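(* Let $(q,b,N)$ be any one of the following four triples: \[ (1,3,6),\quad (1,4,8),\quad (2,3,12),\quad (3,3,16). \] Then for every integer $d\ge N$, the $q$-th term $\alpha_q$ of the saturation sequence of $d$ satisfies $\alpha_q>b$.
   Context: The base field is $\mathbf Q$. For binary forms $A,B$ in $x_1,x_2$ of orders $p,q$ (with coefficients in any commutative $\mathbf Q$-algebra), the $r$-th transvectant is \[ (A,B)_r = \frac{(p-r)!\,(q-r)!}{p!\,q!}\sum_{i=0}^r (-1)^i\binom{r}{i}\frac{\partial^r A}{\partial x_1^{r-i}\partial x_2^i}\,\frac{\partial^r B}{\partial x_1^i\partial x_2^{r-i}} \] for $0\le r\le \min(p,q)$; it has order $p+q-2r$ in $x_1,x_2$. For an integer $d\ge 4$, let $R=\mathbf Q[a_0,\dots,a_d]$ with its standard grading, and let $\mathbb F=\sum_{i=0}^d\binom{d}{i}a_i x_1^{d-i}x_2^i$ be the generic binary form of order $d$. Let $e_d=\lfloor d/2\rfloor$ and, for $1\le q\le e_d$, let $\mathbb H_{2q}=(\mathbb F,\mathbb F)_{2q}$, a form of order $2d-4q$ in $x_1,x_2$ whose coefficients lie in $R_2$. Let $J_{2q}\subseteq R$ be the ideal generated by all the coefficients (with respect to $x_1,x_2$) of $\mathbb H_2,\mathbb H_4,\dots,\mathbb H_{2q}$. Then $J_2\subseteq J_4\subseteq\dots\subseteq J_{2e_d}=I_C$, where $I_C$ is the homogeneous ideal of the rational normal curve of degree $d$ in $\mathbf P^d$. It is known that the saturation of $J_2$ is $I_C$, so all the $J_{2q}$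 agree in sufficiently high degrees. For $1\le q\le e_d-1$ define \[ \alpha_q=\min\{m : (J_{2q})_t=(J_{2q+2})_t \text{ for all } t\ge m\}, \] where the subscript $t$ denotes the degree-$t$ graded piece. The sequence $(\alpha_1,\dots,\alpha_{e_d-1})$ is called the saturation sequence of $d$. *)

theory Defs
  imports
    "HOL-Library.Poly_Mapping"
    "HOL-Computational_Algebra.Polynomial"
    "HOL-Algebra.Ideal"
begin

hide_const (open) Polynomial.degree Polynomial.order

text \<open>
  Polynomials over the rationals in variables indexed by the natural numbers; the keys are the
  exponent vectors of the monomials. The ring in the variables with indices \<open>0, \<dots>, d\<close> is carved out
  of this type by an explicit carrier.
\<close>

type_synonym mpoly = "(nat \<Rightarrow>\<^sub>0 nat) \<Rightarrow>\<^sub>0 rat"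

definition mvar :: "nat \<Rightarrow> mpoly" where
  "mvar i = Poly_Mapping.single (Poly_Mapping.single i 1) 1"

definition mconst :: "rat \<Rightarrow> mpoly" where
  "mconst c = Poly_Mapping.single 0 c"

definition monom_degree :: "(nat \<Rightarrow>\<^sub>0 nat) \<Rightarrow> nat" where
  "monom_degree m = (\<Sum>i\<in>Poly_Mapping.keys m. Poly_Mapping.lookup m i)"

definition poly_carrier :: "nat \<Rightarrow> mpoly set" where
  "poly_carrier d = {p. \<forall>m\<in>Poly_Mapping.keys p. Poly_Mapping.keys m \<subseteq> {0..d}}"

definition poly_ring :: "nat \<Rightarrow> mpoly ring" where
  "poly_ring d = \<lparr>carrier = poly_carrier d, mult = (*), one = 1, zero = 0, add = (+)\<rparr>"

definition graded_piece :: "nat \<Rightarrow> nat \<Rightarrow> mpoly set" where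
  "graded_piece d t = {p \<in> poly_carrier d. \<forall>m\<in>Poly_Mapping.keys p. monom_degree m = t}"

text \<open>
  Polynomials in \<open>x\<^sub>1, x\<^sub>2\<close> with coefficients in \<^typ>\<open>mpoly\<close>: the inner variable is \<open>x\<^sub>1\<close>, the outer one
  is \<open>x\<^sub>2\<close>. The order of a form is not recoverable from the polynomial (the zero polynomial is a
  form of every order), so it is an explicit argument of the transvectant.
\<close>

type_synonym bpoly = "mpoly poly poly"

definition x1 :: bpoly where
  "x1 = [:[:0, 1:]:]"

definition x2 :: bpoly where
  "x2 = [:0, 1:]"

definition bconst :: "mpoly \<Rightarrow> bpoly" where
  "bconst c = [:[:c:]:]"

definition dx1 :: "bpoly \<Rightarrow> bpoly" where
  "dx1 A = map_poly pderiv A"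

definition dx2 :: "bpoly \<Rightarrow> bpoly" where
  "dx2 A = pderiv A"

text \<open>
  \<open>transvectant p q r A B\<close> is \<open>(A, B)\<^sub>r\<close> for forms \<open>A\<close> of order \<open>p\<close> and \<open>B\<close> of order \<open>q\<close>; it is meaningful
  only for \<open>r \<le> min p q\<close>.
\<close>

definition transvectant :: "nat \<Rightarrow> nat \<Rightarrow> nat \<Rightarrow> bpoly \<Rightarrow> bpoly \<Rightarrow> bpoly" where
  "transvectant p q r A B =
     bconst (mconst (fact (p - r) * fact (q - r) / (fact p * fact q))) *
     (\<Sum>i=0..r. (- 1) ^ i * of_nat (r choose i) *
        (dx1 ^^ (r - i)) ((dx2 ^^ i) A) * (dx1 ^^ i) ((dx2 ^^ (r - i)) B))"

definition generic_form :: "nat \<Rightarrow> bpoly" where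
  "generic_form d = (\<Sum>i=0..d. of_nat (d choose i) * bconst (mvar i) * x1 ^ (d - i) * x2 ^ i)"

text \<open>\<open>H d k\<close> is \<open>\<bbbH>\<^bsub>2k\<^esub>\<close> and \<open>J d k\<close> is \<open>J\<^bsub>2k\<^esub>\<close>: the index is halved.\<close>

definition H :: "nat \<Rightarrow> nat \<Rightarrow> bpoly" where
  "H d k = transvectant d d (2 * k) (generic_form d) (generic_form d)"

definition J_gens :: "nat \<Rightarrow> nat \<Rightarrow> mpoly set" where
  "J_gens d q = {coeff (coeff (H d k) j) i | k i j. 1 \<le> k \<and> k \<le> q}"

definition J :: "nat \<Rightarrow> nat \<Rightarrow> mpoly set" where
  "J d q = genideal (poly_ring d) (J_gens d q)"

definition J_piece :: "nat \<Rightarrow> nat \<Rightarrow> nat \<Rightarrow> mpoly set" where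
  "J_piece d q t = J d q \<inter> graded_piece d t"

text \<open>Meaningful for \<open>1 \<le> q \<le> d div 2 - 1\<close>.\<close>

definition alpha :: "nat \<Rightarrow> nat \<Rightarrow> nat" where
  "alpha d q = (LEAST m. \<forall>t\<ge>m. J_piece d q t = J_piece d (q + 1) t)"


text \<open>
  The library operator \<^const>\<open>genideal\<close> intersects all ideals containing the generators, so it is
  the generated ideal only if \<^term>\<open>poly_ring d\<close> is a ring whose carrier contains them.
\<close>

lemma poly_carrier_0: "0 \<in> poly_carrier d"
  by (simp add: poly_carrier_def)

lemma poly_carrier_1: "1 \<in> poly_carrier d"
  by (simp add: poly_carrier_def)

lemma poly_carrier_mconst: "mconst c \<in> poly_carrier d"
  by (simp add: poly_carrier_def mconst_def)

lemma poly_carrier_mvar: "i \<le> d \<Longrightarrow> mvar i \<in> poly_carrier d"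
  by (simp add: poly_carrier_def mvar_def)

lemma poly_carrier_add: "p \<in> poly_carrier d \<Longrightarrow> q \<in> poly_carrier d \<Longrightarrow> p + q \<in> poly_carrier d"
  unfolding poly_carrier_def using Poly_Mapping.keys_add[of p q] by blast

lemma poly_carrier_uminus: "p \<in> poly_carrier d \<Longrightarrow> - p \<in> poly_carrier d"
  by (simp add: poly_carrier_def)

lemma poly_carrier_mult:
  assumes "p \<in> poly_carrier d" "q \<in> poly_carrier d"
  shows "p * q \<in> poly_carrier d"
  unfolding poly_carrier_def
proof (intro CollectI ballI)
  fix m assume "m \<in> Poly_Mapping.keys (p * q)"
  then obtain a b where ab: "m = a + b" "a \<in> Poly_Mapping.keys p" "b \<in> Poly_Mapping.keys q"
    using keys_mult[of p q] by blast
  have "Poly_Mapping.keys m \<subseteq> Poly_Mapping.keys a \<union> Poly_Mapping.keys b"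
    using Poly_Mapping.keys_add[of a b] ab(1) by simp
  with ab assms show "Poly_Mapping.keys m \<subseteq> {0..d}"
    unfolding poly_carrier_def by blast
qed

lemma poly_carrier_sum:
  "(\<And>i. i \<in> A \<Longrightarrow> f i \<in> poly_carrier d) \<Longrightarrow> sum f A \<in> poly_carrier d"
  by (induction A rule: infinite_finite_induct) (auto intro: poly_carrier_0 poly_carrier_add)

lemma poly_carrier_of_nat: "of_nat n \<in> poly_carrier d"
  by (induction n) (auto intro: poly_carrier_0 poly_carrier_1 poly_carrier_add)

lemma poly_ring_cring: "cring (poly_ring d)"
proof (rule cringI)
  show "abelian_group (poly_ring d)"
  proof (rule abelian_groupI)
    fix x assume "x \<in> carrier (poly_ring d)"
    then show "\<exists>y\<in>carrier (poly_ring d). y \<oplus>\<^bsub>poly_ring d\<^esub> x = \<zero>\<^bsub>poly_ring d\<^esub>"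
      by (intro bexI[of _ "- x"]) (auto simp: poly_ring_def poly_carrier_uminus)
  qed (auto simp: poly_ring_def poly_carrier_0 poly_carrier_add algebra_simps)
  show "Group.comm_monoid (poly_ring d)"
    by (rule comm_monoidI)
      (auto simp: poly_ring_def poly_carrier_1 poly_carrier_mult algebra_simps)
qed (auto simp: poly_ring_def algebra_simps)

definition bcarrier :: "nat \<Rightarrow> bpoly set" where
  "bcarrier d = {A. \<forall>i j. coeff (coeff A j) i \<in> poly_carrier d}"

lemma bcarrier_bconst: "c \<in> poly_carrier d \<Longrightarrow> bconst c \<in> bcarrier d"
  by (auto simp: bcarrier_def bconst_def coeff_pCons poly_carrier_0 split: nat.splits)

lemma bcarrier_0: "0 \<in> bcarrier d"
  by (auto simp: bcarrier_def poly_carrier_0)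

lemma bcarrier_1: "1 \<in> bcarrier d"
  using bcarrier_bconst[OF poly_carrier_1, of d] by (simp add: bconst_def flip: one_pCons)

lemma bcarrier_add: "A \<in> bcarrier d \<Longrightarrow> B \<in> bcarrier d \<Longrightarrow> A + B \<in> bcarrier d"
  by (auto simp: bcarrier_def poly_carrier_add)

lemma bcarrier_uminus: "A \<in> bcarrier d \<Longrightarrow> - A \<in> bcarrier d"
  by (auto simp: bcarrier_def poly_carrier_uminus)

lemma bcarrier_mult: "A \<in> bcarrier d \<Longrightarrow> B \<in> bcarrier d \<Longrightarrow> A * B \<in> bcarrier d"
  by (auto simp: bcarrier_def coeff_mult coeff_sum intro!: poly_carrier_sum poly_carrier_mult)

lemma bcarrier_sum: "(\<And>i. i \<in> A \<Longrightarrow> f i \<in> bcarrier d) \<Longrightarrow> sum f A \<in> bcarrier d"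
  by (induction A rule: infinite_finite_induct) (auto intro: bcarrier_0 bcarrier_add)

lemma bcarrier_power: "A \<in> bcarrier d \<Longrightarrow> A ^ n \<in> bcarrier d"
  by (induction n) (auto intro: bcarrier_1 bcarrier_mult)

lemma bcarrier_of_nat: "of_nat n \<in> bcarrier d"
  by (induction n) (auto intro: bcarrier_0 bcarrier_1 bcarrier_add)

lemma bcarrier_x1: "x1 \<in> bcarrier d"
  by (auto simp: bcarrier_def x1_def coeff_pCons poly_carrier_0 poly_carrier_1 split: nat.splits)

lemma bcarrier_x2: "x2 \<in> bcarrier d"
  by (auto simp: bcarrier_def x2_def coeff_pCons poly_carrier_0 poly_carrier_1 split: nat.splits)

lemma coeff_of_nat_mult_poly: "coeff (of_nat n * p) i = of_nat n * coeff p i"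
  by (induction n) (auto simp: algebra_simps)

lemma bcarrier_dx1: "A \<in> bcarrier d \<Longrightarrow> dx1 A \<in> bcarrier d"
  unfolding bcarrier_def dx1_def
  by (auto simp: coeff_map_poly coeff_pderiv simp del: of_nat_Suc
      intro!: poly_carrier_mult poly_carrier_of_nat)

lemma bcarrier_dx2: "A \<in> bcarrier d \<Longrightarrow> dx2 A \<in> bcarrier d"
  unfolding bcarrier_def dx2_def
  by (auto simp: coeff_pderiv coeff_of_nat_mult_poly simp del: of_nat_Suc
      intro!: poly_carrier_mult poly_carrier_of_nat)

lemma bcarrier_dx1_pow: "A \<in> bcarrier d \<Longrightarrow> (dx1 ^^ n) A \<in> bcarrier d"
  by (induction n) (auto intro: bcarrier_dx1)

lemma bcarrier_dx2_pow: "A \<in> bcarrier d \<Longrightarrow> (dx2 ^^ n) A \<in> bcarrier d"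
  by (induction n) (auto intro: bcarrier_dx2)

lemma bcarrier_generic_form: "generic_form d \<in> bcarrier d"
  unfolding generic_form_def
  by (intro bcarrier_sum bcarrier_mult bcarrier_power bcarrier_of_nat bcarrier_bconst
      bcarrier_x1 bcarrier_x2 poly_carrier_mvar) auto

lemma bcarrier_transvectant:
  "A \<in> bcarrier d \<Longrightarrow> B \<in> bcarrier d \<Longrightarrow> transvectant p q r A B \<in> bcarrier d"
  unfolding transvectant_def
  by (intro bcarrier_sum bcarrier_mult bcarrier_power bcarrier_of_nat bcarrier_bconst
      bcarrier_uminus bcarrier_1 bcarrier_dx1_pow bcarrier_dx2_pow poly_carrier_mconst)

lemma J_gens_carrier: "J_gens d q \<subseteq> carrier (poly_ring d)"
  using bcarrier_transvectant[OF bcarrier_generic_form bcarrier_generic_form]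
  by (auto simp: J_gens_def H_def bcarrier_def poly_ring_def)

lemma J_ideal: "ideal (J d q) (poly_ring d)"
  unfolding J_def
  by (rule ring.genideal_ideal[OF cring.axioms(1)[OF poly_ring_cring] J_gens_carrier])

end

theory Submission
  imports Defs
begin

text \<open>
  Symbolically \<open>\<bbbH>\<^bsub>2k\<^esub>\<close> is \<open>(z\<^sub>2 - z\<^sub>1)\<^bsup>2k\<^esup> (1 + z\<^sub>1)\<^bsup>d-2k\<^esup> (1 + z\<^sub>2)\<^bsup>d-2k\<^esup>\<close>, where
  \<open>z\<^sub>1\<^sup>i z\<^sub>2\<^sup>j\<close> stands for \<open>a\<^sub>i a\<^sub>j\<close>.

  Lower bound: a linear functional on forms of degree \<open>b\<close> is a symmetric polynomial \<open>g\<close> in \<open>y\<^sub>1, \<dots>, y\<^sub>b\<close> of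
  degree at most \<open>d\<close> in each variable. It kills the multiples of the coefficients of \<open>\<bbbH>\<^bsub>2k\<^esub>\<close> iff a
  certain differential operator of order \<open>2k\<close> in \<open>y\<^sub>1, y\<^sub>2\<close> annihilates \<open>g\<close> on \<open>y\<^sub>1 = y\<^sub>2\<close>. So the
  power \<open>2q + 2\<close> of the Vandermonde product vanishes on \<open>J\<^bsub>2q\<^esub>\<close> but not on \<open>J\<^bsub>2q+2\<^esub>\<close>. The
  small values of \<open>d\<close> that its degree excludes are settled by symmetric polynomials built from the
  resolvent cubic of a quartic.

  The pieces do agree eventually (otherwise \<open>LEAST\<close> would be meaningless): modulo \<open>J\<^sub>2\<close> and after inverting
  \<open>a\<^sub>0\<close>, the Hessian forces \<open>a\<^sub>w = a\<^sub>0 (a\<^sub>1 / a\<^sub>0)\<^sup>w\<close>, so that a power of \<open>a\<^sub>0\<close> multiplies every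
  coefficient of every \<open>\<bbbH>\<^bsub>2k\<^esub>\<close> into \<open>J\<^sub>2\<close>; the same holds for \<open>a\<^sub>d\<close> by symmetry, and for the other
  \<open>a\<^sub>i\<close> because they are nilpotent modulo \<open>J\<^sub>2\<close> and \<open>a\<^sub>0\<close>.
\<close>

section \<open>Coefficients of the transvectants\<close>

text \<open>Symmetry forces an even power of the Vandermonde product, and the power
  \<open>2q + 2\<close> has degree \<open>(b - 1)(2q + 2)\<close> in each variable. For
  \<open>q = 1\<close> this leaves \<open>d = 6, 7\<close> open if \<open>b = 3\<close> and
  \<open>d = 8, ..., 11\<close> if \<open>b = 4\<close>. There, vanishing to order 4 on the diagonal
  asks too much: only the second-order equation of the Hessian has to hold, and the fourth-order one
  has to fail. Candidates in four points are the invariants of binary quartics, built from one of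
  degree 2, one of degree 3 and the discriminant of degree 6; an invariant of degree
  \<open>d\<close> has degree \<open>d\<close> in each root. The second-order operator sends the two
  candidates that are combined to multiples of one and the same polynomial, so one scalar equation
  fixes the combination. The order \<open>d = 6\<close> inherits \<open>b = 3\<close> from
  \<open>b = 4\<close>. The order 7 admits no such pair of invariants; only \<open>b = 3\<close> is
  asked there, and three points with a polynomial of degree 6 in each suffice.\<close>

lemma mconst_0: "mconst 0 = 0"
  by (simp add: mconst_def)

lemma mconst_1: "mconst 1 = 1"
  by (simp add: mconst_def)

lemma mconst_add: "mconst (a + b) = mconst a + mconst b"
  by (simp add: mconst_def single_add)

lemma mconst_mult: "mconst (a * b) = mconst a * mconst b"
  by (simp add: mconst_def mult_single)

lemma mconst_uminus: "mconst (- a) = - mconst a"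
  by (simp add: mconst_def single_uminus)

lemma mconst_sum: "mconst (sum f A) = (\<Sum>x\<in>A. mconst (f x))"
  by (induction A rule: infinite_finite_induct) (auto simp: mconst_0 mconst_add)

lemma mconst_of_nat: "mconst (of_nat n) = of_nat n"
  by (induction n) (auto simp: mconst_0 mconst_1 mconst_add)

lemma coeff2_monom: "coeff (coeff (monom (monom c a) b) j) i = (if i = a \<and> j = b then c else 0)"
  by auto

lemma coeff_generic_form:
  "coeff (coeff (generic_form d) j) i = (if i + j = d then of_nat (d choose j) * mvar j else 0)"
proof -
  have x1: "x1 ^ a = [:monom 1 a:]" for a
  proof -
    have "x1 = [:monom 1 1:]" by (simp add: x1_def monom_altdef)
    moreover have "[:p:] ^ a = [:p ^ a:]" for p :: "mpoly poly"
      by (induction a) (auto simp: one_pCons)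
    ultimately have "x1 ^ a = [:monom 1 1 ^ a:]" by metis
    then show ?thesis by (simp add: monom_power)
  qed
  have x2: "x2 ^ b = monom 1 b" for b
  proof -
    have "x2 = monom 1 1" by (simp add: x2_def monom_altdef)
    then have "x2 ^ b = monom 1 1 ^ b" by metis
    then show ?thesis by (simp add: monom_power)
  qed
  have "of_nat n * bconst c * x1 ^ a * x2 ^ b = monom (monom (of_nat n * c) a) b" for n c a b
    unfolding x1 x2 bconst_def
    by (simp add: of_nat_poly smult_monom)
  then have "generic_form d = (\<Sum>k=0..d. monom (monom (of_nat (d choose k) * mvar k) (d - k)) k)"
    by (simp add: generic_form_def)
  then have "coeff (coeff (generic_form d) j) i =
      (\<Sum>k=0..d. if i = d - k \<and> j = k then of_nat (d choose k) * mvar k else 0)"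
    by (simp only: coeff_sum coeff2_monom)
  also have "\<dots> = (\<Sum>k=0..d. if k = j then (if i = d - k then of_nat (d choose k) * mvar k else 0) else 0)"
    by (rule sum.cong) auto
  also have "\<dots> = (if i + j = d then of_nat (d choose j) * mvar j else 0)"
    by (subst sum.delta) auto
  finally show ?thesis .
qed

lemma coeff_dx1_pow:
  "coeff (coeff ((dx1 ^^ n) A) j) i = of_nat (pochhammer (Suc i) n) * coeff (coeff A j) (i + n)"
proof (induction n arbitrary: i)
  case (Suc n)
  have "coeff (coeff ((dx1 ^^ Suc n) A) j) i = of_nat (Suc i) * coeff (coeff ((dx1 ^^ n) A) j) (Suc i)"
    by (simp add: dx1_def coeff_map_poly coeff_pderiv del: of_nat_Suc)
  then show ?case by (simp only: Suc.IH pochhammer_rec of_nat_mult mult.assoc add_Suc add_Suc_right Suc_eq_plus1[symmetric])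
qed simp

lemma coeff_dx2_pow:
  "coeff (coeff ((dx2 ^^ n) A) j) i = of_nat (pochhammer (Suc j) n) * coeff (coeff A (j + n)) i"
proof (induction n arbitrary: j)
  case (Suc n)
  have "coeff (coeff ((dx2 ^^ Suc n) A) j) i = of_nat (Suc j) * coeff (coeff ((dx2 ^^ n) A) (Suc j)) i"
    by (simp add: dx2_def coeff_pderiv coeff_of_nat_mult_poly del: of_nat_Suc)
  then show ?case by (simp only: Suc.IH pochhammer_rec of_nat_mult mult.assoc add_Suc add_Suc_right Suc_eq_plus1[symmetric])
qed simp

lemma fact_mult_pochhammer_Suc: "fact i * pochhammer (Suc i) n = (fact (i + n) :: nat)"
proof (induction n)
  case (Suc n)
  then show ?case
    by (simp add: pochhammer_Suc algebra_simps flip: Suc.IH)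
qed simp

text \<open>An \<open>r\<close>-th derivative of the generic form is again a generic form, of order
  \<open>d - r\<close>, with all indices shifted by \<open>l\<close>. The scalar factor does not
  depend on \<open>l\<close> and can be taken out of the transvectant.\<close>

lemma coeff_dx_generic_form:
  assumes "l \<le> r" "r \<le> d"
  shows "coeff (coeff ((dx1 ^^ (r - l)) ((dx2 ^^ l) (generic_form d))) j) i =
    (if i + j = d - r then mconst (fact d / fact (d - r) * of_nat ((d - r) choose j)) * mvar (j + l) else 0)"
proof (cases "i + j = d - r")
  case True
  define N where "N = pochhammer (Suc i) (r - l) * pochhammer (Suc j) l * (d choose (j + l))"
  have "fact i * fact j * N = fact (i + (r - l)) * (fact (j + l) * (d choose (j + l)))"
    by (simp add: N_def flip: fact_mult_pochhammer_Suc)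
  moreover have "i + (r - l) = d - (j + l)" using True assms by auto
  ultimately have "fact i * fact j * N = fact d"
    using binomial_fact_lemma[of "j + l" d] True assms by (simp add: algebra_simps)
  then have 1: "fact i * fact j * (of_nat N :: rat) = fact d"
    by (metis of_nat_fact of_nat_mult)
  have "fact j * fact (d - r - j) * (d - r choose j) = fact (d - r)"
    using binomial_fact_lemma[of j "d - r"] True by simp
  moreover have "d - r - j = i" using True by simp
  ultimately have 2: "fact j * fact i * (of_nat (d - r choose j) :: rat) = fact (d - r)"
    by (metis of_nat_fact of_nat_mult)
  have "of_nat N = (fact d / fact (d - r) * of_nat ((d - r) choose j) :: rat)"
    unfolding 1[symmetric] 2[symmetric] using 2 by (auto simp: field_simps)
  then have 3: "of_nat N = mconst (fact d / fact (d - r) * of_nat ((d - r) choose j))"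
    by (metis mconst_of_nat)
  have "i + (r - l) + (j + l) = d" using True assms by auto
  then have "coeff (coeff ((dx1 ^^ (r - l)) ((dx2 ^^ l) (generic_form d))) j) i = of_nat N * mvar (j + l)"
    by (simp add: coeff_dx1_pow coeff_dx2_pow coeff_generic_form N_def mult.assoc)
  with 3 True show ?thesis by simp
next
  case False
  then have "i + (r - l) + (j + l) \<noteq> d" using assms by auto
  with False show ?thesis
    by (simp add: coeff_dx1_pow coeff_dx2_pow coeff_generic_form)
qed

lemma coeff2_mult:
  "coeff (coeff (A * B) j) i =
    (\<Sum>p\<le>j. \<Sum>u\<le>i. coeff (coeff A p) u * coeff (coeff B (j - p)) (i - u))"
  by (simp add: coeff_mult coeff_sum)

text \<open>In a form one exponent determines the other, so the double convolution collapses to a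
  single one.\<close>

lemma coeff_mult_homogeneous:
  fixes A B :: "'a::comm_ring_1 poly poly"
  assumes A: "\<And>j i. coeff (coeff A j) i = (if i + j = n then f j else 0)"
    and B: "\<And>j i. coeff (coeff B j) i = (if i + j = n then g j else 0)"
    and f: "\<And>j. j > n \<Longrightarrow> f j = 0" and g: "\<And>j. j > n \<Longrightarrow> g j = 0"
  shows "coeff (coeff (A * B) j) i = (if i + j = 2 * n then \<Sum>p\<le>j. f p * g (j - p) else 0)"
proof -
  have "(\<Sum>u\<le>i. coeff (coeff A p) u * coeff (coeff B (j - p)) (i - u)) =
      (if i + j = 2 * n then f p * g (j - p) else 0)" if "p \<le> j" for p
  proof -
    have "(\<Sum>u\<le>i. coeff (coeff A p) u * coeff (coeff B (j - p)) (i - u)) =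
        (\<Sum>u\<le>i. if u = n - p then (if p \<le> n \<and> i - u + (j - p) = n then f p * g (j - p) else 0) else 0)"
    proof (rule sum.cong)
      fix u
      show "coeff (coeff A p) u * coeff (coeff B (j - p)) (i - u) =
          (if u = n - p then (if p \<le> n \<and> i - u + (j - p) = n then f p * g (j - p) else 0) else 0)"
      proof (cases "u + p = n")
        case True
        then have "u = n - p" "p \<le> n" by auto
        with True show ?thesis by (simp add: A B)
      qed (auto simp: A)
    qed simp
    also have "\<dots> = (if n - p \<le> i \<and> p \<le> n \<and> i - (n - p) + (j - p) = n then f p * g (j - p) else 0)"
      by (subst sum.delta) auto
    also have "\<dots> = (if i + j = 2 * n then f p * g (j - p) else 0)"
    proof (cases "p \<le> n \<and> j - p \<le> n")
      case True
      with that show ?thesis by auto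
    next
      case False
      then have "f p * g (j - p) = 0" using f g by (metis leI mult_zero_left mult_zero_right)
      then show ?thesis by simp
    qed
    finally show ?thesis .
  qed
  then have "coeff (coeff (A * B) j) i = (\<Sum>p\<le>j. if i + j = 2 * n then f p * g (j - p) else 0)"
    unfolding coeff2_mult by (intro sum.cong) auto
  then show ?thesis by simp
qed

text \<open>
  \<open>hcoef d k i j\<close> is the coefficient of \<open>z\<^sub>1\<^sup>i z\<^sub>2\<^sup>j\<close> in
  \<open>(z\<^sub>2 - z\<^sub>1)\<^bsup>2k\<^esup> (1 + z\<^sub>1)\<^bsup>d-2k\<^esup> (1 + z\<^sub>2)\<^bsup>d-2k\<^esup>\<close>, the symbolic form of \<open>\<bbbH>\<^bsub>2k\<^esub>\<close>.
\<close>

definition hcoef :: "nat \<Rightarrow> nat \<Rightarrow> nat \<Rightarrow> nat \<Rightarrow> rat" where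
  "hcoef d k i j = (\<Sum>l\<le>2 * k. (-1) ^ l * of_nat (2 * k choose l) *
     (if l \<le> i then of_nat (d - 2 * k choose (i - l)) else 0) *
     (if 2 * k - l \<le> j then of_nat (d - 2 * k choose (j - (2 * k - l))) else 0))"

text \<open>The argument \<open>w\<close> is the weight, the common index sum of the monomials; it
  exceeds the exponent of \<open>x2\<close> in the transvectant by \<open>2 * k\<close>.\<close>

definition quadric :: "nat \<Rightarrow> nat \<Rightarrow> nat \<Rightarrow> mpoly" where
  "quadric d k w = (\<Sum>u\<le>w. mconst (hcoef d k u (w - u)) * mvar u * mvar (w - u))"

lemma coeff_H:
  assumes "2 * k \<le> d"
  shows "coeff (coeff (H d k) m) i = (if i + m = 2 * (d - 2 * k) then quadric d k (m + 2 * k) else 0)"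
proof -
  define r where "r = 2 * k"
  define n where "n = d - r"
  define K :: rat where "K = fact d / fact n"
  define E where "E l = (dx1 ^^ (r - l)) ((dx2 ^^ l) (generic_form d))" for l
  define e where "e l j = mconst (K * of_nat (n choose j)) * mvar (j + l)" for l j
  have rd: "r \<le> d" using assms by (simp add: r_def)
  have E: "coeff (coeff (E l) j) i = (if i + j = n then e l j else 0)" if "l \<le> r" for l i j
    unfolding E_def e_def K_def n_def using coeff_dx_generic_form[OF that rd] by simp
  have e0: "e l j = 0" if "j > n" for l j
    using that by (simp add: e_def binomial_eq_0 mconst_0)
  have EE: "coeff (coeff (E l * E (r - l)) m) i =
      (if i + m = 2 * n then \<Sum>p\<le>m. e l p * e (r - l) (m - p) else 0)" if "l \<le> r" for l
    using coeff_mult_homogeneous[OF E E e0 e0, of l "r - l" m i] that by simp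
  have H: "H d k = bconst (mconst (1 / K\<^sup>2)) *
      (\<Sum>l\<le>r. bconst (mconst ((-1) ^ l * of_nat (r choose l))) * (E l * E (r - l)))"
  proof -
    have "bconst (mconst ((-1) ^ l * of_nat (r choose l))) = (-1) ^ l * of_nat (r choose l)" for l
      by (cases "even l")
        (auto simp: mconst_of_nat bconst_def of_nat_poly mconst_uminus)
    moreover have "1 / K\<^sup>2 = fact (d - r) * fact (d - r) / (fact d * fact d)"
      by (simp add: K_def n_def power2_eq_square)
    ultimately show ?thesis
      unfolding H_def transvectant_def r_def[symmetric] E_def
      by (auto simp: atLeast0AtMost mult.assoc intro!: sum.cong)
  qed
  have coeff_bconst: "coeff (coeff (bconst c * A) j) i = c * coeff (coeff A j) i" for c A j i
    by (simp add: bconst_def)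
  have "coeff (coeff (H d k) m) i = mconst (1 / K\<^sup>2) *
      (\<Sum>l\<le>r. mconst ((-1) ^ l * of_nat (r choose l)) * coeff (coeff (E l * E (r - l)) m) i)"
    unfolding H coeff_bconst by (simp add: coeff_sum coeff_bconst)
  also have "\<dots> = (if i + m = 2 * n then quadric d k (m + r) else 0)"
  proof (cases "i + m = 2 * n")
    case True
    have K0: "K \<noteq> 0" by (simp add: K_def)
    \<comment> \<open>The substitution \<open>u = p + l\<close> makes the summation range
      independent of \<open>l\<close>, so that the two sums can be interchanged.\<close>
    have inner: "(\<Sum>p\<le>m. e l p * e (r - l) (m - p)) =
        (\<Sum>u\<le>m + r. mconst (K\<^sup>2 * ((if l \<le> u then of_nat (n choose (u - l)) else 0) *
           (if r - l \<le> m + r - u then of_nat (n choose (m + r - u - (r - l))) else 0))) *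
           (mvar u * mvar (m + r - u)))"
      (is "_ = (\<Sum>u\<le>m + r. ?t u)") if "l \<le> r" for l
    proof -
      have "(\<Sum>u\<le>m + r. ?t u) = (\<Sum>u\<in>(\<lambda>p. p + l) ` {..m}. ?t u)"
      proof (rule sum.mono_neutral_right)
        show "\<forall>u\<in>{..m + r} - (\<lambda>p. p + l) ` {..m}. ?t u = 0"
        proof
          fix u assume u: "u \<in> {..m + r} - (\<lambda>p. p + l) ` {..m}"
          have "\<not> (l \<le> u \<and> u - l \<le> m)"
          proof
            assume "l \<le> u \<and> u - l \<le> m"
            then have "u = (u - l) + l" "u - l \<in> {..m}" by auto
            with u show False by blast
          qed
          with that u show "?t u = 0" by (auto simp: mconst_0)
        qed
      qed (use that in auto)
      also have "\<dots> = (\<Sum>p\<le>m. ?t (p + l))"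
        by (subst sum.reindex) auto
      also have "\<dots> = (\<Sum>p\<le>m. e l p * e (r - l) (m - p))"
      proof (rule sum.cong)
        fix p assume "p \<in> {..m}"
        then have *: "m + r - (p + l) = m - p + (r - l)" using that by auto
        have "?t (p + l) = mconst (K\<^sup>2 * (of_nat (n choose p) * of_nat (n choose (m - p)))) *
            (mvar (p + l) * mvar (m - p + (r - l)))"
          unfolding * by simp
        then show "?t (p + l) = e l p * e (r - l) (m - p)"
          unfolding e_def by (simp only: mconst_mult power2_eq_square ac_simps)
      qed simp
      finally show ?thesis by simp
    qed
    have "mconst (1 / K\<^sup>2) *
        (\<Sum>l\<le>r. mconst ((-1) ^ l * of_nat (r choose l)) * coeff (coeff (E l * E (r - l)) m) i) =
      (\<Sum>l\<le>r. \<Sum>u\<le>m + r. mconst ((-1) ^ l * of_nat (r choose l) *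
           (if l \<le> u then of_nat (n choose (u - l)) else 0) *
           (if r - l \<le> m + r - u then of_nat (n choose (m + r - u - (r - l))) else 0)) *
           (mvar u * mvar (m + r - u)))"
      unfolding sum_distrib_left
    proof (rule sum.cong)
      fix l assume "l \<in> {..r}"
      then have l: "l \<le> r" by simp
      have "mconst (1 / K\<^sup>2) * (mconst ((-1) ^ l * of_nat (r choose l)) * coeff (coeff (E l * E (r - l)) m) i)
        = (\<Sum>u\<le>m + r. mconst (1 / K\<^sup>2 * ((-1) ^ l * of_nat (r choose l) * (K\<^sup>2 * ((if l \<le> u then of_nat (n choose (u - l)) else 0) *
           (if r - l \<le> m + r - u then of_nat (n choose (m + r - u - (r - l))) else 0))))) *
           (mvar u * mvar (m + r - u)))"
        unfolding EE[OF l] if_P[OF True]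
        by (simp only: inner[OF l] sum_distrib_left mconst_mult mult.assoc)
      also have "\<dots> = (\<Sum>u\<le>m + r. mconst ((-1) ^ l * of_nat (r choose l) *
           (if l \<le> u then of_nat (n choose (u - l)) else 0) *
           (if r - l \<le> m + r - u then of_nat (n choose (m + r - u - (r - l))) else 0)) *
           (mvar u * mvar (m + r - u)))"
      proof -
        have "1 / K\<^sup>2 * (a * (K\<^sup>2 * (b * c))) = a * b * c" for a b c :: rat
          using K0 by simp
        then show ?thesis by (simp only:)
      qed
      finally show "mconst (1 / K\<^sup>2) * (mconst ((-1) ^ l * of_nat (r choose l)) * coeff (coeff (E l * E (r - l)) m) i)
        = (\<Sum>u\<le>m + r. mconst ((-1) ^ l * of_nat (r choose l) *
           (if l \<le> u then of_nat (n choose (u - l)) else 0) *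
           (if r - l \<le> m + r - u then of_nat (n choose (m + r - u - (r - l))) else 0)) *
           (mvar u * mvar (m + r - u)))" .
    qed simp
    also have "\<dots> = quadric d k (m + r)"
      unfolding quadric_def hcoef_def r_def[symmetric] n_def[symmetric]
      by (subst sum.swap) (simp add: mconst_sum sum_distrib_right mult.assoc)
    finally show ?thesis using True by simp
  qed (simp add: EE)
  finally show ?thesis by (simp add: r_def n_def)
qed

text \<open>Since \<open>i choose l\<close> is the eigenvalue of
  \<open>y^l \<partial>^l / l!\<close> on \<open>y^i\<close>, this is the symbol of a differential
  operator of order \<open>2k\<close> in two variables.\<close>

definition ecoef :: "nat \<Rightarrow> nat \<Rightarrow> nat \<Rightarrow> nat \<Rightarrow> rat" where
  "ecoef d k i j = (\<Sum>l\<le>2 * k. (-1) ^ l * of_nat (2 * k choose l) *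
     (of_nat (i choose l) * of_nat (j choose (2 * k - l)) /
      (of_nat (d choose l) * of_nat (d choose (2 * k - l)))))"

section \<open>Generating polynomials in two variables\<close>

definition tensor :: "rat poly \<Rightarrow> rat poly \<Rightarrow> rat poly poly" where
  "tensor p q = map_poly (\<lambda>c. smult c q) p"

lemma coeff_tensor: "coeff (coeff (tensor p q) i) j = coeff p i * coeff q j"
  by (simp add: tensor_def coeff_map_poly)

lemma poly2_eqI:
  assumes "\<And>i j. coeff (coeff P i) j = coeff (coeff Q i) j"
  shows "P = Q"
  using assms by (intro poly_eqI) auto

lemma tensor_mult: "tensor p q * tensor p' q' = tensor (p * p') (q * q')"
proof (rule poly2_eqI)
  fix i j
  have "coeff (coeff (tensor p q * tensor p' q') i) j =
      (\<Sum>a\<le>i. \<Sum>b\<le>j. coeff p a * coeff p' (i - a) * (coeff q b * coeff q' (j - b)))"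
    unfolding coeff2_mult coeff_tensor by (simp only: ac_simps)
  then show "coeff (coeff (tensor p q * tensor p' q') i) j = coeff (coeff (tensor (p * p') (q * q')) i) j"
    by (simp only: coeff_tensor coeff_mult sum_product)
qed

lemma tensor_1: "tensor 1 1 = 1"
  by (rule poly2_eqI) (auto simp: coeff_tensor)

lemma tensor_power: "tensor p q ^ n = tensor (p ^ n) (q ^ n)"
  by (induction n) (auto simp: tensor_1 tensor_mult)

abbreviation X :: "rat poly" where "X \<equiv> [:0, 1:]"
abbreviation X1 :: "rat poly" where "X1 \<equiv> [:1, 1:]"

definition hpoly :: "nat \<Rightarrow> nat \<Rightarrow> rat poly poly" where
  "hpoly d k = (tensor 1 X - tensor X 1) ^ (2 * k) * tensor (X1 ^ (d - 2 * k)) (X1 ^ (d - 2 * k))"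

lemma coeff_X_power_mult: "coeff (X ^ l * p) i = (if l \<le> i then coeff p (i - l) else 0)"
proof -
  have "X = monom 1 1" by (simp add: monom_altdef)
  then have "X ^ l = monom 1 1 ^ l" by metis
  then show ?thesis by (simp add: monom_power coeff_monom_mult)
qed

lemma coeff_X1_power: "coeff (X1 ^ n) i = of_nat (n choose i)"
proof (cases "i \<le> n")
  case False
  then have "Polynomial.degree (X1 ^ n) < i" by (simp add: degree_linear_power)
  with False show ?thesis by (simp add: coeff_eq_0 binomial_eq_0)
qed (simp add: coeff_linear_poly_power)

lemma of_nat_tensor: "of_nat c * tensor p q = tensor (of_nat c * p) q"
  by (rule poly2_eqI) (simp add: coeff_tensor of_nat_poly)

lemma minus_one_power_tensor: "(-1) ^ c * tensor p q = tensor ((-1) ^ c * p) q"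
  by (cases "even c") (auto intro: poly2_eqI simp: coeff_tensor)

lemma diff_tensor_power:
  "(tensor a b - tensor p q) ^ n =
     (\<Sum>l\<le>n. tensor ((-1) ^ l * (of_nat (n choose l) * (p ^ l * a ^ (n - l)))) (q ^ l * b ^ (n - l)))"
proof -
  have "(tensor a b - tensor p q) ^ n = (- tensor p q + tensor a b) ^ n" by simp
  also have "\<dots> = (\<Sum>l\<le>n. of_nat (n choose l) * (- tensor p q) ^ l * tensor a b ^ (n - l))"
    by (rule binomial_ring)
  also have "\<dots> = (\<Sum>l\<le>n. (-1) ^ l * (of_nat (n choose l) * (tensor p q ^ l * tensor a b ^ (n - l))))"
    by (rule sum.cong) (auto simp: power_minus[of "tensor p q"] ac_simps)
  finally show ?thesis
    by (simp only: tensor_power tensor_mult of_nat_tensor minus_one_power_tensor)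
qed

lemma coeff_signed_of_nat_mult:
  "coeff ((-1) ^ l * (of_nat c * p)) i = (-1) ^ l * of_nat c * (coeff p i :: 'a::comm_ring_1)"
  by (cases "even l") (simp_all add: of_nat_poly)

lemma coeff_hpoly: "coeff (coeff (hpoly d k) i) j = hcoef d k i j"
  unfolding hpoly_def hcoef_def diff_tensor_power sum_distrib_right tensor_mult coeff_sum coeff_tensor
proof (rule sum.cong)
  fix l
  have "coeff ((- 1) ^ l * (of_nat (2 * k choose l) * (X ^ l * 1 ^ (2 * k - l))) * X1 ^ (d - 2 * k)) i =
      (-1) ^ l * of_nat (2 * k choose l) * (if l \<le> i then of_nat (d - 2 * k choose (i - l)) else 0)"
    by (simp add: mult.assoc coeff_signed_of_nat_mult coeff_X_power_mult coeff_X1_power)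
  moreover have "coeff (1 ^ l * X ^ (2 * k - l) * X1 ^ (d - 2 * k)) j =
     (if 2 * k - l \<le> j then of_nat (d - 2 * k choose (j - (2 * k - l))) else 0)"
    by (simp add: coeff_X_power_mult coeff_X1_power)
  ultimately show "coeff ((- 1) ^ l * (of_nat (2 * k choose l) * (X ^ l * 1 ^ (2 * k - l))) * X1 ^ (d - 2 * k)) i *
      coeff (1 ^ l * X ^ (2 * k - l) * X1 ^ (d - 2 * k)) j =
      (-1) ^ l * of_nat (2 * k choose l) *
     (if l \<le> i then of_nat (d - 2 * k choose (i - l)) else 0) *
     (if 2 * k - l \<le> j then of_nat (d - 2 * k choose (j - (2 * k - l))) else 0)"
    by (simp only:)
qed simp

lemma choose_mult_rat:
  assumes "l \<le> d"
  shows "(if l \<le> i then of_nat (d - l choose (i - l)) else 0) =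
    (of_nat (d choose i) * (of_nat (i choose l) / of_nat (d choose l)) :: rat)"
proof (cases "l \<le> i \<and> i \<le> d")
  case True
  then have "(d choose i) * (i choose l) = (d choose l) * (d - l choose (i - l))"
    by (intro choose_mult) auto
  then have "of_nat (d choose i) * of_nat (i choose l) =
      (of_nat (d choose l) * of_nat (d - l choose (i - l)) :: rat)"
    by (metis of_nat_mult)
  with True assms show ?thesis by (simp add: field_simps)
qed (use assms in \<open>auto simp: binomial_eq_0\<close>)

text \<open>
  The expansion along \<open>z\<^sub>2 - z\<^sub>1 = z\<^sub>2 (1 + z\<^sub>1) - z\<^sub>1 (1 + z\<^sub>2)\<close> lowers the degree of
  \<open>hcoef d k i j / (d choose i) (d choose j)\<close> in \<open>(i, j)\<close> from \<open>4k\<close> to \<open>2k\<close>.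
\<close>

lemma hcoef_eq_ecoef:
  assumes "2 * k \<le> d"
  shows "hcoef d k i j = of_nat (d choose i) * of_nat (d choose j) * ecoef d k i j"
proof -
  have "tensor 1 X - tensor X 1 = tensor X1 X - tensor X X1"
    by (rule poly2_eqI) (auto simp: coeff_tensor coeff_pCons split: nat.splits)
  then have "hpoly d k = (\<Sum>l\<le>2 * k. tensor ((-1) ^ l * (of_nat (2 * k choose l) *
        (X ^ l * X1 ^ (2 * k - l))) * X1 ^ (d - 2 * k)) (X1 ^ l * X ^ (2 * k - l) * X1 ^ (d - 2 * k)))"
    by (simp only: hpoly_def diff_tensor_power sum_distrib_right tensor_mult)
  also have "\<dots> = (\<Sum>l\<le>2 * k. tensor ((-1) ^ l * (of_nat (2 * k choose l) *
        (X ^ l * X1 ^ (d - l)))) (X ^ (2 * k - l) * X1 ^ (d - (2 * k - l))))"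
  proof (rule sum.cong)
    fix l assume "l \<in> {..2 * k}"
    then have "(2 * k - l) + (d - 2 * k) = d - l" "l + (d - 2 * k) = d - (2 * k - l)"
      using assms by auto
    then have e: "X1 ^ (d - l) = X1 ^ (2 * k - l) * X1 ^ (d - 2 * k)"
      "X1 ^ (d - (2 * k - l)) = X1 ^ l * X1 ^ (d - 2 * k)"
      by (metis power_add)+
    show "tensor ((-1) ^ l * (of_nat (2 * k choose l) *
        (X ^ l * X1 ^ (2 * k - l))) * X1 ^ (d - 2 * k)) (X1 ^ l * X ^ (2 * k - l) * X1 ^ (d - 2 * k)) =
      tensor ((-1) ^ l * (of_nat (2 * k choose l) *
        (X ^ l * X1 ^ (d - l)))) (X ^ (2 * k - l) * X1 ^ (d - (2 * k - l)))"
      unfolding e by (simp only: ac_simps)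
  qed simp
  finally have "hcoef d k i j = (\<Sum>l\<le>2 * k.
      coeff ((-1) ^ l * (of_nat (2 * k choose l) * (X ^ l * X1 ^ (d - l)))) i *
      coeff (X ^ (2 * k - l) * X1 ^ (d - (2 * k - l))) j)"
    by (simp only: coeff_hpoly[symmetric] coeff_sum coeff_tensor)
  also have "\<dots> = (\<Sum>l\<le>2 * k. of_nat (d choose i) * of_nat (d choose j) *
     ((-1) ^ l * of_nat (2 * k choose l) * (of_nat (i choose l) * of_nat (j choose (2 * k - l)) /
      (of_nat (d choose l) * of_nat (d choose (2 * k - l))))))"
  proof (rule sum.cong)
    fix l assume "l \<in> {..2 * k}"
    then have l: "l \<le> d" "2 * k - l \<le> d" using assms by auto
    have "coeff ((-1) ^ l * (of_nat (2 * k choose l) * (X ^ l * X1 ^ (d - l)))) i =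
        (-1) ^ l * of_nat (2 * k choose l) * (of_nat (d choose i) * (of_nat (i choose l) / of_nat (d choose l)))"
      by (simp only: coeff_signed_of_nat_mult coeff_X_power_mult coeff_X1_power choose_mult_rat[OF l(1)])
    moreover have "coeff (X ^ (2 * k - l) * X1 ^ (d - (2 * k - l))) j =
        of_nat (d choose j) * (of_nat (j choose (2 * k - l)) / of_nat (d choose (2 * k - l)))"
      by (simp only: coeff_X_power_mult coeff_X1_power choose_mult_rat[OF l(2)])
    ultimately show "coeff ((-1) ^ l * (of_nat (2 * k choose l) * (X ^ l * X1 ^ (d - l)))) i *
      coeff (X ^ (2 * k - l) * X1 ^ (d - (2 * k - l))) j = of_nat (d choose i) * of_nat (d choose j) *
     ((-1) ^ l * of_nat (2 * k choose l) * (of_nat (i choose l) * of_nat (j choose (2 * k - l)) /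
      (of_nat (d choose l) * of_nat (d choose (2 * k - l)))))"
      by simp
  qed simp
  finally show ?thesis by (simp only: ecoef_def sum_distrib_left)
qed

lemma hcoef_eq_0: "2 * k \<le> d \<Longrightarrow> i > d \<or> j > d \<Longrightarrow> hcoef d k i j = 0"
  by (auto simp: hcoef_eq_ecoef)

lemma coeff_diagonal:
  fixes B :: "'a::comm_ring_1 poly poly"
  shows "coeff (poly B [:0, 1:]) w = (\<Sum>i\<le>w. coeff (coeff B i) (w - i))"
proof (induction B arbitrary: w)
  case (pCons a B)
  show ?case
  proof (cases w)
    case (Suc v)
    have "(\<Sum>i\<le>Suc v. coeff (coeff (pCons a B) i) (Suc v - i)) =
        coeff a (Suc v) + (\<Sum>i\<le>v. coeff (coeff B i) (v - i))"
      by (subst sum.atMost_Suc_shift) simp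
    with Suc show ?thesis by (simp add: pCons.IH)
  qed simp
qed simp


text \<open>These sums are the coefficients of the symbolic form on \<open>z1 = z2\<close>, where
  the factor \<open>(z2 - z1)^(2k)\<close> vanishes. Equivalently, all the quadrics vanish on the
  rational normal curve.\<close>

lemma sum_hcoef_eq_0:
  assumes "k > 0"
  shows "(\<Sum>u\<le>w. hcoef d k u (w - u)) = 0"
proof -
  have 1: "tensor 1 X = [:X:]" "tensor X 1 = [:0, 1:]"
    by (rule poly2_eqI, auto simp: coeff_tensor coeff_pCons split: nat.splits)+
  have "poly (hpoly d k) X = 0"
    unfolding hpoly_def 1 using assms by simp
  then show ?thesis by (simp flip: coeff_diagonal coeff_hpoly)
qed

text \<open>Inverting both symbolic variables changes \<open>z2 - z1\<close> by a monomial factor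
  and a sign, and the exponent \<open>2k\<close> is even. In coefficients this is the substitution
  of \<open>2 * k - l\<close> for \<open>l\<close>.\<close>

lemma hcoef_reverse:
  assumes "2 * k \<le> d" "i \<le> d" "j \<le> d"
  shows "hcoef d k (d - i) (d - j) = hcoef d k i j"
proof -
  let ?n = "d - 2 * k"
  have g: "(if l \<le> d - i then of_nat (?n choose (d - i - l)) else 0) =
      (if 2 * k - l \<le> i then of_nat (?n choose (i - (2 * k - l))) else (0::rat))"
    if "l \<le> 2 * k" "i \<le> d" for l i
  proof (cases "l \<le> d - i \<and> 2 * k - l \<le> i")
    case True
    then have "d - i - l = ?n - (i - (2 * k - l))" "i - (2 * k - l) \<le> ?n" using that assms by auto
    then have "?n choose (d - i - l) = ?n choose (i - (2 * k - l))"
      using binomial_symmetric by metis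
    with True show ?thesis by simp
  next
    case False
    then show ?thesis using that assms by (auto intro!: binomial_eq_0)
  qed
  have "hcoef d k (d - i) (d - j) = (\<Sum>l\<le>2 * k. (-1) ^ l * of_nat (2 * k choose l) *
     (if 2 * k - l \<le> i then of_nat (?n choose (i - (2 * k - l))) else 0) *
     (if l \<le> j then of_nat (?n choose (j - l)) else 0))"
    unfolding hcoef_def
  proof (rule sum.cong)
    fix l assume "l \<in> {..2 * k}"
    then have l: "l \<le> 2 * k" "2 * k - l \<le> 2 * k" "2 * k - (2 * k - l) = l" by auto
    show "(-1) ^ l * of_nat (2 * k choose l) *
     (if l \<le> d - i then of_nat (?n choose (d - i - l)) else 0) *
     (if 2 * k - l \<le> d - j then of_nat (?n choose (d - j - (2 * k - l))) else 0) =
     (-1) ^ l * of_nat (2 * k choose l) *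
     (if 2 * k - l \<le> i then of_nat (?n choose (i - (2 * k - l))) else 0) *
     (if l \<le> j then of_nat (?n choose (j - l)) else (0::rat))"
      by (simp only: g[OF l(1) assms(2)] g[OF l(2) assms(3)] l(3))
  qed simp
  also have "\<dots> = hcoef d k i j"
    unfolding hcoef_def
  proof (rule sum.reindex_bij_witness[of _ "\<lambda>l. 2 * k - l" "\<lambda>l. 2 * k - l"])
    fix l assume "l \<in> {..2 * k}"
    then have l: "l \<le> 2 * k" "2 * k - (2 * k - l) = l" by auto
    have "(-1) ^ (2 * k - l) = ((-1) ^ l :: rat)"
      using l by (metis dvd_triv_left even_diff_nat minus_one_power_iff even_add le_add_diff_inverse)
    moreover have "2 * k choose (2 * k - l) = 2 * k choose l"
      using l(1) binomial_symmetric by metis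
    ultimately show "(-1) ^ (2 * k - l) * of_nat (2 * k choose (2 * k - l)) *
     (if 2 * k - l \<le> i then of_nat (?n choose (i - (2 * k - l))) else 0) *
     (if 2 * k - (2 * k - l) \<le> j then of_nat (?n choose (j - (2 * k - (2 * k - l)))) else 0) =
     (-1) ^ l * of_nat (2 * k choose l) *
     (if 2 * k - l \<le> i then of_nat (?n choose (i - (2 * k - l))) else 0) *
     (if l \<le> j then of_nat (?n choose (j - l)) else (0::rat))"
      by (simp only: l(2))
  qed auto
  finally show ?thesis .
qed

lemma of_nat_choose_two: "(of_nat (n choose 2) :: rat) = of_nat n * (of_nat n - 1) / 2"
  by (induction n) (auto simp: numeral_2_eq_2 field_simps)

lemma ecoef_1:
  "ecoef d 1 i j = of_nat (j choose 2) / of_nat (d choose 2) - 2 * of_nat i * of_nat j / (of_nat d)\<^sup>2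
     + of_nat (i choose 2) / of_nat (d choose 2)"
proof -
  have "{..2 * 1} = {0, 1, 2::nat}" by auto
  then show ?thesis by (simp add: ecoef_def power2_eq_square)
qed

text \<open>The two end coefficients multiply the same unknown in the recursion of
  \<open>geometric\<close>; having the same sign, they cannot cancel.\<close>

lemma hcoef_1_0:
  assumes "2 \<le> w" "w \<le> d"
  shows "hcoef d 1 0 w > 0" "hcoef d 1 w 0 > 0"
proof -
  have "w choose 2 > 0" "d choose 2 > 0" "d choose w > 0"
    using assms by auto
  moreover have "ecoef d 1 0 w = of_nat (w choose 2) / of_nat (d choose 2)"
    "ecoef d 1 w 0 = of_nat (w choose 2) / of_nat (d choose 2)"
    unfolding ecoef_1 by (simp_all add: of_nat_choose_two[of 0])
  ultimately show "hcoef d 1 0 w > 0" "hcoef d 1 w 0 > 0"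
    using assms by (simp_all add: hcoef_eq_ecoef)
qed

text \<open>This isolates the square of the \<open>i\<close>-th variable in weight
  \<open>2i\<close>. The explicit value has the factor \<open>i (i - d)\<close>, whence the strict
  bounds.\<close>

lemma hcoef_1_diag_neq_0:
  assumes "0 < i" "i < d"
  shows "hcoef d 1 i i \<noteq> 0"
proof -
  have d: "of_nat d \<noteq> (0::rat)" "of_nat d - 1 \<noteq> (0::rat)" "d choose i > 0" using assms by auto
  have "ecoef d 1 i i = 2 * of_nat i * (of_nat i - of_nat d) / ((of_nat d)\<^sup>2 * (of_nat d - 1))"
  proof -
    have "i * (i - 1) / 2 / (d * (d - 1) / 2) - 2 * i * i / d\<^sup>2 + i * (i - 1) / 2 / (d * (d - 1) / 2) =
        2 * i * (i - d) / (d\<^sup>2 * (d - 1))" if "d \<noteq> 0" "d - 1 \<noteq> 0" for i d :: rat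
    proof -
      have "i * (i - 1) / 2 / (d * (d - 1) / 2) = i * (i - 1) * d / (d\<^sup>2 * (d - 1))"
        "2 * i * i / d\<^sup>2 = 2 * i * i * (d - 1) / (d\<^sup>2 * (d - 1))"
        using that by (simp_all add: power2_eq_square)
      then show ?thesis
        by (simp only: add_divide_distrib[symmetric] diff_divide_distrib[symmetric])
          (simp add: algebra_simps)
    qed
    then show ?thesis unfolding ecoef_1 of_nat_choose_two using d by blast
  qed
  also have "\<dots> \<noteq> 0" using d assms by auto
  finally show ?thesis using assms hcoef_eq_ecoef[of 1 d] by auto
qed

section \<open>Saturation with respect to the variables\<close>

text \<open>Containment of \<open>I\<close> in the carrier is left out on purpose: saturations and
  colon sets such as \<open>{r. r * g \<in> J d 1}\<close> are then instances as they stand.\<close>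

locale poly_ideal =
  fixes d :: nat and I :: "mpoly set"
  assumes zero_mem: "0 \<in> I"
    and add_mem: "x \<in> I \<Longrightarrow> y \<in> I \<Longrightarrow> x + y \<in> I"
    and mult_mem: "r \<in> poly_carrier d \<Longrightarrow> x \<in> I \<Longrightarrow> r * x \<in> I"
begin

lemma uminus_mem: "x \<in> I \<Longrightarrow> - x \<in> I"
  using mult_mem[of "- 1" x] poly_carrier_uminus[OF poly_carrier_1] by simp

lemma diff_mem: "x \<in> I \<Longrightarrow> y \<in> I \<Longrightarrow> x - y \<in> I"
  using add_mem[of x "- y"] uminus_mem by simp

lemma sum_mem: "(\<And>a. a \<in> A \<Longrightarrow> f a \<in> I) \<Longrightarrow> sum f A \<in> I"
  by (induction A rule: infinite_finite_induct) (auto intro: zero_mem add_mem)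

lemma mconst_cancel:
  assumes "mconst c * x \<in> I" "c \<noteq> 0"
  shows "x \<in> I"
proof -
  have "mconst (inverse c) * (mconst c * x) \<in> I"
    by (intro mult_mem poly_carrier_mconst assms)
  moreover have "mconst (inverse c) * (mconst c * x) = mconst (inverse c * c) * x"
    by (simp only: mconst_mult mult.assoc)
  ultimately show ?thesis using assms by (simp add: mconst_1)
qed

end

lemma poly_carrier_power: "p \<in> poly_carrier d \<Longrightarrow> p ^ n \<in> poly_carrier d"
  by (induction n) (auto intro: poly_carrier_1 poly_carrier_mult)

lemma poly_carrier_diff: "p \<in> poly_carrier d \<Longrightarrow> q \<in> poly_carrier d \<Longrightarrow> p - q \<in> poly_carrier d"
  using poly_carrier_add[of p d "- q"] poly_carrier_uminus by simp

lemma poly_ideal_imp_ideal: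
  assumes "poly_ideal d I" "I \<subseteq> poly_carrier d"
  shows "ideal I (poly_ring d)"
proof -
  interpret poly_ideal d I by fact
  interpret R: cring "poly_ring d" by (rule poly_ring_cring)
  show ?thesis
  proof (rule idealI)
    show "subgroup I (add_monoid (poly_ring d))"
    proof
      fix x assume x: "x \<in> I"
      have "inv\<^bsub>add_monoid (poly_ring d)\<^esub> x = - x"
      proof (rule R.minus_equality[unfolded a_inv_def])
        show "- x \<oplus>\<^bsub>poly_ring d\<^esub> x = \<zero>\<^bsub>poly_ring d\<^esub>" by (simp add: poly_ring_def)
      qed (use x assms(2) poly_carrier_uminus in \<open>auto simp: poly_ring_def\<close>)
      with uminus_mem[OF x] show "inv\<^bsub>add_monoid (poly_ring d)\<^esub> x \<in> I" by simp
    qed (use assms(2) zero_mem add_mem in \<open>auto simp: poly_ring_def\<close>)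
    show "ring (poly_ring d)" by (rule R.ring_axioms)
    show "x \<otimes>\<^bsub>poly_ring d\<^esub> a \<in> I" "a \<otimes>\<^bsub>poly_ring d\<^esub> x \<in> I"
      if "a \<in> I" "x \<in> carrier (poly_ring d)" for a x
      using mult_mem[of x a] that by (simp_all add: poly_ring_def mult.commute)
  qed
qed

lemma poly_ideal_J: "poly_ideal d (J d q)"
proof -
  interpret ideal "J d q" "poly_ring d" by (rule J_ideal)
  show ?thesis
  proof
    show "0 \<in> J d q" using additive_subgroup.zero_closed[OF is_additive_subgroup] by (simp add: poly_ring_def)
    show "x + y \<in> J d q" if "x \<in> J d q" "y \<in> J d q" for x y
      using additive_subgroup.a_closed[OF is_additive_subgroup that] by (simp add: poly_ring_def)
    show "r * x \<in> J d q" if "r \<in> poly_carrier d" "x \<in> J d q" for r x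
      using I_l_closed[of x r] that by (simp add: poly_ring_def)
  qed
qed

lemma J_gens_subset: "J_gens d q \<subseteq> J d q"
  unfolding J_def by (rule ring.genideal_self[OF cring.axioms(1)[OF poly_ring_cring] J_gens_carrier])

lemma J_minimal:
  assumes "poly_ideal d I" "I \<subseteq> poly_carrier d" "J_gens d q \<subseteq> I"
  shows "J d q \<subseteq> I"
  unfolding J_def
  by (rule ring.genideal_minimal[OF cring.axioms(1)[OF poly_ring_cring] poly_ideal_imp_ideal]) fact+

lemma J_subset_carrier: "J d q \<subseteq> poly_carrier d"
  using additive_subgroup.a_subset[OF ideal.axioms(1)[OF J_ideal]] by (simp add: poly_ring_def)

lemma J_mono: "q \<le> q' \<Longrightarrow> J d q \<subseteq> J d q'"
proof (rule J_minimal[OF poly_ideal_J J_subset_carrier])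
  assume "q \<le> q'"
  then have "J_gens d q \<subseteq> J_gens d q'" unfolding J_gens_def by fastforce
  then show "J_gens d q \<subseteq> J d q'" using J_gens_subset by blast
qed

lemma quadric_in_J:
  assumes "1 \<le> k" "k \<le> q" "2 * k \<le> d" "2 * k \<le> w" "w + 2 * k \<le> 2 * d"
  shows "quadric d k w \<in> J d q"
proof -
  have "coeff (coeff (H d k) (w - 2 * k)) (2 * (d - 2 * k) - (w - 2 * k)) = quadric d k w"
    using assms by (subst coeff_H) auto
  then have "quadric d k w \<in> J_gens d q" using assms(1,2) unfolding J_gens_def mem_Collect_eq by metis
  then show ?thesis using J_gens_subset by blast
qed

lemma J_gens_cases:
  assumes "g \<in> J_gens d q" "2 * q \<le> d"
  obtains "g = 0" | k w where "1 \<le> k" "k \<le> q" "w \<le> 2 * d" "g = quadric d k w"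
proof -
  from assms obtain k i j where k: "1 \<le> k" "k \<le> q" "g = coeff (coeff (H d k) j) i"
    by (auto simp: J_gens_def)
  with assms(2) have "2 * k \<le> d" by simp
  from k(3) coeff_H[OF this] have "g = (if i + j = 2 * (d - 2 * k) then quadric d k (j + 2 * k) else 0)"
    by simp
  with k that(1) that(2)[of k "j + 2 * k"] \<open>2 * k \<le> d\<close> show ?thesis
    by (auto split: if_splits)
qed

lemma hcoef_sum_valid:
  assumes "2 * k \<le> d"
  shows "(\<Sum>u\<le>w. mconst (hcoef d k u (w - u)) * f u * g u) =
    (\<Sum>u | u \<le> w \<and> u \<le> d \<and> w - u \<le> d. mconst (hcoef d k u (w - u)) * f u * g u)"
proof (rule sum.mono_neutral_right)
  show "\<forall>u\<in>{..w} - {u. u \<le> w \<and> u \<le> d \<and> w - u \<le> d}. mconst (hcoef d k u (w - u)) * f u * g u = 0"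
  proof
    fix u assume "u \<in> {..w} - {u. u \<le> w \<and> u \<le> d \<and> w - u \<le> d}"
    then have "hcoef d k u (w - u) = 0" by (intro hcoef_eq_0[OF assms]) auto
    then show "mconst (hcoef d k u (w - u)) * f u * g u = 0" by (simp add: mconst_0)
  qed
qed auto

lemma quadric_reverse:
  assumes "2 * k \<le> d" "w \<le> 2 * d"
  shows "quadric d k (2 * d - w) =
    (\<Sum>u\<le>w. mconst (hcoef d k u (w - u)) * mvar (d - u) * mvar (d - (w - u)))"
proof -
  have "quadric d k (2 * d - w) =
    (\<Sum>u | u \<le> w \<and> u \<le> d \<and> w - u \<le> d. mconst (hcoef d k u (w - u)) * mvar (d - u) * mvar (d - (w - u)))"
    unfolding quadric_def hcoef_sum_valid[OF assms(1)]
  proof (rule sum.reindex_bij_witness[of _ "\<lambda>u. d - u" "\<lambda>u. d - u"])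
    fix u assume "u \<in> {u. u \<le> 2 * d - w \<and> u \<le> d \<and> 2 * d - w - u \<le> d}"
    then have u: "u \<le> d" "2 * d - w - u = d - (w - (d - u))" "d - (d - u) = u" "w - (d - u) \<le> d"
      using assms by auto
    have "hcoef d k (d - u) (w - (d - u)) = hcoef d k (d - (d - u)) (d - (w - (d - u)))"
      using u by (intro hcoef_reverse[OF assms(1), symmetric]) auto
    then show "mconst (hcoef d k (d - u) (w - (d - u))) * mvar (d - (d - u)) * mvar (d - (w - (d - u))) =
        mconst (hcoef d k u (2 * d - w - u)) * mvar u * mvar (2 * d - w - u)"
      using u by simp
  qed (use assms in auto)
  also have "\<dots> = (\<Sum>u\<le>w. mconst (hcoef d k u (w - u)) * mvar (d - u) * mvar (d - (w - u)))"
    by (rule hcoef_sum_valid[OF assms(1), symmetric])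
  finally show ?thesis .
qed

lemma sum_atMost_split_ends:
  assumes "(w::nat) > 0"
  shows "(\<Sum>u\<le>w. f u) = f 0 + f w + (\<Sum>u\<in>{0<..<w}. f u :: 'a::comm_monoid_add)"
proof -
  have "{..w} = insert 0 (insert w {0<..<w})" using assms by auto
  then show ?thesis using assms by (simp add: add.assoc)
qed

text \<open>
  Modulo an ideal that contains the coefficients of the Hessian and is saturated with respect to \<open>b 0\<close>,
  the sequence \<open>b\<close> behaves like the geometric sequence \<open>b u = b 0 * (b 1 / b 0) ^ u\<close>.
\<close>

locale saturated_hessian = poly_ideal +
  fixes b :: "nat \<Rightarrow> mpoly"
  assumes d: "d \<ge> 2"
    and b_carrier: "\<And>u. u \<le> d \<Longrightarrow> b u \<in> poly_carrier d"
    and saturated: "\<And>x. x \<in> poly_carrier d \<Longrightarrow> b 0 * x \<in> I \<Longrightarrow> x \<in> I"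
    and hessian: "\<And>w. 2 \<le> w \<Longrightarrow> w \<le> d \<Longrightarrow>
      (\<Sum>u\<le>w. mconst (hcoef d 1 u (w - u)) * b u * b (w - u)) \<in> I"
begin

lemma saturated_power: "x \<in> poly_carrier d \<Longrightarrow> b 0 ^ n * x \<in> I \<Longrightarrow> x \<in> I"
proof (induction n arbitrary: x)
  case (Suc n)
  have "b 0 * x \<in> I"
    by (rule Suc.IH) (use Suc.prems b_carrier[of 0] in \<open>auto intro: poly_carrier_mult simp: mult_ac\<close>)
  with Suc.prems(1) show ?case by (rule saturated)
qed simp

lemma product_mem:
  assumes "u \<le> d" "v \<le> d" "b 0 ^ u * b u - b 0 * b 1 ^ u \<in> I" "b 0 ^ v * b v - b 0 * b 1 ^ v \<in> I"
  shows "b 0 ^ (u + v) * (b u * b v) - b 0 ^ 2 * b 1 ^ (u + v) \<in> I"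
proof -
  have "b 0 ^ (u + v) * (b u * b v) - b 0 ^ 2 * b 1 ^ (u + v) =
      (b 0 ^ u * b u) * (b 0 ^ v * b v - b 0 * b 1 ^ v) +
      (b 0 * b 1 ^ v) * (b 0 ^ u * b u - b 0 * b 1 ^ u)"
    by (simp add: algebra_simps power_add power2_eq_square)
  moreover have "b 0 ^ u * b u \<in> poly_carrier d" "b 0 * b 1 ^ v \<in> poly_carrier d"
    using assms b_carrier d by (auto intro!: poly_carrier_mult poly_carrier_power)
  ultimately show ?thesis using assms by (auto intro: add_mem mult_mem)
qed

text \<open>As the coefficients sum to zero, the common value \<open>b 0 ^ 2 * b 1 ^ w\<close> may
  be subtracted from every product.\<close>

lemma combine:
  assumes "(\<Sum>u\<le>w. c u) = 0"
  shows "(\<Sum>u\<le>w. mconst (c u) * (b 0 ^ w * (b u * b (w - u)) - b 0 ^ 2 * b 1 ^ w)) =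
    b 0 ^ w * (\<Sum>u\<le>w. mconst (c u) * b u * b (w - u))"
proof -
  have "(\<Sum>u\<le>w. mconst (c u) * (b 0 ^ w * (b u * b (w - u)) - b 0 ^ 2 * b 1 ^ w)) =
      b 0 ^ w * (\<Sum>u\<le>w. mconst (c u) * b u * b (w - u)) - mconst (\<Sum>u\<le>w. c u) * (b 0 ^ 2 * b 1 ^ w)"
    by (simp add: algebra_simps sum_subtractf sum_distrib_left sum_distrib_right mconst_sum)
  with assms show ?thesis by (simp add: mconst_0)
qed

text \<open>The Hessian coefficient of weight \<open>w\<close> contains \<open>b w\<close> only in
  its two end terms. The inner products are known modulo \<open>I\<close> by induction, and
  \<open>saturated\<close> removes the factor \<open>b 0\<close> that is left over.\<close>

lemma geometric: "w \<le> d \<Longrightarrow> b 0 ^ w * b w - b 0 * b 1 ^ w \<in> I"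
proof (induction w rule: less_induct)
  case (less w)
  consider "w = 0" | "w = 1" | "w \<ge> 2" by linarith
  then show ?case
  proof cases
    case 3
    define c where "c u = hcoef d 1 u (w - u)" for u
    define E where "E u = b 0 ^ w * (b u * b (w - u)) - b 0 ^ 2 * b 1 ^ w" for u
    have E: "E u \<in> I" if "u \<in> {0<..<w}" for u
      using product_mem[of u "w - u"] less.IH[of u] less.IH[of "w - u"] less.prems that by (simp add: E_def)
    have c0: "(\<Sum>u\<le>w. c u) = 0" unfolding c_def by (rule sum_hcoef_eq_0) simp
    have "(\<Sum>u\<le>w. mconst (c u) * E u) \<in> I"
      unfolding E_def combine[of c w, OF c0]
      unfolding c_def using 3 less.prems b_carrier[of 0] hessian by (intro mult_mem poly_carrier_power) auto
    moreover have "(\<Sum>u\<in>{0<..<w}. mconst (c u) * E u) \<in> I"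
      by (intro sum_mem mult_mem poly_carrier_mconst E)
    ultimately have "mconst (c 0) * E 0 + mconst (c w) * E w \<in> I"
      using diff_mem 3 by (subst (asm) sum_atMost_split_ends) fastforce+
    moreover have "E 0 = b 0 * (b 0 ^ w * b w - b 0 * b 1 ^ w)" "E w = E 0"
      by (simp_all add: E_def algebra_simps power2_eq_square)
    ultimately have "mconst (c 0 + c w) * (b 0 * (b 0 ^ w * b w - b 0 * b 1 ^ w)) \<in> I"
      by (simp add: mconst_add distrib_right)
    moreover have "c 0 + c w \<noteq> 0"
      using hcoef_1_0[of w d] 3 less.prems by (auto simp: c_def)
    ultimately have "b 0 * (b 0 ^ w * b w - b 0 * b 1 ^ w) \<in> I" by (rule mconst_cancel)
    moreover have "b 0 ^ w * b w - b 0 * b 1 ^ w \<in> poly_carrier d"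
      using less.prems b_carrier d
      by (intro poly_carrier_diff poly_carrier_mult poly_carrier_power) auto
    ultimately show ?thesis using saturated by blast
  qed (auto simp: zero_mem)
qed

text \<open>Only the Hessian is assumed, yet all \<open>k\<close> are covered: a geometric sequence
  is a point of the rational normal curve, on which every quadric vanishes.\<close>

lemma quadric_mem:
  assumes "2 * k \<le> d" "k > 0"
  shows "(\<Sum>u\<le>w. mconst (hcoef d k u (w - u)) * b u * b (w - u)) \<in> I"
proof -
  let ?c = "\<lambda>u. hcoef d k u (w - u)"
  have 0: "?c u = 0" if "\<not> (u \<le> d \<and> w - u \<le> d)" for u
    using that hcoef_eq_0[OF assms(1)] by auto
  have "(\<Sum>u\<le>w. mconst (?c u) * (b 0 ^ w * (b u * b (w - u)) - b 0 ^ 2 * b 1 ^ w)) \<in> I"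
  proof (rule sum_mem)
    fix u assume u: "u \<in> {..w}"
    show "mconst (?c u) * (b 0 ^ w * (b u * b (w - u)) - b 0 ^ 2 * b 1 ^ w) \<in> I"
    proof (cases "u \<le> d \<and> w - u \<le> d")
      case True
      then show ?thesis
        using product_mem[of u "w - u"] geometric u by (auto intro!: mult_mem poly_carrier_mconst)
    qed (simp add: 0 mconst_0 zero_mem)
  qed
  then have "b 0 ^ w * (\<Sum>u\<le>w. mconst (?c u) * b u * b (w - u)) \<in> I"
    unfolding combine[of ?c w, OF sum_hcoef_eq_0[OF assms(2)]] .
  moreover have "(\<Sum>u\<le>w. mconst (?c u) * b u * b (w - u)) \<in> poly_carrier d"
  proof (rule poly_carrier_sum)
    fix u
    show "mconst (?c u) * b u * b (w - u) \<in> poly_carrier d"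
      by (cases "u \<le> d \<and> w - u \<le> d")
        (auto simp: 0 mconst_0 poly_carrier_0 intro!: poly_carrier_mult poly_carrier_mconst b_carrier)
  qed
  ultimately show ?thesis by (rule saturated_power[rotated])
qed

end

section \<open>Powers of the first and of the last variable\<close>

lemma (in poly_ideal) poly_ideal_saturation:
  assumes "a \<in> poly_carrier d"
  shows "poly_ideal d {x. \<exists>n. a ^ n * x \<in> I}"
proof
  fix x y assume "x \<in> {x. \<exists>n. a ^ n * x \<in> I}" "y \<in> {x. \<exists>n. a ^ n * x \<in> I}"
  then obtain m n where mn: "a ^ m * x \<in> I" "a ^ n * y \<in> I" by auto
  have "a ^ n * (a ^ m * x) + a ^ m * (a ^ n * y) \<in> I"
    by (intro add_mem mult_mem mn poly_carrier_power assms)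
  then have "a ^ (m + n) * (x + y) \<in> I" by (simp add: algebra_simps power_add)
  then show "x + y \<in> {x. \<exists>n. a ^ n * x \<in> I}" by blast
next
  fix r x assume r: "r \<in> poly_carrier d" and "x \<in> {x. \<exists>n. a ^ n * x \<in> I}"
  then obtain n where "a ^ n * x \<in> I" by auto
  then have "r * (a ^ n * x) \<in> I" by (rule mult_mem[OF r])
  then show "r * x \<in> {x. \<exists>n. a ^ n * x \<in> I}" by (auto simp: ac_simps)
qed (auto intro: zero_mem)

lemma saturated_hessian_J:
  assumes "d \<ge> 2" "\<And>u. u \<le> d \<Longrightarrow> b u \<in> poly_carrier d"
    and "\<And>w. 2 \<le> w \<Longrightarrow> w \<le> d \<Longrightarrow>
      (\<Sum>u\<le>w. mconst (hcoef d 1 u (w - u)) * b u * b (w - u)) \<in> J d 1"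
  shows "saturated_hessian d {x. \<exists>n. b 0 ^ n * x \<in> J d 1} b"
proof -
  interpret J: poly_ideal d "J d 1" by (rule poly_ideal_J)
  show ?thesis
  proof (intro saturated_hessian.intro saturated_hessian_axioms.intro)
    show "poly_ideal d {x. \<exists>n. b 0 ^ n * x \<in> J d 1}"
      using assms by (intro J.poly_ideal_saturation) auto
    show "x \<in> {x. \<exists>n. b 0 ^ n * x \<in> J d 1}" if "b 0 * x \<in> {x. \<exists>n. b 0 ^ n * x \<in> J d 1}" for x
    proof -
      from that obtain n where "b 0 ^ n * (b 0 * x) \<in> J d 1" by auto
      then have "b 0 ^ Suc n * x \<in> J d 1" by (simp add: ac_simps)
      then show ?thesis by blast
    qed
    show "(\<Sum>u\<le>w. mconst (hcoef d 1 u (w - u)) * b u * b (w - u)) \<in> {x. \<exists>n. b 0 ^ n * x \<in> J d 1}"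
      if "2 \<le> w" "w \<le> d" for w
    proof -
      have "b 0 ^ 0 * (\<Sum>u\<le>w. mconst (hcoef d 1 u (w - u)) * b u * b (w - u)) \<in> J d 1"
        using assms(3)[OF that] by simp
      then show ?thesis by blast
    qed
  qed (use assms in auto)
qed

lemma first_var_saturates:
  assumes "d \<ge> 2" "2 * k \<le> d" "k > 0"
  shows "\<exists>n. mvar 0 ^ n * quadric d k w \<in> J d 1"
proof -
  interpret saturated_hessian d "{x. \<exists>n. mvar 0 ^ n * x \<in> J d 1}" mvar
    using assms
    by (intro saturated_hessian_J) (auto simp: poly_carrier_mvar quadric_in_J simp flip: quadric_def)
  show ?thesis using quadric_mem[OF assms(2,3), of w] by (simp add: quadric_def)
qed

lemma last_var_saturates:
  assumes "d \<ge> 2" "2 * k \<le> d" "k > 0" "w \<le> 2 * d"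
  shows "\<exists>n. mvar d ^ n * quadric d k w \<in> J d 1"
proof -
  \<comment> \<open>Reversing the indices exchanges the weights \<open>w\<close> and
    \<open>2 * d - w\<close>, so the reversed variables satisfy the same hypotheses.\<close>
  have "saturated_hessian d {x. \<exists>n. mvar (d - 0) ^ n * x \<in> J d 1} (\<lambda>u. mvar (d - u))"
  proof (rule saturated_hessian_J)
    fix w assume "2 \<le> w" "w \<le> d"
    then have "quadric d 1 (2 * d - w) \<in> J d 1" using assms by (intro quadric_in_J) auto
    then show "(\<Sum>u\<le>w. mconst (hcoef d 1 u (w - u)) * mvar (d - u) * mvar (d - (w - u))) \<in> J d 1"
      using \<open>w \<le> d\<close> assms by (subst (asm) quadric_reverse) auto
  qed (use assms in \<open>auto simp: poly_carrier_mvar\<close>)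
  then interpret saturated_hessian d "{x. \<exists>n. mvar (d - 0) ^ n * x \<in> J d 1}" "\<lambda>u. mvar (d - u)" .
  have "quadric d k (2 * d - (2 * d - w)) \<in> {x. \<exists>n. mvar (d - 0) ^ n * x \<in> J d 1}"
    by (subst quadric_reverse[OF assms(2)]) (simp, rule quadric_mem[OF assms(2,3)])
  then show ?thesis using assms by simp
qed

section \<open>Nilpotency of the remaining variables\<close>

context poly_ideal
begin

definition nilpotent_mod :: "mpoly \<Rightarrow> bool" where
  "nilpotent_mod x \<longleftrightarrow> x \<in> poly_carrier d \<and> (\<exists>n. x ^ n \<in> I)"

lemma nilpotent_mod_mult:
  assumes "r \<in> poly_carrier d" "nilpotent_mod x"
  shows "nilpotent_mod (r * x)"
proof -
  from assms obtain n where "x ^ n \<in> I" by (auto simp: nilpotent_mod_def)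
  then have "r ^ n * x ^ n \<in> I" by (intro mult_mem poly_carrier_power assms)
  then show ?thesis
    using assms by (auto simp: nilpotent_mod_def power_mult_distrib intro: poly_carrier_mult)
qed

lemma nilpotent_mod_add:
  assumes "nilpotent_mod x" "nilpotent_mod y"
  shows "nilpotent_mod (x + y)"
proof -
  from assms obtain m n where mn: "x ^ m \<in> I" "y ^ n \<in> I" and xy: "x \<in> poly_carrier d" "y \<in> poly_carrier d"
    by (auto simp: nilpotent_mod_def)
  have "(x + y) ^ (m + n) \<in> I"
    unfolding binomial_ring
  proof (rule sum_mem)
    fix k
    show "of_nat (m + n choose k) * x ^ k * y ^ (m + n - k) \<in> I"
    proof (cases "k \<ge> m")
      case True
      then have "x ^ k = x ^ (k - m) * x ^ m" by (simp flip: power_add)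
      then have "of_nat (m + n choose k) * x ^ k * y ^ (m + n - k) =
          of_nat (m + n choose k) * x ^ (k - m) * y ^ (m + n - k) * x ^ m"
        by (simp only: ac_simps)
      then show ?thesis
        using mn xy by (metis mult_mem poly_carrier_mult poly_carrier_power poly_carrier_of_nat)
    next
      case False
      then have "y ^ (m + n - k) = y ^ (m - k) * y ^ n" by (simp flip: power_add)
      then have "of_nat (m + n choose k) * x ^ k * y ^ (m + n - k) =
          of_nat (m + n choose k) * x ^ k * y ^ (m - k) * y ^ n"
        by (simp only: ac_simps)
      then show ?thesis
        using mn xy by (metis mult_mem poly_carrier_mult poly_carrier_power poly_carrier_of_nat)
    qed
  qed
  then show ?thesis using xy by (auto simp: nilpotent_mod_def intro: poly_carrier_add)
qed

lemma nilpotent_mod_0: "nilpotent_mod 0"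
  using zero_mem by (auto simp: nilpotent_mod_def poly_carrier_0 intro: exI[of _ 1])

lemma nilpotent_mod_sum: "(\<And>a. a \<in> A \<Longrightarrow> nilpotent_mod (f a)) \<Longrightarrow> nilpotent_mod (sum f A)"
  by (induction A rule: infinite_finite_induct) (auto intro: nilpotent_mod_0 nilpotent_mod_add)

text \<open>In weight \<open>2 * i\<close> every monomial with nonzero coefficient, other than the
  square of \<open>mvar i\<close>, contains a variable of smaller index. By induction these are
  nilpotent, hence so is the square.\<close>

lemma nilpotent_mod_vars:
  assumes J: "J d 1 \<subseteq> I" and "mvar 0 ^ n \<in> I" and d: "d \<ge> 2"
  shows "i < d \<Longrightarrow> nilpotent_mod (mvar i)"
proof (induction i rule: less_induct)
  case (less i)
  show ?case
  proof (cases "i = 0")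
    case True
    then show ?thesis using assms by (auto simp: nilpotent_mod_def poly_carrier_mvar)
  next
    case False
    define c where "c u = hcoef d 1 u (2 * i - u)" for u
    define t where "t u = mconst (c u) * mvar u * mvar (2 * i - u)" for u
    have i: "c i \<noteq> 0" using hcoef_1_diag_neq_0[of i d] False less.prems by (simp add: c_def)
    have "quadric d 1 (2 * i) \<in> I"
      using J False less.prems d by (intro set_mp[OF J] quadric_in_J) auto
    then have Q: "nilpotent_mod (quadric d 1 (2 * i))"
      using J_subset_carrier[of d 1] quadric_in_J[of 1 1 d "2 * i"] False less.prems d
      by (auto simp: nilpotent_mod_def intro!: exI[of _ 1])
    have "nilpotent_mod (t u)" if u: "u \<in> {..2 * i} - {i}" for u
    proof (cases "u \<le> d \<and> 2 * i - u \<le> d")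
      case True
      consider "u < i" | "2 * i - u < i" using u by fastforce
      then show ?thesis
      proof cases
        case 1
        then have "nilpotent_mod ((mconst (c u) * mvar (2 * i - u)) * mvar u)"
          using less True
          by (intro nilpotent_mod_mult poly_carrier_mult poly_carrier_mconst poly_carrier_mvar) auto
        then show ?thesis by (simp add: t_def ac_simps)
      next
        case 2
        then show ?thesis
          unfolding t_def using less True
          by (intro nilpotent_mod_mult poly_carrier_mult poly_carrier_mconst poly_carrier_mvar) auto
      qed
    next
      case False
      then have "c u = 0" using d hcoef_eq_0[of 1 d] by (auto simp: c_def)
      then show ?thesis by (simp add: t_def mconst_0 nilpotent_mod_0)
    qed
    then have "nilpotent_mod (\<Sum>u\<in>{..2 * i} - {i}. t u)" by (rule nilpotent_mod_sum)
    then have "nilpotent_mod ((- 1) * (\<Sum>u\<in>{..2 * i} - {i}. t u))"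
      by (rule nilpotent_mod_mult[OF poly_carrier_uminus[OF poly_carrier_1]])
    then have "nilpotent_mod (mconst (inverse (c i)) * (quadric d 1 (2 * i) + (- 1) * (\<Sum>u\<in>{..2 * i} - {i}. t u)))"
      by (rule nilpotent_mod_mult[OF poly_carrier_mconst nilpotent_mod_add[OF Q]])
    moreover have "quadric d 1 (2 * i) = t i + (\<Sum>u\<in>{..2 * i} - {i}. t u)"
      unfolding quadric_def t_def c_def by (rule sum.remove) auto
    moreover have "mconst (inverse (c i)) * t i = mvar i ^ 2"
    proof -
      have "mconst (inverse (c i)) * t i = mconst (inverse (c i) * c i) * (mvar i * mvar i)"
        by (simp add: t_def mconst_mult ac_simps)
      then show ?thesis using i by (simp add: mconst_1 power2_eq_square)
    qed
    ultimately have "nilpotent_mod (mvar i ^ 2)" by simp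
    then show ?thesis
      using less.prems by (auto simp: nilpotent_mod_def poly_carrier_mvar simp flip: power_mult)
  qed
qed

end

lemma var_saturates:
  assumes "d \<ge> 2" "2 * k \<le> d" "k > 0" "w \<le> 2 * d" "i \<le> d"
  shows "\<exists>n. mvar i ^ n * quadric d k w \<in> J d 1"
proof (cases "i = d")
  case True
  then show ?thesis using last_var_saturates assms by simp
next
  case False
  interpret J: poly_ideal d "J d 1" by (rule poly_ideal_J)
  let ?g = "quadric d k w"
  have "?g \<in> poly_carrier d"
    unfolding quadric_def hcoef_sum_valid[OF assms(2)]
    by (intro poly_carrier_sum poly_carrier_mult poly_carrier_mconst poly_carrier_mvar) auto
  \<comment> \<open>The colon ideal of \<open>?g\<close> contains \<open>J d 1\<close> and a power
    of \<open>mvar 0\<close>; nilpotency of \<open>mvar i\<close> modulo it is exactly the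
    claim.\<close>
  interpret U: poly_ideal d "{r. r * ?g \<in> J d 1}"
    using J.zero_mem J.add_mem J.mult_mem by unfold_locales (auto simp: distrib_right mult.assoc)
  obtain n where "mvar 0 ^ n * ?g \<in> J d 1" using first_var_saturates assms by blast
  moreover have "J d 1 \<subseteq> {r. r * ?g \<in> J d 1}"
    using J.mult_mem[OF \<open>?g \<in> _\<close>] by (auto simp: mult.commute)
  ultimately have "U.nilpotent_mod (mvar i)"
    using assms False by (intro U.nilpotent_mod_vars) auto
  then show ?thesis unfolding U.nilpotent_mod_def by blast
qed


section \<open>Uniform exponents and monomials of large degree\<close>

lemma uniform_var_saturation:
  assumes "d \<ge> 2" "2 * q \<le> d"
  shows "\<exists>N. \<forall>k w i n. 1 \<le> k \<and> k \<le> q \<and> w \<le> 2 * d \<and> i \<le> d \<and> N \<le> n \<longrightarrow>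
    mvar i ^ n * quadric d k w \<in> J d 1"
proof -
  interpret J: poly_ideal d "J d 1" by (rule poly_ideal_J)
  define A where "A = {1..q} \<times> {..2 * d} \<times> {..d}"
  have "\<forall>(k, w, i)\<in>A. \<exists>n. mvar i ^ n * quadric d k w \<in> J d 1"
    using var_saturates assms unfolding A_def by force
  then have "\<forall>a\<in>A. \<exists>n. case a of (k, w, i) \<Rightarrow> mvar i ^ n * quadric d k w \<in> J d 1" by auto
  then obtain f where f: "\<forall>a\<in>A. case a of (k, w, i) \<Rightarrow> mvar i ^ f a * quadric d k w \<in> J d 1"
    by (rule bchoice[THEN exE])
  show ?thesis
  proof (intro exI allI impI)
    fix k w i n assume *: "1 \<le> k \<and> k \<le> q \<and> w \<le> 2 * d \<and> i \<le> d \<and> Max (f ` A) \<le> n"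
    then have a: "(k, w, i) \<in> A" by (auto simp: A_def)
    then have "f (k, w, i) \<le> Max (f ` A)" by (intro Max_ge) (auto simp: A_def)
    then have "mvar i ^ n = mvar i ^ (n - f (k, w, i)) * mvar i ^ f (k, w, i)"
      using * by (simp flip: power_add)
    moreover have "mvar i ^ (n - f (k, w, i)) * (mvar i ^ f (k, w, i) * quadric d k w) \<in> J d 1"
      by (rule J.mult_mem[OF poly_carrier_power[OF poly_carrier_mvar]]) (use bspec[OF f a] * in auto)
    ultimately show "mvar i ^ n * quadric d k w \<in> J d 1" by (simp add: mult.assoc)
  qed
qed

abbreviation pmonom :: "(nat \<Rightarrow>\<^sub>0 nat) \<Rightarrow> mpoly" where
  "pmonom m \<equiv> Poly_Mapping.single m 1"

abbreviation unit_vec :: "nat \<Rightarrow> nat \<Rightarrow>\<^sub>0 nat" where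
  "unit_vec i \<equiv> Poly_Mapping.single i 1"

lemma mvar_power: "mvar i ^ n = pmonom (Poly_Mapping.single i n)"
proof (induction n)
  case (Suc n)
  have "mvar i ^ Suc n = mvar i * pmonom (Poly_Mapping.single i n)" by (simp only: power_Suc Suc)
  also have "\<dots> = pmonom (Poly_Mapping.single i (Suc n))"
    by (simp add: mvar_def mult_single flip: single_add)
  finally show ?case .
qed simp

lemma monom_degree_superset:
  assumes "finite A" "Poly_Mapping.keys m \<subseteq> A"
  shows "monom_degree m = (\<Sum>i\<in>A. Poly_Mapping.lookup m i)"
  unfolding monom_degree_def using assms
  by (intro sum.mono_neutral_left) (auto simp: in_keys_iff)

lemma monom_degree_add: "monom_degree (m + m') = monom_degree m + monom_degree m'"
proof -
  let ?A = "Poly_Mapping.keys m \<union> Poly_Mapping.keys m'"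
  have "monom_degree (m + m') = (\<Sum>i\<in>?A. Poly_Mapping.lookup (m + m') i)"
    by (rule monom_degree_superset) (auto dest: subsetD[OF Poly_Mapping.keys_add])
  moreover have "monom_degree m = (\<Sum>i\<in>?A. Poly_Mapping.lookup m i)"
    "monom_degree m' = (\<Sum>i\<in>?A. Poly_Mapping.lookup m' i)"
    by (rule monom_degree_superset; auto)+
  ultimately show ?thesis by (simp add: lookup_add sum.distrib)
qed

lemma monom_degree_single: "monom_degree (Poly_Mapping.single i n) = n"
  by (simp add: monom_degree_def)

lemma exists_large_exponent:
  assumes "Poly_Mapping.keys m \<subseteq> {0..d}" "monom_degree m \<ge> (d + 1) * N"
  shows "\<exists>i\<le>d. N \<le> Poly_Mapping.lookup m i"
proof (rule ccontr)
  assume "\<not> ?thesis"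
  then have "\<And>i. i \<in> {0..d} \<Longrightarrow> Poly_Mapping.lookup m i < N" by auto
  then have "(\<Sum>i\<in>{0..d}. Poly_Mapping.lookup m i) < (\<Sum>i\<in>{0..d}. N)"
    by (intro sum_strict_mono) auto
  with assms monom_degree_superset[OF _ assms(1)] show False by simp
qed

lemma pmonom_mult_quadric_in_J:
  assumes "d \<ge> 2" "2 * q \<le> d"
  shows "\<exists>T. \<forall>k w m. 1 \<le> k \<and> k \<le> q \<and> w \<le> 2 * d \<and> Poly_Mapping.keys m \<subseteq> {0..d} \<and> T \<le> monom_degree m \<longrightarrow>
    pmonom m * quadric d k w \<in> J d 1"
proof -
  interpret J: poly_ideal d "J d 1" by (rule poly_ideal_J)
  from uniform_var_saturation[OF assms] obtain N where
    N: "\<And>k w i n. 1 \<le> k \<Longrightarrow> k \<le> q \<Longrightarrow> w \<le> 2 * d \<Longrightarrow> i \<le> d \<Longrightarrow> N \<le> n \<Longrightarrow>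
      mvar i ^ n * quadric d k w \<in> J d 1" by blast
  show ?thesis
  proof (intro exI allI impI)
    fix k w m
    assume *: "1 \<le> k \<and> k \<le> q \<and> w \<le> 2 * d \<and> Poly_Mapping.keys m \<subseteq> {0..d} \<and> (d + 1) * N \<le> monom_degree m"
    then obtain i where i: "i \<le> d" "N \<le> Poly_Mapping.lookup m i"
      using exists_large_exponent by blast
    define m' where "m' = m - Poly_Mapping.single i (Poly_Mapping.lookup m i)"
    have m: "m = m' + Poly_Mapping.single i (Poly_Mapping.lookup m i)"
      by (rule poly_mapping_eqI) (simp add: m'_def lookup_add lookup_minus lookup_single when_def)
    have "Poly_Mapping.keys m' \<subseteq> Poly_Mapping.keys m"
      by (auto simp: m'_def in_keys_iff lookup_minus)
    then have "pmonom m' \<in> poly_carrier d" using * by (auto simp: poly_carrier_def)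
    then have "pmonom m' * (mvar i ^ Poly_Mapping.lookup m i * quadric d k w) \<in> J d 1"
      by (rule J.mult_mem) (use N i * in auto)
    moreover have "pmonom m = pmonom m' * mvar i ^ Poly_Mapping.lookup m i"
      by (subst m) (simp add: mvar_power mult_single)
    ultimately show "pmonom m * quadric d k w \<in> J d 1" by (simp add: mult.assoc)
  qed
qed

section \<open>Eventual equality of the graded pieces\<close>

lemma poly_mapping_eq_sum_single:
  "p = (\<Sum>m\<in>Poly_Mapping.keys p. Poly_Mapping.single m (Poly_Mapping.lookup p m))"
proof (rule poly_mapping_eqI)
  fix m
  have "(\<Sum>k\<in>Poly_Mapping.keys p. Poly_Mapping.lookup (Poly_Mapping.single k (Poly_Mapping.lookup p k)) m) =
      (\<Sum>k\<in>Poly_Mapping.keys p. if k = m then Poly_Mapping.lookup p k else 0)"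
    by (rule sum.cong) (auto simp: lookup_single)
  also have "\<dots> = Poly_Mapping.lookup p m" by (auto simp: in_keys_iff)
  finally show "Poly_Mapping.lookup p m =
      Poly_Mapping.lookup (\<Sum>m\<in>Poly_Mapping.keys p. Poly_Mapping.single m (Poly_Mapping.lookup p m)) m"
    by (simp add: lookup_sum)
qed

definition homogeneous_part :: "nat \<Rightarrow> mpoly \<Rightarrow> mpoly" where
  "homogeneous_part t p =
     (\<Sum>m | m \<in> Poly_Mapping.keys p \<and> monom_degree m = t. Poly_Mapping.single m (Poly_Mapping.lookup p m))"

lemma lookup_homogeneous_part:
  "Poly_Mapping.lookup (homogeneous_part t p) m = (if monom_degree m = t then Poly_Mapping.lookup p m else 0)"
proof -
  let ?A = "{m \<in> Poly_Mapping.keys p. monom_degree m = t}"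
  have "(\<Sum>k\<in>?A. Poly_Mapping.lookup (Poly_Mapping.single k (Poly_Mapping.lookup p k)) m) =
      (\<Sum>k\<in>?A. if k = m then Poly_Mapping.lookup p k else 0)"
    by (rule sum.cong) (auto simp: lookup_single)
  also have "\<dots> = (if monom_degree m = t then Poly_Mapping.lookup p m else 0)"
    by (auto simp: in_keys_iff)
  finally show ?thesis by (simp add: homogeneous_part_def lookup_sum)
qed

lemma homogeneous_part_add: "homogeneous_part t (p + q) = homogeneous_part t p + homogeneous_part t q"
  by (rule poly_mapping_eqI) (simp add: lookup_homogeneous_part lookup_add)

lemma homogeneous_part_0: "homogeneous_part t 0 = 0"
  by (rule poly_mapping_eqI) (simp add: lookup_homogeneous_part)

lemma homogeneous_part_sum: "homogeneous_part t (sum f A) = (\<Sum>a\<in>A. homogeneous_part t (f a))"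
  by (induction A rule: infinite_finite_induct) (auto simp: homogeneous_part_0 homogeneous_part_add)

lemma homogeneous_part_homogeneous:
  assumes "\<forall>m\<in>Poly_Mapping.keys p. monom_degree m = s"
  shows "homogeneous_part t p = (if s = t then p else 0)"
  by (rule poly_mapping_eqI) (use assms in \<open>auto simp: lookup_homogeneous_part in_keys_iff\<close>)

lemma keys_homogeneous_mult:
  assumes "\<forall>m\<in>Poly_Mapping.keys p. monom_degree m = s" "\<forall>m\<in>Poly_Mapping.keys q. monom_degree m = t"
  shows "\<forall>m\<in>Poly_Mapping.keys (p * q). monom_degree m = s + t"
  using assms keys_mult[of p q] by (auto simp: monom_degree_add dest!: subsetD)

lemma keys_quadric: "\<forall>m\<in>Poly_Mapping.keys (quadric d k w). monom_degree m = 2"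
proof
  fix m assume "m \<in> Poly_Mapping.keys (quadric d k w)"
  then obtain u where "m \<in> Poly_Mapping.keys (mconst (hcoef d k u (w - u)) * mvar u * mvar (w - u))"
    unfolding quadric_def using Poly_Mapping.keys_sum by fastforce
  then have "m = unit_vec u + unit_vec (w - u)"
    by (simp add: mconst_def mvar_def mult_single split: if_splits)
  then show "monom_degree m = 2" by (simp add: monom_degree_add monom_degree_single)
qed

lemma quadric_carrier:
  assumes "2 * k \<le> d"
  shows "quadric d k w \<in> poly_carrier d"
  unfolding quadric_def hcoef_sum_valid[OF assms]
  by (intro poly_carrier_sum poly_carrier_mult poly_carrier_mconst poly_carrier_mvar) auto

lemma J_piece_eventually_constant:
  assumes "d \<ge> 2" "2 * q \<le> d"
  shows "\<exists>T. \<forall>t\<ge>T. J d q \<inter> graded_piece d t \<subseteq> J d 1"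
proof -
  interpret J: poly_ideal d "J d 1" by (rule poly_ideal_J)
  obtain T where T: "\<And>k w m. 1 \<le> k \<Longrightarrow> k \<le> q \<Longrightarrow> w \<le> 2 * d \<Longrightarrow> Poly_Mapping.keys m \<subseteq> {0..d} \<Longrightarrow>
      T \<le> monom_degree m \<Longrightarrow> pmonom m * quadric d k w \<in> J d 1"
    using pmonom_mult_quadric_in_J[OF assms] by blast
  \<comment> \<open>Quantifying over all multiples makes \<open>L\<close> an ideal, so that only the
    generators have to be tested. The summand 2 is their degree.\<close>
  define L where "L = {x \<in> poly_carrier d. \<forall>r\<in>poly_carrier d. \<forall>t\<ge>T + 2. homogeneous_part t (r * x) \<in> J d 1}"
  have L: "poly_ideal d L"
  proof
    show "r * x \<in> L" if "r \<in> poly_carrier d" "x \<in> L" for r x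
    proof -
      have "homogeneous_part t (s * (r * x)) \<in> J d 1" if "s \<in> poly_carrier d" "t \<ge> T + 2" for s t
        using that \<open>r \<in> _\<close> \<open>x \<in> L\<close> poly_carrier_mult[of s d r] by (auto simp: L_def simp flip: mult.assoc)
      with that show ?thesis by (auto simp: L_def poly_carrier_mult)
    qed
  qed (use J.zero_mem J.add_mem in
      \<open>auto simp: L_def poly_carrier_0 poly_carrier_add homogeneous_part_0 homogeneous_part_add distrib_left\<close>)
  have "J_gens d q \<subseteq> L"
  proof
    fix g assume "g \<in> J_gens d q"
    then show "g \<in> L"
    proof (rule J_gens_cases[OF _ assms(2)])
      assume "g = 0"
      then show ?thesis using poly_ideal.zero_mem[OF L] by simp
    next
      fix k w assume k: "1 \<le> k" "k \<le> q" "w \<le> 2 * d" and g: "g = quadric d k w"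
      have "homogeneous_part t (r * g) \<in> J d 1" if r: "r \<in> poly_carrier d" and t: "t \<ge> T + 2" for r t
      proof -
        have "r * g = (\<Sum>m\<in>Poly_Mapping.keys r. Poly_Mapping.single m (Poly_Mapping.lookup r m) * g)"
          by (subst poly_mapping_eq_sum_single[of r]) (simp add: sum_distrib_right)
        moreover have "homogeneous_part t (Poly_Mapping.single m (Poly_Mapping.lookup r m) * g) \<in> J d 1"
          if m: "m \<in> Poly_Mapping.keys r" for m
        proof -
          let ?s = "Poly_Mapping.single m (Poly_Mapping.lookup r m)"
          have "\<forall>m'\<in>Poly_Mapping.keys (?s * g). monom_degree m' = monom_degree m + 2"
            by (rule keys_homogeneous_mult) (auto simp: g keys_quadric)
          then have "homogeneous_part t (?s * g) = (if monom_degree m + 2 = t then ?s * g else 0)"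
            by (rule homogeneous_part_homogeneous)
          moreover have "?s * g \<in> J d 1" if "monom_degree m + 2 = t"
          proof -
            have "mconst (Poly_Mapping.lookup r m) * (pmonom m * g) \<in> J d 1"
              unfolding g by (rule J.mult_mem[OF poly_carrier_mconst T[OF k]])
                (use r m t that in \<open>auto simp: poly_carrier_def\<close>)
            then show ?thesis by (simp add: mconst_def mult_single flip: mult.assoc)
          qed
          ultimately show ?thesis using J.zero_mem by simp
        qed
        ultimately show ?thesis by (metis (no_types, lifting) homogeneous_part_sum J.sum_mem)
      qed
      moreover have "g \<in> poly_carrier d" unfolding g using k assms by (intro quadric_carrier) auto
      ultimately show ?thesis by (auto simp: L_def)
    qed
  qed
  then have JL: "J d q \<subseteq> L" by (intro J_minimal[OF L]) (auto simp: L_def)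
  show ?thesis
  proof (intro exI allI impI subsetI)
    fix t x assume t: "T + 2 \<le> t" and x: "x \<in> J d q \<inter> graded_piece d t"
    then have "homogeneous_part t (1 * x) \<in> J d 1"
      using JL poly_carrier_1 unfolding L_def by blast
    moreover have "homogeneous_part t x = x"
      using x homogeneous_part_homogeneous[of x t t] by (auto simp: graded_piece_def)
    ultimately show "x \<in> J d 1" by simp
  qed
qed

text \<open>Disagreement in one degree bounds \<open>alpha\<close> from below only because some
  \<open>m\<close> satisfies the condition under \<open>LEAST\<close>; this is where eventual
  equality enters.\<close>

lemma alpha_gt:
  assumes "1 \<le> q" "2 * (q + 1) \<le> d" "J_piece d q b \<noteq> J_piece d (q + 1) b"
  shows "alpha d q > b"
proof -
  have "\<exists>m. \<forall>t\<ge>m. J_piece d q t = J_piece d (q + 1) t"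
  proof -
    obtain T where T: "\<And>t. t \<ge> T \<Longrightarrow> J d (q + 1) \<inter> graded_piece d t \<subseteq> J d 1"
      using J_piece_eventually_constant[of d "q + 1"] assms by auto
    have "J d 1 \<subseteq> J d q" "J d q \<subseteq> J d (q + 1)" using assms(1) by (auto intro!: J_mono)
    then have "\<forall>t\<ge>T. J_piece d q t = J_piece d (q + 1) t"
      using T unfolding J_piece_def by blast
    then show ?thesis ..
  qed
  then have "\<forall>t\<ge>alpha d q. J_piece d q t = J_piece d (q + 1) t"
    unfolding alpha_def by (rule LeastI_ex)
  with assms(3) show ?thesis by (meson leI)
qed

section \<open>Linear functionals from symmetric coefficient arrays\<close>

definition monom_functional :: "((nat \<Rightarrow>\<^sub>0 nat) \<Rightarrow> rat) \<Rightarrow> mpoly \<Rightarrow> rat" where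
  "monom_functional c p = (\<Sum>m\<in>Poly_Mapping.keys p. Poly_Mapping.lookup p m * c m)"

lemma monom_functional_superset:
  assumes "finite A" "Poly_Mapping.keys p \<subseteq> A"
  shows "monom_functional c p = (\<Sum>m\<in>A. Poly_Mapping.lookup p m * c m)"
  unfolding monom_functional_def using assms
  by (intro sum.mono_neutral_left) (auto simp: in_keys_iff)

lemma monom_functional_add: "monom_functional c (p + q) = monom_functional c p + monom_functional c q"
proof -
  let ?A = "Poly_Mapping.keys p \<union> Poly_Mapping.keys q"
  have "monom_functional c (p + q) = (\<Sum>m\<in>?A. Poly_Mapping.lookup (p + q) m * c m)"
    by (rule monom_functional_superset) (auto dest: subsetD[OF Poly_Mapping.keys_add])
  moreover have "monom_functional c p = (\<Sum>m\<in>?A. Poly_Mapping.lookup p m * c m)"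
    "monom_functional c q = (\<Sum>m\<in>?A. Poly_Mapping.lookup q m * c m)"
    by (rule monom_functional_superset; auto)+
  ultimately show ?thesis by (simp add: lookup_add sum.distrib distrib_right)
qed

lemma monom_functional_0: "monom_functional c 0 = 0"
  by (simp add: monom_functional_def)

lemma monom_functional_sum: "monom_functional c (sum f A) = (\<Sum>a\<in>A. monom_functional c (f a))"
  by (induction A rule: infinite_finite_induct) (auto simp: monom_functional_0 monom_functional_add)

lemma monom_functional_single: "monom_functional c (Poly_Mapping.single m a) = a * c m"
  by (simp add: monom_functional_def)

lemma monom_functional_single_mult_quadric:
  "monom_functional c (Poly_Mapping.single m a * quadric d k w) =
    a * (\<Sum>u\<le>w. hcoef d k u (w - u) * c (unit_vec u + unit_vec (w - u) + m))"
  by (simp add: quadric_def sum_distrib_left monom_functional_sum mconst_def mvar_def mult_single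
      monom_functional_single ac_simps)

lemma J_piece_neq:
  assumes d: "2 * (q + 1) \<le> d"
    and c_homogeneous: "\<And>m. monom_degree m \<noteq> b \<Longrightarrow> c m = 0"
    and vanish: "\<And>k w m. 1 \<le> k \<Longrightarrow> k \<le> q \<Longrightarrow> Poly_Mapping.keys m \<subseteq> {0..d} \<Longrightarrow> monom_degree m + 2 = b \<Longrightarrow>
      (\<Sum>u\<le>w. hcoef d k u (w - u) * c (unit_vec u + unit_vec (w - u) + m)) = 0"
    and m: "Poly_Mapping.keys m \<subseteq> {0..d}" "monom_degree m + 2 = b"
    and w: "2 * (q + 1) \<le> w" "w + 2 * (q + 1) \<le> 2 * d"
    and nonzero: "(\<Sum>u\<le>w. hcoef d (q + 1) u (w - u) * c (unit_vec u + unit_vec (w - u) + m)) \<noteq> 0"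
  shows "J_piece d q b \<noteq> J_piece d (q + 1) b"
proof -
  \<comment> \<open>The largest ideal inside the kernel of the functional. It contains
    \<open>J d q\<close> as soon as the functional kills all monomial multiples of the
    generators.\<close>
  define L where "L = {x \<in> poly_carrier d. \<forall>r\<in>poly_carrier d. monom_functional c (r * x) = 0}"
  have L: "poly_ideal d L"
  proof
    show "r * x \<in> L" if "r \<in> poly_carrier d" "x \<in> L" for r x
    proof -
      have "monom_functional c (s * (r * x)) = 0" if "s \<in> poly_carrier d" for s
        using that \<open>r \<in> _\<close> \<open>x \<in> L\<close> poly_carrier_mult[of s d r] by (auto simp: L_def simp flip: mult.assoc)
      with that show ?thesis by (auto simp: L_def poly_carrier_mult)
    qed
  qed (auto simp: L_def poly_carrier_0 poly_carrier_add monom_functional_0 monom_functional_add distrib_left)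
  have "J_gens d q \<subseteq> L"
  proof
    fix g assume "g \<in> J_gens d q"
    moreover have "2 * q \<le> d" using d by simp
    ultimately show "g \<in> L"
    proof (rule J_gens_cases)
      assume "g = 0"
      then show ?thesis using poly_ideal.zero_mem[OF L] by simp
    next
      fix k w assume k: "1 \<le> k" "k \<le> q" "w \<le> 2 * d" and g: "g = quadric d k w"
      have "monom_functional c (r * g) = 0" if r: "r \<in> poly_carrier d" for r
      proof -
        have "r * g = (\<Sum>m\<in>Poly_Mapping.keys r. Poly_Mapping.single m (Poly_Mapping.lookup r m) * g)"
          by (subst poly_mapping_eq_sum_single[of r]) (simp add: sum_distrib_right)
        moreover have "monom_functional c (Poly_Mapping.single m (Poly_Mapping.lookup r m) * g) = 0"
          if m: "m \<in> Poly_Mapping.keys r" for m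
        proof (cases "monom_degree m + 2 = b")
          case True
          with vanish[OF k(1,2)] r m show ?thesis
            by (simp add: g monom_functional_single_mult_quadric poly_carrier_def)
        next
          case False
          then have "c (unit_vec u + unit_vec (w - u) + m) = 0" for u
            by (intro c_homogeneous) (auto simp: monom_degree_add monom_degree_single)
          then show ?thesis by (simp add: g monom_functional_single_mult_quadric)
        qed
        ultimately show ?thesis by (simp add: monom_functional_sum)
      qed
      moreover have "g \<in> poly_carrier d" unfolding g using k d by (intro quadric_carrier) auto
      ultimately show ?thesis by (auto simp: L_def)
    qed
  qed
  then have JL: "J d q \<subseteq> L" by (intro J_minimal[OF L]) (auto simp: L_def)
  define x where "x = pmonom m * quadric d (q + 1) w"
  have mc: "pmonom m \<in> poly_carrier d" using m by (simp add: poly_carrier_def)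
  have "x \<in> J d (q + 1)"
    unfolding x_def using d w mc by (intro poly_ideal.mult_mem[OF poly_ideal_J] quadric_in_J) auto
  moreover have "\<forall>m'\<in>Poly_Mapping.keys x. monom_degree m' = b"
    unfolding x_def m(2)[symmetric] by (rule keys_homogeneous_mult) (auto simp: keys_quadric)
  moreover have "x \<in> poly_carrier d"
    unfolding x_def using d mc by (intro poly_carrier_mult quadric_carrier) auto
  moreover have "x \<notin> J d q"
  proof
    assume "x \<in> J d q"
    then have "monom_functional c (1 * x) = 0" using JL poly_carrier_1 unfolding L_def by blast
    then show False using nonzero by (simp add: x_def monom_functional_single_mult_quadric)
  qed
  ultimately show ?thesis by (auto simp: J_piece_def graded_piece_def)
qed

section \<open>Monomials as index lists\<close>

definition list_monom :: "nat list \<Rightarrow> nat \<Rightarrow>\<^sub>0 nat" where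
  "list_monom xs = (\<Sum>x\<leftarrow>xs. unit_vec x)"

lemma list_monom_Nil: "list_monom [] = 0"
  by (simp add: list_monom_def)

lemma list_monom_Cons: "list_monom (x # xs) = unit_vec x + list_monom xs"
  by (simp add: list_monom_def)

lemma lookup_list_monom: "Poly_Mapping.lookup (list_monom xs) y = count (mset xs) y"
  by (induction xs) (auto simp: list_monom_Nil list_monom_Cons lookup_add lookup_single when_def)

lemma list_monom_eq_iff: "list_monom xs = list_monom ys \<longleftrightarrow> mset xs = mset ys"
  by (auto simp: poly_mapping_eq_iff multiset_eq_iff fun_eq_iff lookup_list_monom)

lemma monom_degree_list_monom: "monom_degree (list_monom xs) = length xs"
  by (induction xs)
    (auto simp: list_monom_Nil list_monom_Cons monom_degree_add monom_degree_single monom_degree_def[of 0])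

lemma keys_list_monom: "Poly_Mapping.keys (list_monom xs) = set xs"
  by (auto simp: in_keys_iff lookup_list_monom)

lemma list_monom_surj: "\<exists>xs. m = list_monom xs"
proof (induction "monom_degree m" arbitrary: m)
  case 0
  then have "\<forall>i\<in>Poly_Mapping.keys m. Poly_Mapping.lookup m i = 0" by (simp add: monom_degree_def)
  then have "m = 0" by (intro poly_mapping_eqI) (auto simp: in_keys_iff)
  then show ?case by (metis list_monom_Nil)
next
  case (Suc n)
  then have "Poly_Mapping.keys m \<noteq> {}" by (auto simp: monom_degree_def)
  then obtain i where i: "i \<in> Poly_Mapping.keys m" by blast
  have m: "m = unit_vec i + (m - unit_vec i)"
    by (rule poly_mapping_eqI) (use i in \<open>auto simp: lookup_add lookup_minus lookup_single in_keys_iff when_def\<close>)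
  then have "monom_degree m = 1 + monom_degree (m - unit_vec i)"
    by (metis monom_degree_add monom_degree_single)
  then obtain xs where "m - unit_vec i = list_monom xs" using Suc by fastforce
  with m show ?case by (metis list_monom_Cons)
qed

text \<open>Adjacent transpositions carry any chosen entry to the front; the rest is induction, with
  the arbitrary prefix \<open>us\<close> absorbing the entries already matched.\<close>

lemma swap_invariant_imp_mset_invariant:
  assumes swap: "\<And>us x y vs. F (us @ x # y # vs) = F (us @ y # x # vs)"
    and "mset xs = mset ys"
  shows "F xs = F ys"
proof -
  have front: "F (us @ ps @ a # ss) = F (us @ a # ps @ ss)" for us ps a ss
  proof (induction ps arbitrary: us)
    case (Cons p ps)
    from Cons.IH[of "us @ [p]"] swap[of us p a "ps @ ss"] show ?case by simp
  qed simp
  have "F (us @ xs) = F (us @ ys)" if "mset xs = mset ys" for us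
    using that
  proof (induction xs arbitrary: us ys)
    case (Cons a xs)
    then have "a \<in> set ys" by (metis list.set_intros(1) set_mset_mset)
    then obtain ps ss where ys: "ys = ps @ a # ss" by (meson split_list)
    with Cons.prems have "mset xs = mset (ps @ ss)" by simp
    from Cons.IH[OF this, of "us @ [a]"] front[of us ps a ss] ys show ?case by simp
  qed simp
  from this[of "[]"] assms(2) show ?thesis by simp
qed

text \<open>
  The functional takes the value \<open>F xs / (\<Prod>x\<leftarrow>xs. d choose x)\<close> on the monomial with index list \<open>xs\<close>; these
  denominators turn \<open>hcoef\<close> into \<open>ecoef\<close>.
\<close>

lemma J_piece_neq_list:
  fixes F :: "nat list \<Rightarrow> rat"
  assumes d: "2 * (q + 1) \<le> d"
    and swap: "\<And>us x y vs. F (us @ x # y # vs) = F (us @ y # x # vs)"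
    and supp: "\<And>xs x. x \<in> set xs \<Longrightarrow> x > d \<Longrightarrow> F xs = 0"
    and vanish: "\<And>k w xs. 1 \<le> k \<Longrightarrow> k \<le> q \<Longrightarrow> length xs + 2 = b \<Longrightarrow>
      (\<Sum>u\<le>w. ecoef d k u (w - u) * F (u # (w - u) # xs)) = 0"
    and xs: "length xs + 2 = b"
    and w: "2 * (q + 1) \<le> w" "w + 2 * (q + 1) \<le> 2 * d"
    and nonzero: "(\<Sum>u\<le>w. ecoef d (q + 1) u (w - u) * F (u # (w - u) # xs)) \<noteq> 0"
  shows "J_piece d q b \<noteq> J_piece d (q + 1) b"
proof -
  define W where "W ys = F ys / (\<Prod>x\<leftarrow>ys. of_nat (d choose x))" for ys
  \<comment> \<open>\<open>SOME\<close> may pick any arrangement of the indices: the numerator and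
    the denominator of \<open>W\<close> depend only on the multiset.\<close>
  define c where "c m = (if monom_degree m = b then W (SOME ys. list_monom ys = m) else 0)" for m
  have c: "c (list_monom ys) = W ys" if "length ys = b" for ys
  proof -
    define zs where "zs = (SOME zs. list_monom zs = list_monom ys)"
    have "list_monom zs = list_monom ys" unfolding zs_def by (rule someI) (rule refl)
    then have *: "mset zs = mset ys" by (simp add: list_monom_eq_iff)
    then have "mset (map (\<lambda>x. rat_of_nat (d choose x)) zs) = mset (map (\<lambda>x. rat_of_nat (d choose x)) ys)"
      by simp
    then have "(\<Prod>x\<leftarrow>zs. rat_of_nat (d choose x)) = (\<Prod>x\<leftarrow>ys. rat_of_nat (d choose x))"
      by (metis prod_mset_prod_list)
    moreover have "F zs = F ys" by (rule swap_invariant_imp_mset_invariant[where F = F, OF swap *])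
    ultimately show ?thesis using that by (simp add: c_def W_def monom_degree_list_monom flip: zs_def)
  qed
  have sum_c: "(\<Sum>u\<le>w. hcoef d k u (w - u) * c (unit_vec u + unit_vec (w - u) + list_monom ys)) =
      (\<Sum>u\<le>w. ecoef d k u (w - u) * F (u # (w - u) # ys)) / (\<Prod>x\<leftarrow>ys. of_nat (d choose x))"
    if "2 * k \<le> d" "length ys + 2 = b" for k w ys
    unfolding sum_divide_distrib
  proof (rule sum.cong)
    fix u
    have "c (unit_vec u + unit_vec (w - u) + list_monom ys) = W (u # (w - u) # ys)"
      using c[of "u # (w - u) # ys"] that(2) by (simp add: list_monom_Cons add.assoc)
    \<comment> \<open>For an index above \<open>d\<close> the binomials cannot be cancelled; there
      both sides are zero, the right one because \<open>F\<close> vanishes.\<close>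
    moreover have "F (u # (w - u) # ys) = 0" if "d choose u = 0 \<or> d choose (w - u) = 0"
      using that supp[of u "u # (w - u) # ys"] supp[of "w - u" "u # (w - u) # ys"]
      by (auto simp: binomial_eq_0_iff)
    ultimately show "hcoef d k u (w - u) * c (unit_vec u + unit_vec (w - u) + list_monom ys) =
        ecoef d k u (w - u) * F (u # (w - u) # ys) / (\<Prod>x\<leftarrow>ys. of_nat (d choose x))"
      unfolding hcoef_eq_ecoef[OF that(1)] W_def by auto
  qed simp
  have xs_le: "\<And>x. x \<in> set xs \<Longrightarrow> x \<le> d"
  proof (rule ccontr)
    fix x assume "x \<in> set xs" "\<not> x \<le> d"
    then have "F (u # v # xs) = 0" for u v by (intro supp[of x]) auto
    with nonzero show False by simp
  qed
  show ?thesis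
  proof (rule J_piece_neq[where c = c and m = "list_monom xs" and w = w, OF d])
    show "c m = 0" if "monom_degree m \<noteq> b" for m using that by (simp add: c_def)
    show "(\<Sum>u\<le>w. hcoef d k u (w - u) * c (unit_vec u + unit_vec (w - u) + m)) = 0"
      if "1 \<le> k" "k \<le> q" "monom_degree m + 2 = b" for k w m
    proof -
      obtain ys where m: "m = list_monom ys" using list_monom_surj by blast
      then have "length ys + 2 = b" using that by (simp add: monom_degree_list_monom)
      then show ?thesis using sum_c[of k ys w] vanish[of k ys w] that d by (simp add: m)
    qed
    show "Poly_Mapping.keys (list_monom xs) \<subseteq> {0..d}" using xs_le by (auto simp: keys_list_monom)
    show "monom_degree (list_monom xs) + 2 = b" using xs by (simp add: monom_degree_list_monom)
    have "(\<Prod>x\<leftarrow>xs. rat_of_nat (d choose x)) \<noteq> 0"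
      by (auto simp: prod_list_zero_iff binomial_eq_0_iff dest!: xs_le)
    then show "(\<Sum>u\<le>w. hcoef d (q + 1) u (w - u) *
        c (unit_vec u + unit_vec (w - u) + list_monom xs)) \<noteq> 0"
      using sum_c[OF d xs, of w] nonzero by simp
  qed (use w in auto)
qed

section \<open>Coefficient arrays of polynomials in four variables\<close>

lemma poly_eq_sum_atMost:
  fixes p :: "'a::comm_semiring_1 poly"
  assumes "Polynomial.degree p \<le> n"
  shows "poly p x = (\<Sum>i\<le>n. coeff p i * x ^ i)"
  unfolding poly_altdef using assms
  by (intro sum.mono_neutral_left) (auto simp: coeff_eq_0 not_le)

lemma sum_powers_eq_0_imp:
  fixes c :: "nat \<Rightarrow> rat"
  assumes "\<And>x. (\<Sum>i\<le>n. c i * x ^ i) = 0" "i \<le> n"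
  shows "c i = 0"
proof -
  define p where "p = (\<Sum>i\<le>n. monom (c i) i)"
  have "poly p x = 0" for x using assms(1)[of x] by (simp add: p_def poly_sum poly_monom)
  then have "p = 0" using poly_all_0_iff_0 by blast
  moreover have "coeff p i = c i"
    using assms(2) by (simp add: p_def coeff_sum)
  ultimately show ?thesis by simp
qed

text \<open>The array is zero outside the common bound, so the function determines it. Symmetries
  can then be checked on values at rational points and carried over to the coefficients.\<close>

definition represents ::
  "nat \<Rightarrow> (nat \<Rightarrow> nat \<Rightarrow> nat \<Rightarrow> nat \<Rightarrow> rat) \<Rightarrow> (rat \<Rightarrow> rat \<Rightarrow> rat \<Rightarrow> rat \<Rightarrow> rat) \<Rightarrow> bool" where
  "represents n G f \<longleftrightarrow>
     (\<forall>i j k l. i > n \<or> j > n \<or> k > n \<or> l > n \<longrightarrow> G i j k l = 0) \<and>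
     (\<forall>x y z t. f x y z t =
        (\<Sum>i\<le>n. \<Sum>j\<le>n. \<Sum>k\<le>n. \<Sum>l\<le>n. G i j k l * x ^ i * y ^ j * z ^ k * t ^ l))"

lemma represents_unique:
  assumes "represents n G f" "represents n G' f"
  shows "G i j k l = G' i j k l"
proof -
  define D where "D i j k l = G i j k l - G' i j k l" for i j k l
  have "(\<Sum>i\<le>n. \<Sum>j\<le>n. \<Sum>k\<le>n. \<Sum>l\<le>n. D i j k l * x ^ i * y ^ j * z ^ k * t ^ l) = 0" for x y z t
    using assms by (simp add: represents_def D_def left_diff_distrib sum_subtractf)
  then have 0: "(\<Sum>i\<le>n. (\<Sum>j\<le>n. (\<Sum>k\<le>n. (\<Sum>l\<le>n. D i j k l * t ^ l) * z ^ k) * y ^ j) * x ^ i) = 0"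
    for x y z t
  proof -
    have "(\<Sum>i\<le>n. (\<Sum>j\<le>n. (\<Sum>k\<le>n. (\<Sum>l\<le>n. D i j k l * t ^ l) * z ^ k) * y ^ j) * x ^ i) =
        (\<Sum>i\<le>n. \<Sum>j\<le>n. \<Sum>k\<le>n. \<Sum>l\<le>n. D i j k l * t ^ l * z ^ k * y ^ j * x ^ i)"
      by (simp only: sum_distrib_right)
    also have "\<dots> = (\<Sum>i\<le>n. \<Sum>j\<le>n. \<Sum>k\<le>n. \<Sum>l\<le>n. D i j k l * x ^ i * y ^ j * z ^ k * t ^ l)"
      by (intro sum.cong refl) (simp only: mult_ac)
    finally show ?thesis
      using \<open>\<And>x y z t. (\<Sum>i\<le>n. \<Sum>j\<le>n. \<Sum>k\<le>n. \<Sum>l\<le>n. D i j k l * x ^ i * y ^ j * z ^ k * t ^ l) = 0\<close>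
      by simp
  qed
  have "D i j k l = 0"
  proof (cases "i \<le> n \<and> j \<le> n \<and> k \<le> n \<and> l \<le> n")
    case True
    have "(\<Sum>j\<le>n. (\<Sum>k\<le>n. (\<Sum>l\<le>n. D i j k l * t ^ l) * z ^ k) * y ^ j) = 0" for y z t
      using 0 True by (intro sum_powers_eq_0_imp[of "\<lambda>i. \<Sum>j\<le>n. (\<Sum>k\<le>n. (\<Sum>l\<le>n. D i j k l * t ^ l) * z ^ k) * y ^ j"]) auto
    then have "(\<Sum>k\<le>n. (\<Sum>l\<le>n. D i j k l * t ^ l) * z ^ k) = 0" for z t
      using True by (intro sum_powers_eq_0_imp[of "\<lambda>j. \<Sum>k\<le>n. (\<Sum>l\<le>n. D i j k l * t ^ l) * z ^ k"]) auto
    then have "(\<Sum>l\<le>n. D i j k l * t ^ l) = 0" for t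
      using True by (intro sum_powers_eq_0_imp[of "\<lambda>k. \<Sum>l\<le>n. D i j k l * t ^ l"]) auto
    then show ?thesis using True by (intro sum_powers_eq_0_imp[of "\<lambda>l. D i j k l"]) auto
  next
    case False
    then have "G i j k l = 0" "G' i j k l = 0"
      using assms unfolding represents_def by (meson not_le)+
    then show ?thesis by (simp add: D_def)
  qed
  then show ?thesis by (simp add: D_def)
qed

lemma represents_swap12:
  assumes "represents n G f" "\<And>x y z t. f x y z t = f y x z t"
  shows "G i j k l = G j i k l"
proof (rule represents_unique[OF assms(1)])
  have "f x y z t = (\<Sum>i\<le>n. \<Sum>j\<le>n. \<Sum>k\<le>n. \<Sum>l\<le>n. G j i k l * x ^ i * y ^ j * z ^ k * t ^ l)" for x y z t
  proof -
    have "f y x z t = (\<Sum>i\<le>n. \<Sum>j\<le>n. \<Sum>k\<le>n. \<Sum>l\<le>n. G i j k l * y ^ i * x ^ j * z ^ k * t ^ l)"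
      using assms(1) by (simp add: represents_def)
    also have "\<dots> = (\<Sum>j\<le>n. \<Sum>i\<le>n. \<Sum>k\<le>n. \<Sum>l\<le>n. G i j k l * y ^ i * x ^ j * z ^ k * t ^ l)"
      by (rule sum.swap)
    finally show ?thesis by (simp add: assms(2)[of x y] mult_ac)
  qed
  then show "represents n (\<lambda>i j k l. G j i k l) f"
    using assms(1) by (auto simp: represents_def)
qed

lemma represents_swap23:
  assumes "represents n G f" "\<And>x y z t. f x y z t = f x z y t"
  shows "G i j k l = G i k j l"
proof (rule represents_unique[OF assms(1)])
  have "f x y z t = (\<Sum>i\<le>n. \<Sum>j\<le>n. \<Sum>k\<le>n. \<Sum>l\<le>n. G i k j l * x ^ i * y ^ j * z ^ k * t ^ l)" for x y z t
  proof -
    have "f x z y t = (\<Sum>i\<le>n. \<Sum>j\<le>n. \<Sum>k\<le>n. \<Sum>l\<le>n. G i j k l * x ^ i * z ^ j * y ^ k * t ^ l)"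
      using assms(1) by (simp add: represents_def)
    also have "\<dots> = (\<Sum>i\<le>n. \<Sum>k\<le>n. \<Sum>j\<le>n. \<Sum>l\<le>n. G i j k l * x ^ i * z ^ j * y ^ k * t ^ l)"
      by (intro sum.cong sum.swap refl)
    finally show ?thesis by (simp add: assms(2)[of x y] mult_ac)
  qed
  then show "represents n (\<lambda>i j k l. G i k j l) f"
    using assms(1) by (auto simp: represents_def)
qed

lemma represents_swap34:
  assumes "represents n G f" "\<And>x y z t. f x y z t = f x y t z"
  shows "G i j k l = G i j l k"
proof (rule represents_unique[OF assms(1)])
  have "f x y z t = (\<Sum>i\<le>n. \<Sum>j\<le>n. \<Sum>k\<le>n. \<Sum>l\<le>n. G i j l k * x ^ i * y ^ j * z ^ k * t ^ l)" for x y z t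
  proof -
    have "f x y t z = (\<Sum>i\<le>n. \<Sum>j\<le>n. \<Sum>k\<le>n. \<Sum>l\<le>n. G i j k l * x ^ i * y ^ j * t ^ k * z ^ l)"
      using assms(1) by (simp add: represents_def)
    also have "\<dots> = (\<Sum>i\<le>n. \<Sum>j\<le>n. \<Sum>l\<le>n. \<Sum>k\<le>n. G i j k l * x ^ i * y ^ j * t ^ k * z ^ l)"
      by (intro sum.cong sum.swap refl)
    finally show ?thesis by (simp add: assms(2)[of x y] mult_ac)
  qed
  then show "represents n (\<lambda>i j k l. G i j l k) f"
    using assms(1) by (auto simp: represents_def)
qed

lemma poly2_eval_unique:
  fixes P Q :: "rat poly poly"
  assumes "\<And>x y. poly (poly P [:x:]) y = poly (poly Q [:x:]) y"
  shows "P = Q"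
proof -
  have "poly (P - Q) [:x:] = 0" for x
    using assms by (intro poly_ext) simp
  then have "range (\<lambda>x::rat. [:x:]) \<subseteq> {p. poly (P - Q) p = 0}" by auto
  moreover have "infinite (range (\<lambda>x::rat. [:x:]))"
    by (simp add: finite_image_iff inj_def infinite_UNIV_char_0)
  ultimately have "P - Q = 0" using poly_roots_finite finite_subset by blast
  then show ?thesis by simp
qed

text \<open>\<open>B\<close> is the slice in which the last two variables are fixed numbers. The
  differential operators touch only the first two variables, so they can be evaluated on such
  slices.\<close>

lemma coeff_slice:
  assumes G: "represents n G f" and B: "\<And>x y. poly (poly B [:x:]) y = f x y z t"
  shows "coeff (coeff B i) j = (\<Sum>k\<le>n. \<Sum>l\<le>n. G i j k l * z ^ k * t ^ l)"
proof -
  define s where "s i j = (\<Sum>k\<le>n. \<Sum>l\<le>n. G i j k l * z ^ k * t ^ l)" for i j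
  define B' where "B' = (\<Sum>i\<le>n. \<Sum>j\<le>n. monom (monom (s i j) j) i)"
  have "[:x:] ^ i = [:x ^ i:]" for x :: rat and i by (induction i) (auto simp: one_pCons)
  then have "poly (poly B' [:x:]) y = (\<Sum>i\<le>n. \<Sum>j\<le>n. s i j * y ^ j * x ^ i)" for x y
    by (simp add: B'_def poly_sum poly_monom mult_ac sum_distrib_left sum_distrib_right)
  also have "(\<Sum>i\<le>n. \<Sum>j\<le>n. s i j * y ^ j * x ^ i) = f x y z t" for x y
    using G by (simp add: represents_def s_def sum_distrib_left sum_distrib_right mult_ac)
  finally have "B = B'" using B by (intro poly2_eval_unique) simp
  have "coeff (coeff B' i) j = (\<Sum>a\<le>n. \<Sum>b\<le>n. if a = i then if b = j then s a b else 0 else 0)"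
    unfolding B'_def coeff_sum by (intro sum.cong refl) auto
  also have "\<dots> = (\<Sum>a\<le>n. if a = i then \<Sum>b\<le>n. if b = j then s a b else 0 else 0)"
    by (intro sum.cong refl) auto
  also have "\<dots> = (if i \<le> n \<and> j \<le> n then s i j else 0)" by simp
  also have "\<dots> = s i j"
    using G by (auto simp: represents_def s_def not_le)
  finally show ?thesis by (simp add: \<open>B = B'\<close> s_def)
qed

definition eval4 :: "rat poly poly poly poly \<Rightarrow> rat \<Rightarrow> rat \<Rightarrow> rat \<Rightarrow> rat \<Rightarrow> rat" where
  "eval4 P x y z t = poly (poly (poly (poly P [:[:[:x:]:]:]) [:[:y:]:]) [:z:]) t"

text \<open>Used once per level of nesting: finitely many coefficients have a common bound, and
  \<open>Q\<close> is monotone in the bound.\<close>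

lemma uniform_coeff_bound:
  assumes "\<And>c. \<exists>n. Q n c" "\<And>m n c. m \<le> n \<Longrightarrow> Q m c \<Longrightarrow> Q n c"
  shows "\<exists>n. Polynomial.degree P \<le> n \<and> (\<forall>i. Q n (coeff P i))"
proof -
  obtain f where f: "\<And>c. Q (f c) c" using assms(1) by metis
  \<comment> \<open>The extra entry 0 accounts for the coefficients beyond the degree and keeps the
    set nonempty.\<close>
  define n where "n = Polynomial.degree P + Max (f ` set (0 # coeffs P))"
  have "Q n (coeff P i)" for i
  proof (rule assms(2)[OF _ f])
    have "coeff P i \<in> set (0 # coeffs P)"
      using range_coeff[of P] by (metis list.simps(15) rangeI)
    then have "f (coeff P i) \<le> Max (f ` set (0 # coeffs P))" by (intro Max_ge) auto
    then show "f (coeff P i) \<le> n" by (simp add: n_def)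
  qed
  then show ?thesis by (intro exI[of _ n]) (auto simp: n_def)
qed

lemma represents_eval4:
  "\<exists>n. represents n (\<lambda>i j k l. coeff (coeff (coeff (coeff P i) j) k) l) (eval4 P)"
proof -
  define Q1 where "Q1 n p \<longleftrightarrow> Polynomial.degree p \<le> n" for n and p :: "rat poly"
  define Q2 where "Q2 n p \<longleftrightarrow> Polynomial.degree p \<le> n \<and> (\<forall>i. Q1 n (coeff p i))" for n p
  define Q3 where "Q3 n p \<longleftrightarrow> Polynomial.degree p \<le> n \<and> (\<forall>i. Q2 n (coeff p i))" for n p
  define Q4 where "Q4 n p \<longleftrightarrow> Polynomial.degree p \<le> n \<and> (\<forall>i. Q3 n (coeff p i))" for n p
  have m1: "Q1 n p" if "m \<le> n" "Q1 m p" for m n p using that unfolding Q1_def by linarith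
  have m2: "Q2 n p" if "m \<le> n" "Q2 m p" for m n p
    using that m1 unfolding Q2_def by (meson order_trans)
  have m3: "Q3 n p" if "m \<le> n" "Q3 m p" for m n p
    using that m2 unfolding Q3_def by (meson order_trans)
  have "\<exists>n. Q1 n p" for p unfolding Q1_def by blast
  then have "\<exists>n. Q2 n p" for p unfolding Q2_def using m1 by (rule uniform_coeff_bound)
  then have "\<exists>n. Q3 n p" for p unfolding Q3_def using m2 by (rule uniform_coeff_bound)
  then have "\<exists>n. Q4 n p" for p unfolding Q4_def using m3 by (rule uniform_coeff_bound)
  then obtain n where "Q4 n P" by blast
  then have n: "Polynomial.degree P \<le> n" "Polynomial.degree (coeff P i) \<le> n"
    "Polynomial.degree (coeff (coeff P i) j) \<le> n" "Polynomial.degree (coeff (coeff (coeff P i) j) k) \<le> n"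
    for i j k
    by (auto simp: Q1_def Q2_def Q3_def Q4_def)
  have const_power: "[:c:] ^ i = [:c ^ i:]" for c :: "'a::comm_ring_1" and i
    by (induction i) (auto simp: one_pCons)
  have "eval4 P x y z t = (\<Sum>i\<le>n. \<Sum>j\<le>n. \<Sum>k\<le>n. \<Sum>l\<le>n.
      coeff (coeff (coeff (coeff P i) j) k) l * x ^ i * y ^ j * z ^ k * t ^ l)" for x y z t
    unfolding eval4_def poly_eq_sum_atMost[OF n(1)] poly_sum poly_mult const_power poly_eq_sum_atMost[OF n(2)]
      poly_eq_sum_atMost[OF n(3)] poly_eq_sum_atMost[OF n(4)]
    by (simp add: sum_distrib_left sum_distrib_right mult_ac)
  moreover have "coeff (coeff (coeff (coeff P i) j) k) l = 0" if h: "i > n \<or> j > n \<or> k > n \<or> l > n" for i j k l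
  proof -
    consider "i > n" | "j > n" | "k > n" | "l > n" using h by blast
    then show ?thesis
    proof cases
      case 1
      then have "coeff P i = 0" using n(1) by (intro coeff_eq_0) simp
      then show ?thesis by simp
    next
      case 2
      then have "coeff (coeff P i) j = 0" using n(2)[of i] by (intro coeff_eq_0) simp
      then show ?thesis by simp
    next
      case 3
      then have "coeff (coeff (coeff P i) j) k = 0" using n(3)[of i j] by (intro coeff_eq_0) simp
      then show ?thesis by simp
    next
      case 4
      then show ?thesis using n(4)[of i j k] by (intro coeff_eq_0) simp
    qed
  qed
  ultimately show ?thesis unfolding represents_def by blast
qed

lemma sum_slice:
  assumes G: "represents n G f" and B: "\<And>x y. poly (poly B [:x:]) y = f x y z t"
  shows "(\<Sum>u\<le>w. c u * coeff (coeff B u) (w - u)) =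
    (\<Sum>k\<le>n. (\<Sum>l\<le>n. (\<Sum>u\<le>w. c u * G u (w - u) k l) * t ^ l) * z ^ k)"
proof -
  have "(\<Sum>u\<le>w. c u * coeff (coeff B u) (w - u)) =
      (\<Sum>u\<le>w. \<Sum>k\<le>n. \<Sum>l\<le>n. c u * G u (w - u) k l * t ^ l * z ^ k)"
    by (simp add: coeff_slice[OF G B] sum_distrib_left mult_ac)
  also have "\<dots> = (\<Sum>k\<le>n. \<Sum>u\<le>w. \<Sum>l\<le>n. c u * G u (w - u) k l * t ^ l * z ^ k)"
    by (rule sum.swap)
  also have "\<dots> = (\<Sum>k\<le>n. \<Sum>l\<le>n. \<Sum>u\<le>w. c u * G u (w - u) k l * t ^ l * z ^ k)"
    by (intro sum.cong sum.swap refl)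
  finally show ?thesis by (simp add: sum_distrib_right)
qed

lemma sum_slice_eq_0:
  assumes G: "represents n G f" and B: "\<And>x y z t. poly (poly (B z t) [:x:]) y = f x y z t"
    and 0: "\<And>z t. (\<Sum>u\<le>w. c u * coeff (coeff (B z t) u) (w - u)) = 0"
  shows "(\<Sum>u\<le>w. c u * G u (w - u) k l) = 0"
proof (cases "k \<le> n \<and> l \<le> n")
  case True
  have "(\<Sum>k\<le>n. (\<Sum>l\<le>n. (\<Sum>u\<le>w. c u * G u (w - u) k l) * t ^ l) * z ^ k) = 0" for z t
    using sum_slice[OF G B, where c = c and w = w] 0 by simp
  then have "(\<Sum>l\<le>n. (\<Sum>u\<le>w. c u * G u (w - u) k l) * t ^ l) = 0" for t
    using True by (intro sum_powers_eq_0_imp[of "\<lambda>k. \<Sum>l\<le>n. (\<Sum>u\<le>w. c u * G u (w - u) k l) * t ^ l"]) auto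
  then show ?thesis
    using True by (intro sum_powers_eq_0_imp[of "\<lambda>l. \<Sum>u\<le>w. c u * G u (w - u) k l"]) auto
next
  case False
  then have "G u v k l = 0" for u v using G by (auto simp: represents_def)
  then show ?thesis by simp
qed

text \<open>The fourth variable is a dummy: the functional reads only the coefficients with fourth
  exponent 0, which is why \<open>nonzero\<close> is stated at \<open>t = 0\<close>.\<close>

lemma J_piece_neq_3:
  assumes d: "2 * (q + 1) \<le> d" and deg: "Polynomial.degree P \<le> d"
    and sym: "\<And>x y z t. eval4 P x y z t = eval4 P y x z t" "\<And>x y z t. eval4 P x y z t = eval4 P x z y t"
    and B: "\<And>x y z t. poly (poly (B z t) [:x:]) y = eval4 P x y z t"
    and vanish: "\<And>k w z t. 1 \<le> k \<Longrightarrow> k \<le> q \<Longrightarrow>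
      (\<Sum>u\<le>w. ecoef d k u (w - u) * coeff (coeff (B z t) u) (w - u)) = 0"
    and w: "2 * (q + 1) \<le> w" "w + 2 * (q + 1) \<le> 2 * d"
    and nonzero: "(\<Sum>u\<le>w. ecoef d (q + 1) u (w - u) * coeff (coeff (B z 0) u) (w - u)) \<noteq> 0"
  shows "J_piece d q 3 \<noteq> J_piece d (q + 1) 3"
proof -
  define G where "G i j k l = coeff (coeff (coeff (coeff P i) j) k) l" for i j k l
  obtain n where G: "represents n G (eval4 P)" using represents_eval4 unfolding G_def by blast
  note swap = represents_swap12[OF G sym(1)] represents_swap23[OF G sym(2)]
  have G0: "G i j k l = 0" if "i > d" for i j k l
    using that deg by (simp add: G_def coeff_eq_0)
  define F where "F xs = (if length xs = 3 then G (xs ! 0) (xs ! 1) (xs ! 2) 0 else 0)" for xs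
  have F3: "F [i, j, k] = G i j k 0" for i j k by (simp add: F_def)
  have len: "length xs = 3 \<longleftrightarrow> (\<exists>i j k. xs = [i, j, k])" for xs :: "nat list"
    by (auto simp: length_Suc_conv numeral_3_eq_3)
  have "\<exists>k. (\<Sum>u\<le>w. ecoef d (q + 1) u (w - u) * G u (w - u) k 0) \<noteq> 0"
  proof (rule ccontr)
    assume "\<not> ?thesis"
    then have "(\<Sum>l\<le>n. (\<Sum>u\<le>w. ecoef d (q + 1) u (w - u) * G u (w - u) k l) * 0 ^ l) = 0" for k
      by (intro sum.neutral) (auto simp: power_0_left)
    with sum_slice[OF G B, where c = "\<lambda>u. ecoef d (q + 1) u (w - u)" and w = w] nonzero show False by simp
  qed
  then obtain k where k: "(\<Sum>u\<le>w. ecoef d (q + 1) u (w - u) * G u (w - u) k 0) \<noteq> 0" ..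
  show ?thesis
  proof (rule J_piece_neq_list[where F = F and xs = "[k]", OF d])
    show "F (us @ x # y # vs) = F (us @ y # x # vs)" for us x y vs
    proof (cases "length (us @ x # y # vs) = 3")
      case True
      then consider a where "us = []" "vs = [a]" | a where "us = [a]" "vs = []"
        by (cases us; cases vs) (auto simp: length_Suc_conv numeral_3_eq_3)
      then show ?thesis using swap by cases (auto simp: F3)
    qed (simp add: F_def)
    show "F xs = 0" if "x \<in> set xs" "x > d" for xs x
    proof (cases "length xs = 3")
      case True
      then obtain i j k where "xs = [i, j, k]" using len by blast
      with that show ?thesis using G0 swap by (auto simp: F3) metis+
    qed (simp add: F_def)
    show "(\<Sum>u\<le>w. ecoef d k u (w - u) * F (u # (w - u) # xs)) = 0"
      if "1 \<le> k" "k \<le> q" "length xs + 2 = 3" for k w xs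
    proof -
      from that(3) obtain a where "xs = [a]" by (auto simp: length_Suc_conv)
      with sum_slice_eq_0[OF G B vanish[OF that(1,2)]] show ?thesis by (simp add: F3)
    qed
    show "(\<Sum>u\<le>w. ecoef d (q + 1) u (w - u) * F (u # (w - u) # [k])) \<noteq> 0"
      using k by (simp add: F3)
  qed (use w in auto)
qed

lemma J_piece_neq_4:
  assumes d: "2 * (q + 1) \<le> d" and deg: "Polynomial.degree P \<le> d"
    and sym: "\<And>x y z t. eval4 P x y z t = eval4 P y x z t" "\<And>x y z t. eval4 P x y z t = eval4 P x z y t"
      "\<And>x y z t. eval4 P x y z t = eval4 P x y t z"
    and B: "\<And>x y z t. poly (poly (B z t) [:x:]) y = eval4 P x y z t"
    and vanish: "\<And>k w z t. 1 \<le> k \<Longrightarrow> k \<le> q \<Longrightarrow>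
      (\<Sum>u\<le>w. ecoef d k u (w - u) * coeff (coeff (B z t) u) (w - u)) = 0"
    and w: "2 * (q + 1) \<le> w" "w + 2 * (q + 1) \<le> 2 * d"
    and nonzero: "(\<Sum>u\<le>w. ecoef d (q + 1) u (w - u) * coeff (coeff (B z t) u) (w - u)) \<noteq> 0"
  shows "J_piece d q 4 \<noteq> J_piece d (q + 1) 4"
proof -
  define G where "G i j k l = coeff (coeff (coeff (coeff P i) j) k) l" for i j k l
  obtain n where G: "represents n G (eval4 P)" using represents_eval4 unfolding G_def by blast
  note swap = represents_swap12[OF G sym(1)] represents_swap23[OF G sym(2)] represents_swap34[OF G sym(3)]
  have G0: "G i j k l = 0" if "i > d" for i j k l
    using that deg by (simp add: G_def coeff_eq_0)
  \<comment> \<open>Symmetry carries the degree bound from the first variable to the others.\<close>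
  have G1: "G i j k l = 0" if "j > d" for i j k l using G0 swap that by metis
  have G2: "G i j k l = 0" if "k > d" for i j k l using G1 swap that by metis
  have G3: "G i j k l = 0" if "l > d" for i j k l using G2 swap that by metis
  define F where "F xs = (if length xs = 4 then G (xs ! 0) (xs ! 1) (xs ! 2) (xs ! 3) else 0)" for xs
  have F4: "F [i, j, k, l] = G i j k l" for i j k l by (simp add: F_def)
  have len: "length xs = 4 \<longleftrightarrow> (\<exists>i j k l. xs = [i, j, k, l])" for xs :: "nat list"
    by (auto simp: length_Suc_conv eval_nat_numeral)
  have "\<exists>k l. (\<Sum>u\<le>w. ecoef d (q + 1) u (w - u) * G u (w - u) k l) \<noteq> 0"
  proof (rule ccontr)
    assume "\<not> ?thesis"
    with sum_slice[OF G B, where c = "\<lambda>u. ecoef d (q + 1) u (w - u)" and w = w] nonzero show False by simp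
  qed
  then obtain k l where k: "(\<Sum>u\<le>w. ecoef d (q + 1) u (w - u) * G u (w - u) k l) \<noteq> 0" by blast
  show ?thesis
  proof (rule J_piece_neq_list[where F = F and xs = "[k, l]", OF d])
    show "F (us @ x # y # vs) = F (us @ y # x # vs)" for us x y vs
    proof (cases "length (us @ x # y # vs) = 4")
      case True
      then consider a b where "us = []" "vs = [a, b]" | a b where "us = [a]" "vs = [b]"
        | a b where "us = [a, b]" "vs = []"
        by (cases us; cases vs; cases "tl us"; cases "tl vs") (auto simp: length_Suc_conv eval_nat_numeral)
      then show ?thesis using swap by cases (auto simp: F4)
    qed (simp add: F_def)
    show "F xs = 0" if "x \<in> set xs" "x > d" for xs x
    proof (cases "length xs = 4")
      case True
      then obtain i j k l where "xs = [i, j, k, l]" using len by blast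
      with that show ?thesis by (auto simp: F4 G0 G1 G2 G3)
    qed (simp add: F_def)
    show "(\<Sum>u\<le>w. ecoef d k u (w - u) * F (u # (w - u) # xs)) = 0"
      if "1 \<le> k" "k \<le> q" "length xs + 2 = 4" for k w xs
    proof -
      from that(3) obtain a b where "xs = [a, b]" by (auto simp: length_Suc_conv eval_nat_numeral)
      with sum_slice_eq_0[OF G B vanish[OF that(1,2)]] show ?thesis by (simp add: F4)
    qed
    show "(\<Sum>u\<le>w. ecoef d (q + 1) u (w - u) * F (u # (w - u) # [k, l])) \<noteq> 0"
      using k by (simp add: F4)
  qed (use w in auto)
qed

section \<open>The differential operators on the diagonal\<close>

definition esum :: "nat \<Rightarrow> nat \<Rightarrow> nat \<Rightarrow> rat poly poly \<Rightarrow> rat" where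
  "esum d k w B = (\<Sum>u\<le>w. ecoef d k u (w - u) * coeff (coeff B u) (w - u))"

text \<open>The coefficient of degree \<open>w\<close> in the restriction of
  \<open>y1^l y2^s \<partial>1^l \<partial>2^s B / (l! s!)\<close> to
  \<open>y1 = y2\<close>.\<close>

definition bsum :: "nat \<Rightarrow> nat \<Rightarrow> nat \<Rightarrow> rat poly poly \<Rightarrow> rat" where
  "bsum l s w B = (\<Sum>u\<le>w. of_nat (u choose l) * of_nat ((w - u) choose s) * coeff (coeff B u) (w - u))"

definition delta :: "rat poly poly" where
  "delta = [:- X, 1:]"

lemma poly_delta: "poly (poly delta [:x:]) y = x - y"
  by (simp add: delta_def)

lemma esum_eq_bsum:
  "esum d k w B = (\<Sum>l\<le>2 * k. (-1) ^ l * of_nat (2 * k choose l) /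
     (of_nat (d choose l) * of_nat (d choose (2 * k - l))) * bsum l (2 * k - l) w B)"
proof -
  have "esum d k w B = (\<Sum>u\<le>w. \<Sum>l\<le>2 * k. (-1) ^ l * of_nat (2 * k choose l) /
     (of_nat (d choose l) * of_nat (d choose (2 * k - l))) *
     (of_nat (u choose l) * of_nat ((w - u) choose (2 * k - l)) * coeff (coeff B u) (w - u)))"
    unfolding esum_def ecoef_def sum_distrib_right by (intro sum.cong refl) simp
  then show ?thesis by (subst (asm) sum.swap) (simp add: bsum_def sum_distrib_left)
qed

lemma coeff_delta_mult:
  "coeff (coeff (delta * B) u) v =
    (if u = 0 then 0 else coeff (coeff B (u - 1)) v) - (if v = 0 then 0 else coeff (coeff B u) (v - 1))"
  by (cases u; cases v) (simp_all add: delta_def)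

lemma bsum_delta_mult_0: "bsum l s 0 (delta * B) = 0"
  by (simp add: bsum_def coeff_delta_mult)

text \<open>The Leibniz rule: \<open>y1 - y2\<close> vanishes on the diagonal, so only the terms
  survive in which one derivative falls on this factor.\<close>

lemma bsum_delta_mult_Suc:
  "bsum l s (Suc w) (delta * B) =
    (if l = 0 then 0 else bsum (l - 1) s w B) - (if s = 0 then 0 else bsum l (s - 1) w B)"
proof -
  let ?g = "\<lambda>u. coeff (coeff B u) (w - u)"
  have "bsum l s (Suc w) (delta * B) =
      (\<Sum>u\<le>Suc w. of_nat (u choose l) * of_nat ((Suc w - u) choose s) *
         (if u = 0 then 0 else coeff (coeff B (u - 1)) (Suc w - u))) -
      (\<Sum>u\<le>Suc w. of_nat (u choose l) * of_nat ((Suc w - u) choose s) *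
         (if Suc w - u = 0 then 0 else coeff (coeff B u) (Suc w - u - 1)))"
    by (simp only: bsum_def coeff_delta_mult right_diff_distrib sum_subtractf)
  also have "(\<Sum>u\<le>Suc w. of_nat (u choose l) * of_nat ((Suc w - u) choose s) *
         (if u = 0 then 0 else coeff (coeff B (u - 1)) (Suc w - u))) =
      (\<Sum>u\<le>w. of_nat (Suc u choose l) * of_nat ((w - u) choose s) * ?g u)"
    by (subst sum.atMost_Suc_shift) simp
  also have "(\<Sum>u\<le>Suc w. of_nat (u choose l) * of_nat ((Suc w - u) choose s) *
         (if Suc w - u = 0 then 0 else coeff (coeff B u) (Suc w - u - 1))) =
      (\<Sum>u\<le>w. of_nat (u choose l) * of_nat (Suc (w - u) choose s) * ?g u)"
    by (subst sum.atMost_Suc) (auto simp: Suc_diff_le intro!: sum.cong)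
  finally have "bsum l s (Suc w) (delta * B) =
      (\<Sum>u\<le>w. (of_nat (Suc u choose l) * of_nat ((w - u) choose s) -
         of_nat (u choose l) * of_nat (Suc (w - u) choose s)) * ?g u)"
    by (simp add: left_diff_distrib sum_subtractf)
  also have "\<dots> = (\<Sum>u\<le>w. ((if l = 0 then 0 else of_nat (u choose (l - 1)) * of_nat ((w - u) choose s)) -
         (if s = 0 then 0 else of_nat (u choose l) * of_nat ((w - u) choose (s - 1)))) * ?g u)"
    by (rule sum.cong) (cases l; cases s; auto simp: algebra_simps)+
  finally show ?thesis
    by (cases l; cases s) (simp_all add: bsum_def left_diff_distrib sum_subtractf sum_negf)
qed

lemma bsum_delta_power_less: "l + s < M \<Longrightarrow> bsum l s w (delta ^ M * B) = 0"
proof (induction M arbitrary: l s w)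
  case (Suc M)
  show ?case
  proof (cases w)
    case 0
    then show ?thesis by (simp add: mult.assoc bsum_delta_mult_0)
  next
    case (Suc v)
    have "bsum (l - 1) s v (delta ^ M * B) = 0" if "l \<noteq> 0" by (rule Suc.IH) (use that Suc.prems in simp)
    moreover have "bsum l (s - 1) v (delta ^ M * B) = 0" if "s \<noteq> 0"
      by (rule Suc.IH) (use that Suc.prems in simp)
    ultimately show ?thesis
      by (cases "l = 0"; cases "s = 0") (simp_all add: mult.assoc bsum_delta_mult_Suc Suc)
  qed
qed simp

text \<open>All \<open>M\<close> derivatives are spent on the factors \<open>y1 - y2\<close>; the
  constant is the coefficient of \<open>y1^l y2^s\<close> in \<open>(y1 - y2)^M\<close>.\<close>

lemma bsum_delta_power_eq:
  "l + s = M \<Longrightarrow> bsum l s (w + M) (delta ^ M * B) = (-1) ^ s * of_nat (M choose s) * bsum 0 0 w B"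
proof (induction M arbitrary: l s)
  case (Suc M)
  have 1: "bsum (l - 1) s (w + M) (delta ^ M * B) = (-1) ^ s * of_nat (M choose s) * bsum 0 0 w B" if "l \<noteq> 0"
    by (rule Suc.IH) (use that Suc.prems in simp)
  have 2: "bsum l (s - 1) (w + M) (delta ^ M * B) =
      (-1) ^ (s - 1) * of_nat (M choose (s - 1)) * bsum 0 0 w B" if "s \<noteq> 0"
    by (rule Suc.IH) (use that Suc.prems in simp)
  have "bsum l s (w + Suc M) (delta ^ Suc M * B) =
      (if l = 0 then 0 else bsum (l - 1) s (w + M) (delta ^ M * B)) -
      (if s = 0 then 0 else bsum l (s - 1) (w + M) (delta ^ M * B))"
    by (simp add: mult.assoc bsum_delta_mult_Suc)
  then show ?case
    using 1 2 Suc.prems by (cases l; cases s) (auto simp: algebra_simps binomial_eq_0)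
qed simp

lemma esum_delta_power_less: "2 * k < M \<Longrightarrow> esum d k w (delta ^ M * B) = 0"
  by (simp add: esum_eq_bsum bsum_delta_power_less)

definition esum_const :: "nat \<Rightarrow> nat \<Rightarrow> rat" where
  "esum_const d k = (\<Sum>l\<le>2 * k. of_nat ((2 * k choose l)\<^sup>2) /
     (of_nat (d choose l) * of_nat (d choose (2 * k - l))))"

lemma esum_const_pos:
  assumes "2 * k \<le> d"
  shows "esum_const d k > 0"
  unfolding esum_const_def
proof (rule sum_pos)
  fix l assume "l \<in> {..2 * k}"
  then have "2 * k choose l > 0" "d choose l > 0" "d choose (2 * k - l) > 0" using assms by auto
  then show "0 < rat_of_nat ((2 * k choose l)\<^sup>2) / (of_nat (d choose l) * of_nat (d choose (2 * k - l)))"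
    by simp
qed auto

text \<open>The sign \<open>(-1)^l\<close> of the operator and the sign \<open>(-1)^(2k - l)\<close>
  from the power of \<open>delta\<close> multiply to 1. Hence \<open>esum_const\<close> is a sum of
  positive terms and cannot vanish.\<close>

lemma esum_delta_power_eq:
  assumes "M = 2 * k"
  shows "esum d k M (delta ^ M * B) = esum_const d k * coeff (coeff B 0) 0"
proof -
  have "(-1) ^ l * of_nat (2 * k choose l) / (of_nat (d choose l) * of_nat (d choose (2 * k - l))) *
      bsum l (2 * k - l) M (delta ^ M * B) =
      of_nat ((2 * k choose l)\<^sup>2) / (of_nat (d choose l) * of_nat (d choose (2 * k - l))) * coeff (coeff B 0) 0"
    if "l \<in> {..2 * k}" for l
  proof -
    have l: "l \<le> 2 * k" using that by simp
    have "bsum l (2 * k - l) M (delta ^ M * B) =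
        (-1) ^ (2 * k - l) * of_nat (2 * k choose (2 * k - l)) * coeff (coeff B 0) 0"
      using bsum_delta_power_eq[of l "2 * k - l" M 0 B] l assms by (simp add: bsum_def)
    moreover have "2 * k choose (2 * k - l) = 2 * k choose l" using binomial_symmetric[OF l] by simp
    moreover have "(-1) ^ l * (-1) ^ (2 * k - l) = (1 :: rat)" using l by (simp flip: power_add)
    ultimately show ?thesis by (simp add: power2_eq_square)
  qed
  then show ?thesis
    unfolding esum_eq_bsum esum_const_def sum_distrib_right by (intro sum.cong refl) blast
qed

lemma coeff_of_int_mult: "coeff (of_int c * p) i = of_int c * (coeff p i :: 'a::comm_ring_1)"
  by (simp add: of_int_poly)

lemma coeff_of_int_mult2: "coeff (coeff (of_int c * B) i) j = of_int c * (coeff (coeff B i) j :: rat)"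
  by (simp add: of_int_poly)

lemma esum_add: "esum d k w (A + B) = esum d k w A + esum d k w B"
  by (simp add: esum_def distrib_left sum.distrib)

lemma esum_of_int_mult: "esum d k w (of_int c * B) = of_int c * esum d k w B"
  unfolding esum_def coeff_of_int_mult2 sum_distrib_left by (intro sum.cong refl) simp

text \<open>
  For \<open>k = 1\<close> the vanishing of \<open>esum d 1 w B\<close> for all \<open>w\<close> is the differential equation
  \<open>d \<partial>\<^sub>1\<^sup>2 B = (d - 1) \<partial>\<^sub>1 \<partial>\<^sub>2 B\<close> on the diagonal, written without \<open>\<partial>\<^sub>2\<close> by means of the chain rule.
\<close>

definition defect :: "nat \<Rightarrow> rat poly poly \<Rightarrow> rat poly" where
  "defect d B = of_int (int d) * pderiv (pderiv (poly B X)) -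
     of_int (4 * int d - 2) * (pderiv (poly (pderiv B) X) - poly (pderiv (pderiv B)) X)"

lemma coeff_diagonal_pderiv:
  "coeff (poly (pderiv B) X) w = (\<Sum>u\<le>Suc w. of_nat u * coeff (coeff B u) (Suc w - u) :: rat)"
  by (subst sum.atMost_Suc_shift)
    (simp add: coeff_diagonal coeff_pderiv coeff_of_nat_mult_poly del: of_nat_Suc)

lemma coeff_diagonal_pderiv2:
  "coeff (poly (pderiv (pderiv B)) X) w =
    (\<Sum>u\<le>Suc (Suc w). of_nat u * (of_nat u - 1) * coeff (coeff B u) (Suc (Suc w) - u) :: rat)"
proof -
  have "coeff (poly (pderiv (pderiv B)) X) w =
      (\<Sum>u\<le>w. of_nat (Suc u) * (of_nat (Suc (Suc u)) * coeff (coeff B (Suc (Suc u))) (w - u)))"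
    by (simp add: coeff_diagonal coeff_pderiv coeff_of_nat_mult_poly del: of_nat_Suc)
  then show ?thesis
    by (subst sum.atMost_Suc_shift, subst sum.atMost_Suc_shift) (simp add: algebra_simps)
qed

lemma esum_1_eq_0:
  assumes "d \<ge> 2" "defect d B = 0"
  shows "esum d 1 w B = 0"
proof -
  define D :: rat where "D = of_nat d"
  have D: "D \<noteq> 0" "D - 1 \<noteq> 0" using assms by (auto simp: D_def)
  let ?g = "\<lambda>u. coeff (coeff B u) (w - u)"
  let ?U = "\<lambda>u. rat_of_nat u" and ?w = "rat_of_nat w"
  \<comment> \<open>In fixed weight the symbol is affine in \<open>u * (w - u)\<close>: the constant
    part is the second derivative along the diagonal, the other part the mixed derivative.\<close>
  have e: "ecoef d 1 u (w - u) = (D * ?w * (?w - 1) - (4 * D - 2) * (?U u * (?w - ?U u))) / (D\<^sup>2 * (D - 1))"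
    if "u \<le> w" for u
  proof -
    have "v * (v - 1) / 2 / (D * (D - 1) / 2) - 2 * u * v / D\<^sup>2 + u * (u - 1) / 2 / (D * (D - 1) / 2) =
        (D * (u + v) * (u + v - 1) - (4 * D - 2) * (u * v)) / (D\<^sup>2 * (D - 1))" for u v :: rat
    proof -
      have "a * (a - 1) / 2 / (D * (D - 1) / 2) = D * (a * (a - 1)) / (D\<^sup>2 * (D - 1))" for a
        using D by (simp add: power2_eq_square)
      moreover have "2 * u * v / D\<^sup>2 = 2 * u * v * (D - 1) / (D\<^sup>2 * (D - 1))" using D by simp
      ultimately show ?thesis
        by (simp only: add_divide_distrib[symmetric] diff_divide_distrib[symmetric])
          (simp add: algebra_simps)
    qed
    from this[of "rat_of_nat (w - u)" "?U u"] that show ?thesis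
      unfolding ecoef_1 of_nat_choose_two D_def by (simp add: of_nat_diff)
  qed
  have "esum d 1 w B = (\<Sum>u\<le>w. (D * ?w * (?w - 1) - (4 * D - 2) * (?U u * (?w - ?U u))) * ?g u) / (D\<^sup>2 * (D - 1))"
    unfolding esum_def sum_divide_distrib by (intro sum.cong refl) (simp only: e atMost_iff, simp)
  also have "(\<Sum>u\<le>w. (D * ?w * (?w - 1) - (4 * D - 2) * (?U u * (?w - ?U u))) * ?g u) = 0"
  proof -
    consider "w = 0" | "w = 1" | v where "w = Suc (Suc v)" by (metis One_nat_def not0_implies_Suc)
    then show ?thesis
    proof cases
      case 3
      let ?v = "rat_of_nat v"
      define S0 S1 S2 where "S0 = (\<Sum>u\<le>w. ?g u)" and "S1 = (\<Sum>u\<le>w. ?U u * ?g u)"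
        and "S2 = (\<Sum>u\<le>w. ?U u * (?U u - 1) * ?g u)"
      have "coeff (poly B X) w = S0" "coeff (poly (pderiv B) X) (Suc v) = S1"
        "coeff (poly (pderiv (pderiv B)) X) v = S2"
        unfolding S0_def S1_def S2_def 3
        by (rule coeff_diagonal coeff_diagonal_pderiv coeff_diagonal_pderiv2)+
      then have "coeff (defect d B) v = D * ((?v + 1) * ((?v + 2) * S0)) - (4 * D - 2) * ((?v + 1) * S1 - S2)"
        unfolding defect_def coeff_diff coeff_of_int_mult coeff_pderiv by (simp add: D_def 3 algebra_simps)
      then have "0 = D * ((?v + 1) * ((?v + 2) * S0)) - (4 * D - 2) * ((?v + 1) * S1 - S2)"
        using assms by simp
      also have "\<dots> = D * ?w * (?w - 1) * S0 - (4 * D - 2) * ((?w - 1) * S1 - S2)"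
        by (simp add: 3 algebra_simps)
      also have "\<dots> = (\<Sum>u\<le>w. (D * ?w * (?w - 1) - (4 * D - 2) * (?U u * (?w - ?U u))) * ?g u)"
        unfolding S0_def S1_def S2_def sum_distrib_left sum_subtractf[symmetric]
        by (intro sum.cong refl) (simp add: algebra_simps)
      finally show ?thesis by simp
    qed auto
  qed
  finally show ?thesis by simp
qed

lemma defect_add: "defect d (A + B) = defect d A + defect d B"
  by (simp add: defect_def pderiv_add algebra_simps)

lemma pderiv_of_int_mult: "pderiv (of_int c * p) = of_int c * pderiv (p :: 'a::idom poly)"
  by (simp add: of_int_poly pderiv_smult)

lemma pderiv_of_nat_mult: "pderiv (of_nat c * p) = of_nat c * pderiv (p :: 'a::idom poly)"
  by (simp add: of_nat_poly pderiv_smult)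

lemma defect_of_int_mult: "defect d (of_int c * B) = of_int c * defect d B"
  by (simp only: defect_def pderiv_of_int_mult poly_mult poly_of_int right_diff_distrib mult.left_commute)

lemma poly_delta_X: "poly delta X = 0"
  by (simp add: delta_def)

lemma pderiv_delta_mult: "pderiv (delta * f) = f + delta * pderiv f"
proof -
  have "pderiv delta = 1" by (simp add: delta_def pderiv_pCons one_pCons)
  then show ?thesis by (simp add: pderiv_mult)
qed

lemma defect_delta_sq_mult: "defect d (delta ^ 2 * f) = of_int (2 * (4 * int d - 2)) * poly f X"
  by (simp add: defect_def power2_eq_square mult.assoc pderiv_delta_mult pderiv_add poly_delta_X)

lemma pderiv_power_Suc': "pderiv (p ^ Suc n) = of_nat (Suc n) * p ^ n * pderiv (p :: 'a::idom poly)"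
  by (simp add: pderiv_power_Suc of_nat_poly del: of_nat_Suc power_Suc)

text \<open>The base is the polarisation of a quadratic polynomial
  \<open>q = p - 2 h x + \<epsilon> x^2\<close>, whose half derivative \<open>r\<close> satisfies
  \<open>r^2 = \<epsilon> q + (h^2 - \<epsilon> p)\<close>. The contributions of
  \<open>\<epsilon> q\<close> cancel if the exponent \<open>m + 2\<close> equals \<open>d\<close> or
  if \<open>\<epsilon> = 0\<close>; the latter case serves a point at infinity.\<close>

lemma defect_bilinear_power:
  assumes "\<epsilon> = 0 \<or> m + 2 = d"
  shows "defect d ([:[:p, - h:], [:- h, \<epsilon>:]:] ^ Suc (Suc m)) =
    of_nat (2 * Suc (Suc m) * Suc m) * [:h\<^sup>2 - \<epsilon> * p:] * poly [:[:p, - h:], [:- h, \<epsilon>:]:] X ^ m"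
proof -
  define D where "D = [:[:p, - h:], [:- h, \<epsilon>:]:]"
  define r where "r = [:- h, \<epsilon>:]"
  define q where "q = poly D X"
  define a b where "a = rat_of_nat (Suc (Suc m))" and "b = rat_of_nat (Suc m)"
  have q: "pderiv q = 2 * r" by (simp add: q_def D_def r_def pderiv_pCons numeral_poly)
  have r: "pderiv r = [:\<epsilon>:]" by (simp add: r_def pderiv_pCons)
  have rr: "r * r = [:\<epsilon>:] * q + [:h\<^sup>2 - \<epsilon> * p:]"
    by (simp add: q_def D_def r_def power2_eq_square algebra_simps)
  have D': "pderiv D = [:r:]" by (simp add: D_def r_def pderiv_pCons)
  have P1: "pderiv (D ^ Suc (Suc m)) = of_nat (Suc (Suc m)) * (D ^ Suc m * [:r:])"
    by (simp only: pderiv_power_Suc' D' mult.assoc)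
  have "pderiv (D ^ Suc m * [:r:]) = of_nat (Suc m) * (D ^ m * [:r:] * [:r:])"
    by (simp only: pderiv_mult pderiv_power_Suc' D' mult.assoc) (simp add: pderiv_pCons)
  then have P2: "pderiv (pderiv (D ^ Suc (Suc m))) = of_nat (Suc (Suc m)) * (of_nat (Suc m) * (D ^ m * [:r:] * [:r:]))"
    by (simp only: P1 pderiv_of_nat_mult)
  have g0: "pderiv (pderiv (q ^ Suc (Suc m))) =
      of_nat (Suc (Suc m)) * (of_nat (Suc m) * q ^ m * (2 * r) * (2 * r) + q ^ Suc m * (2 * [:\<epsilon>:]))"
  proof -
    have "pderiv (2 * r) = 2 * [:\<epsilon>:]"
      using pderiv_of_nat_mult[of 2 r] r by simp
    then have "pderiv (q ^ Suc m * (2 * r)) = of_nat (Suc m) * q ^ m * (2 * r) * (2 * r) + q ^ Suc m * (2 * [:\<epsilon>:])"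
      by (simp only: pderiv_mult pderiv_power_Suc' q) (simp only: ac_simps)
    moreover have "pderiv (q ^ Suc (Suc m)) = of_nat (Suc (Suc m)) * (q ^ Suc m * (2 * r))"
      by (simp only: pderiv_power_Suc' q mult.assoc)
    ultimately show ?thesis by (simp only: pderiv_of_nat_mult)
  qed
  have g1: "pderiv (of_nat (Suc (Suc m)) * (q ^ Suc m * r)) =
      of_nat (Suc (Suc m)) * (of_nat (Suc m) * q ^ m * (2 * r) * r + q ^ Suc m * [:\<epsilon>:])"
  proof -
    have "pderiv (q ^ Suc m * r) = of_nat (Suc m) * q ^ m * (2 * r) * r + q ^ Suc m * [:\<epsilon>:]"
      by (simp only: pderiv_mult pderiv_power_Suc' q r) (simp only: ac_simps)
    then show ?thesis by (simp only: pderiv_of_nat_mult)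
  qed
  have "defect d (D ^ Suc (Suc m)) =
     of_nat (2 * Suc (Suc m)) * q ^ m * (of_nat (Suc m) * (r * r) - of_int (int d - 1) * ([:\<epsilon>:] * q))"
  proof -
    have "poly (pderiv (D ^ Suc (Suc m))) X = of_nat (Suc (Suc m)) * (q ^ Suc m * r)"
      unfolding P1 poly_mult poly_power poly_of_nat q_def[symmetric] by simp
    moreover have "poly (pderiv (pderiv (D ^ Suc (Suc m)))) X = of_nat (Suc (Suc m)) * (of_nat (Suc m) * (q ^ m * r * r))"
      unfolding P2 poly_mult poly_power poly_of_nat q_def[symmetric] by simp
    moreover have "poly (D ^ Suc (Suc m)) X = q ^ Suc (Suc m)" by (simp only: poly_power q_def)
    ultimately show ?thesis
      unfolding defect_def by (simp only: g0 g1)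
        (simp add: algebra_simps del: mult_pCons_left mult_pCons_right smult_pCons)
  qed
  also have "of_nat (Suc m) * (r * r) - of_int (int d - 1) * ([:\<epsilon>:] * q) =
      of_nat (Suc m) * [:h\<^sup>2 - \<epsilon> * p:]"
  proof -
    have "of_int (int d - 1) * ([:\<epsilon>:] * q) = of_nat (Suc m) * ([:\<epsilon>:] * q)"
      using assms by auto
    then show ?thesis unfolding rr by (simp only: distrib_left add_diff_cancel_left')
  qed
  finally show ?thesis
    by (simp only: D_def q_def of_nat_mult mult_ac)
qed

section \<open>The symmetric polynomials\<close>

type_synonym poly4 = "rat poly poly poly poly"

definition Y1 :: poly4 where "Y1 = [:0, 1:]"
definition Y2 :: poly4 where "Y2 = [:[:0, 1:]:]"
definition Y3 :: poly4 where "Y3 = [:[:[:0, 1:]:]:]"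
definition Y4 :: poly4 where "Y4 = [:[:[:[:0, 1:]:]:]:]"

lemma eval4_var:
  "eval4 Y1 x y z t = x" "eval4 Y2 x y z t = y" "eval4 Y3 x y z t = z" "eval4 Y4 x y z t = t"
  by (simp_all add: eval4_def Y1_def Y2_def Y3_def Y4_def)

lemma eval4_ring:
  "eval4 (P + Q) x y z t = eval4 P x y z t + eval4 Q x y z t"
  "eval4 (P - Q) x y z t = eval4 P x y z t - eval4 Q x y z t"
  "eval4 (P * Q) x y z t = eval4 P x y z t * eval4 Q x y z t"
  "eval4 (P ^ n) x y z t = eval4 P x y z t ^ n"
  "eval4 (of_int c) x y z t = of_int c"
  "eval4 (numeral m) x y z t = numeral m"
  by (simp_all add: eval4_def)

lemma degree_var:
  "Polynomial.degree Y1 = 1" "Polynomial.degree Y2 = 0" "Polynomial.degree Y3 = 0" "Polynomial.degree Y4 = 0"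
  by (simp_all add: Y1_def Y2_def Y3_def Y4_def)

lemma degree_mult_leI:
  "Polynomial.degree p \<le> m \<Longrightarrow> Polynomial.degree q \<le> n \<Longrightarrow> m + n \<le> r \<Longrightarrow> Polynomial.degree (p * q) \<le> r"
  by (meson add_mono degree_mult_le order_trans)

lemma degree_power_leI:
  "Polynomial.degree p \<le> m \<Longrightarrow> m * n \<le> r \<Longrightarrow> Polynomial.degree (p ^ n) \<le> r"
  by (meson degree_power_le mult_le_mono1 order_trans)

lemma square_eq_if_neg: "a = - b \<Longrightarrow> a ^ 2 = (b ^ 2 :: 'a::comm_ring_1)"
  by simp

section \<open>Powers of the Vandermonde product\<close>

lemma J_piece_neq_3_vandermonde:
  assumes "q \<ge> 1" "d \<ge> 4 * (q + 1)"
  shows "J_piece d q 3 \<noteq> J_piece d (q + 1) 3"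
proof -
  define P where "P = (((Y1 - Y2) * (Y1 - Y3) * (Y2 - Y3)) ^ 2) ^ (q + 1)"
  define B where "B z = delta ^ (2 * (q + 1)) * ([:[:- z:], 1:] * [:[:- z, 1:]:]) ^ (2 * (q + 1))" for z :: rat
  have e: "eval4 P x y z t = (((x - y) * (x - z) * (y - z)) ^ 2) ^ (q + 1)" for x y z t
    by (simp add: P_def eval4_ring eval4_var)
  show ?thesis
  \<comment> \<open>In the lowest weight only the value of the cofactor of the power of
    \<open>delta\<close> at \<open>y1 = y2 = 0\<close> enters; it is nonzero as \<open>z\<close> is
    not 0.\<close>
  proof (rule J_piece_neq_3[where B = "\<lambda>z t. B z" and P = P and w = "2 * (q + 1)" and z = 1])
    have "Polynomial.degree ((Y1 - Y2) * (Y1 - Y3) * (Y2 - Y3)) \<le> 2"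
      by (intro degree_mult_leI[where m = 2 and n = 0] degree_mult_leI[where m = 1 and n = 1] degree_diff_le)
        (simp_all add: degree_var)
    then show "Polynomial.degree P \<le> d"
      unfolding P_def using assms
      by (intro degree_power_leI[where m = 4] degree_power_leI[where m = 2 and n = 2]) auto
    have "((x - y) * (x - z) * (y - z)) ^ 2 = ((y - x) * (y - z) * (x - z)) ^ 2"
      "((x - y) * (x - z) * (y - z)) ^ 2 = ((x - z) * (x - y) * (z - y)) ^ 2" for x y z :: rat
      by (rule square_eq_if_neg, simp add: algebra_simps)+
    then show "eval4 P x y z t = eval4 P y x z t" "eval4 P x y z t = eval4 P x z y t" for x y z t
      unfolding e by metis+
    define n where "n = 2 * (q + 1)"
    have "poly (poly (B z) [:x:]) y = (x - y) ^ n * ((x - z) * (y - z)) ^ n" for x y z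
    proof -
      have "poly (poly [:[:- z:], 1:] [:x:]) y = x - z" "poly (poly [:[:- z, 1:]:] [:x:]) y = y - z" by simp_all
      then show ?thesis unfolding B_def n_def[symmetric] by (simp only: poly_mult poly_power poly_delta)
    qed
    then show "poly (poly (B z) [:x:]) y = eval4 P x y z t" for x y z t
      unfolding e power_mult[symmetric] n_def[symmetric] by (simp only: power_mult_distrib mult_ac)
    show "(\<Sum>u\<le>w. ecoef d k u (w - u) * coeff (coeff (B z) u) (w - u)) = 0" if "k \<le> q" for k w z
      using that unfolding B_def esum_def[symmetric] by (intro esum_delta_power_less) simp
    have "coeff (coeff (([:[:- 1:], 1:] * [:[:- 1, 1:]:]) ^ (2 * (q + 1))) 0) 0 = (1 :: rat)"
      unfolding poly_0_coeff_0[symmetric] poly_power poly_mult by simp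
    then have "esum d (q + 1) (2 * (q + 1)) (B 1) = esum_const d (q + 1)"
      unfolding B_def by (subst esum_delta_power_eq) auto
    then show "(\<Sum>u\<le>2 * (q + 1). ecoef d (q + 1) u (2 * (q + 1) - u) *
        coeff (coeff (B 1) u) (2 * (q + 1) - u)) \<noteq> 0"
      unfolding esum_def[symmetric] using esum_const_pos[of "q + 1" d] assms by simp
  qed (use assms in auto)
qed

lemma J_piece_neq_4_vandermonde:
  assumes "q \<ge> 1" "d \<ge> 6 * (q + 1)"
  shows "J_piece d q 4 \<noteq> J_piece d (q + 1) 4"
proof -
  define P where "P = (((Y1 - Y2) * (Y1 - Y3) * (Y1 - Y4) * ((Y2 - Y3) * (Y2 - Y4) * (Y3 - Y4))) ^ 2) ^ (q + 1)"
  define B where "B z t = delta ^ (2 * (q + 1)) * ([:[:- z:], 1:] * [:[:- t:], 1:] *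
    ([:[:- z, 1:]:] * [:[:- t, 1:]:] * [:[:z - t:]:])) ^ (2 * (q + 1))" for z t :: rat
  have e: "eval4 P x y z t =
      (((x - y) * (x - z) * (x - t) * ((y - z) * (y - t) * (z - t))) ^ 2) ^ (q + 1)" for x y z t
    by (simp add: P_def eval4_ring eval4_var)
  show ?thesis
  \<comment> \<open>Any two distinct nonzero numbers keep the cofactor nonzero at the
    origin.\<close>
  proof (rule J_piece_neq_4[where B = B and P = P and w = "2 * (q + 1)" and z = 1 and t = 2])
    have "Polynomial.degree ((Y1 - Y2) * (Y1 - Y3) * (Y1 - Y4) * ((Y2 - Y3) * (Y2 - Y4) * (Y3 - Y4))) \<le> 3"
      by (intro degree_mult_leI[where m = 3 and n = 0] degree_mult_leI[where m = 2 and n = 1]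
          degree_mult_leI[where m = 1 and n = 1] degree_mult_leI[where m = 0 and n = 0] degree_diff_le)
        (simp_all add: degree_var)
    then show "Polynomial.degree P \<le> d"
      unfolding P_def using assms
      by (intro degree_power_leI[where m = 6] degree_power_leI[where m = 3 and n = 2]) auto
    let ?V = "\<lambda>x y z t::rat. (x - y) * (x - z) * (x - t) * ((y - z) * (y - t) * (z - t))"
    have "?V x y z t ^ 2 = ?V y x z t ^ 2" "?V x y z t ^ 2 = ?V x z y t ^ 2"
      "?V x y z t ^ 2 = ?V x y t z ^ 2" for x y z t
      by (rule square_eq_if_neg, simp add: algebra_simps)+
    then show "eval4 P x y z t = eval4 P y x z t" "eval4 P x y z t = eval4 P x z y t"
      "eval4 P x y z t = eval4 P x y t z" for x y z t
      unfolding e by metis+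
    define n where "n = 2 * (q + 1)"
    have "poly (poly (B z t) [:x:]) y =
        (x - y) ^ n * ((x - z) * (x - t) * ((y - z) * (y - t) * (z - t))) ^ n" for x y z t
    proof -
      have "poly (poly [:[:- z:], 1:] [:x:]) y = x - z" "poly (poly [:[:- z, 1:]:] [:x:]) y = y - z"
        "poly (poly [:[:- t:], 1:] [:x:]) y = x - t" "poly (poly [:[:- t, 1:]:] [:x:]) y = y - t"
        "poly (poly [:[:z - t:]:] [:x:]) y = z - t"
        by simp_all
      then show ?thesis unfolding B_def n_def[symmetric] by (simp only: poly_mult poly_power poly_delta)
    qed
    then show "poly (poly (B z t) [:x:]) y = eval4 P x y z t" for x y z t
      unfolding e power_mult[symmetric] n_def[symmetric] by (simp only: power_mult_distrib mult_ac)
    show "(\<Sum>u\<le>w. ecoef d k u (w - u) * coeff (coeff (B z t) u) (w - u)) = 0" if "k \<le> q" for k w z t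
      using that unfolding B_def esum_def[symmetric] by (intro esum_delta_power_less) simp
    define c where "c = coeff (coeff (([:[:- 1 :: rat:], 1:] * [:[:- 2:], 1:] *
      ([:[:- 1, 1:]:] * [:[:- 2, 1:]:] * [:[:1 - 2:]:])) ^ (2 * (q + 1))) 0) (0::nat)"
    have c: "c \<noteq> (0::rat)"
      unfolding c_def poly_0_coeff_0[symmetric] poly_power poly_mult by simp
    have "esum d (q + 1) (2 * (q + 1)) (B 1 2) = esum_const d (q + 1) * c"
      unfolding B_def c_def by (subst esum_delta_power_eq) auto
    then show "(\<Sum>u\<le>2 * (q + 1). ecoef d (q + 1) u (2 * (q + 1) - u) *
        coeff (coeff (B 1 2) u) (2 * (q + 1) - u)) \<noteq> 0"
      unfolding esum_def[symmetric] using esum_const_pos[of "q + 1" d] c assms by simp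
  qed (use assms in auto)
qed

text \<open>
  With \<open>A = (y\<^sub>1 - y\<^sub>2) (y\<^sub>3 - y\<^sub>4)\<close>, \<open>B = (y\<^sub>1 - y\<^sub>3) (y\<^sub>2 - y\<^sub>4)\<close> and \<open>C = (y\<^sub>1 - y\<^sub>4) (y\<^sub>2 - y\<^sub>3)\<close>, put
  \<open>D = B + C\<close> and \<open>Y = 4 A\<^sup>2\<close>, where \<open>A = B - C\<close>. The three expressions in \<open>D\<close> and \<open>Y\<close> below are, up to
  constants, the product of the sums \<open>B + C\<close>, \<open>A + B\<close>, \<open>A - C\<close>, the symmetric function
  \<open>A\<^sup>2 + B\<^sup>2 + C\<^sup>2\<close>, and the discriminant \<open>(A B C)\<^sup>2\<close>. The integers \<open>a, b\<close> are chosen such that the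
  terms of order at most \<open>2\<close> in \<open>y\<^sub>1 - y\<^sub>2\<close> satisfy the equation of \<open>defect\<close>.
\<close>

definition ghat :: "int \<Rightarrow> int \<Rightarrow> nat \<Rightarrow> nat \<Rightarrow> 'a::comm_ring_1 \<Rightarrow> 'a \<Rightarrow> 'a" where
  "ghat a b k e D Y = (D * (4 * D ^ 2 - 9 * Y)) ^ e *
    (of_int a * (4 * D ^ 2 + 3 * Y) ^ k + of_int b * (Y * (Y - 4 * D ^ 2) ^ 2) * (4 * D ^ 2 + 3 * Y) ^ (k - 3))"

text \<open>Expansions in powers of \<open>Y\<close> for \<open>d = 6, 7, 8, 9, 10, 11\<close>, in
  this order. Each time \<open>a = 2 * d - 1\<close>, and \<open>b\<close> then solves the linear
  relation between the first two coefficients that \<open>defect_combination\<close>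
  requires.\<close>

lemma ghat_instances:
  fixes D Y :: "'a::comm_ring_1"
  shows "ghat 11 (- 114) 3 0 D Y = of_int 704 * D ^ 6 + of_int (- 240) * (Y * D ^ 4) +
      Y ^ 2 * (of_int 2100 * D ^ 2 + Y * 183)"
    and "ghat 13 (- 132) 3 0 D Y = of_int 832 * D ^ 6 + of_int (- 240) * (Y * D ^ 4) +
      Y ^ 2 * (of_int 2460 * D ^ 2 + Y * 219)"
    and "ghat 15 (- 208) 4 0 D Y = of_int 3840 * D ^ 8 + of_int (- 1792) * (Y * D ^ 6) +
      Y ^ 2 * (of_int 9632 * D ^ 4 + Y * (10640 * D ^ 2 + 591 * Y))"
    and "ghat 17 (- 36) 3 1 D Y = of_int 4352 * D ^ 9 + of_int (- 2304) * (Y * D ^ 7) +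
      Y ^ 2 * (of_int (- 8352) * D ^ 5 + Y * (- 17424 * D ^ 3 - 3807 * (Y * D)))"
    and "ghat 19 (- 330) 5 0 D Y = of_int 19456 * D ^ 10 + of_int (- 11520) * (Y * D ^ 8) +
      Y ^ 2 * (of_int 24960 * D ^ 6 + Y * (92640 * D ^ 4 + 46620 * (Y * D ^ 2) + 1647 * Y ^ 2))"
    and "ghat 21 (- 118) 4 1 D Y = of_int 21504 * D ^ 11 + of_int (- 14080) * (Y * D ^ 9) +
      Y ^ 2 * (of_int (- 12160) * D ^ 7 + Y * (- 100576 * D ^ 5 - 97500 * (Y * D ^ 3) - 12123 * (Y ^ 2 * D)))"
  by (simp_all add: ghat_def algebra_simps power_numeral_reduce)

lemma poly_ghat: "poly (ghat a b k e D Y) x = ghat a b k e (poly D x) (poly Y x)"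
  by (simp add: ghat_def)

lemma eval4_ghat:
  "eval4 (ghat a b k e D Y) x y z t = ghat a b k e (eval4 D x y z t) (eval4 Y x y z t)"
  by (simp add: eval4_def poly_ghat)

lemma degree_ghat:
  assumes D: "Polynomial.degree D \<le> 1" and Y: "Polynomial.degree Y \<le> 2" and "k \<ge> 3"
  shows "Polynomial.degree (ghat a b k e D Y) \<le> 2 * k + 3 * e"
proof -
  have num: "Polynomial.degree (c * p) \<le> n" if "Polynomial.degree c = 0" "Polynomial.degree p \<le> n"
    for c p :: "'a poly" and n
    using degree_mult_leI[of c 0 p n n] that by simp
  have DD: "Polynomial.degree (D ^ 2) \<le> 2" by (rule degree_power_leI[OF D]) simp
  have 1: "Polynomial.degree (4 * D ^ 2 - 9 * Y) \<le> 2" "Polynomial.degree (4 * D ^ 2 + 3 * Y) \<le> 2"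
    "Polynomial.degree (Y - 4 * D ^ 2) \<le> 2"
    using DD Y by (auto intro!: degree_diff_le degree_add_le num)
  have 2: "Polynomial.degree ((D * (4 * D ^ 2 - 9 * Y)) ^ e) \<le> 3 * e"
    by (rule degree_power_leI[OF degree_mult_leI[OF D 1(1)]]) auto
  have 3: "Polynomial.degree ((4 * D ^ 2 + 3 * Y) ^ j) \<le> 2 * j" for j
    by (rule degree_power_leI[OF 1(2)]) simp
  have "Polynomial.degree (Y * (Y - 4 * D ^ 2) ^ 2) \<le> 6"
    by (rule degree_mult_leI[OF Y degree_power_leI[OF 1(3)]]) auto
  then have hb: "Polynomial.degree (of_int b * (Y * (Y - 4 * D ^ 2) ^ 2) * (4 * D ^ 2 + 3 * Y) ^ (k - 3)) \<le> 2 * k"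
    using assms(3) by (intro degree_mult_leI[OF num 3[of "k - 3"], of _ _ 6]) auto
  have ha: "Polynomial.degree (of_int a * (4 * D ^ 2 + 3 * Y) ^ k) \<le> 2 * k"
    using 3[of k] by (intro num) auto
  show ?thesis
    unfolding ghat_def by (rule degree_mult_leI[OF 2 degree_add_le[OF ha hb]]) simp
qed

definition DD :: "'a::comm_ring_1 \<Rightarrow> 'a \<Rightarrow> 'a \<Rightarrow> 'a \<Rightarrow> 'a" where
  "DD x y z t = (x - z) * (y - t) + (x - t) * (y - z)"

definition YY :: "'a::comm_ring_1 \<Rightarrow> 'a \<Rightarrow> 'a \<Rightarrow> 'a \<Rightarrow> 'a" where
  "YY x y z t = 4 * ((x - y) * (z - t)) ^ 2"

lemma ghat_DD_YY:
  "ghat a b k e (DD x y z t) (YY x y z t) =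
    (4 * (DD x y z t * ((DD x y z t) ^ 2 - 9 * ((x - y) * (z - t)) ^ 2))) ^ e *
    (of_int a * (4 * ((DD x y z t) ^ 2 + 3 * ((x - y) * (z - t)) ^ 2)) ^ k +
     of_int b * (1024 * ((x - y) * (z - t) * ((x - z) * (y - t)) * ((x - t) * (y - z))) ^ 2) *
     (4 * ((DD x y z t) ^ 2 + 3 * ((x - y) * (z - t)) ^ 2)) ^ (k - 3))"
proof -
  define A B C where "A = (x - y) * (z - t)" and "B = (x - z) * (y - t)" and "C = (x - t) * (y - z)"
  have ABC: "A = B - C" by (simp add: A_def B_def C_def algebra_simps)
  have D: "DD x y z t = B + C" and Y: "YY x y z t = 4 * A ^ 2"
    by (simp_all add: DD_def YY_def A_def B_def C_def)
  have "YY x y z t * (YY x y z t - 4 * (DD x y z t) ^ 2) ^ 2 = 1024 * (A * B * C) ^ 2"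
  proof -
    have "4 * A ^ 2 - 4 * (B + C) ^ 2 = - (16 * (B * C))"
      unfolding ABC by (simp add: power2_eq_square algebra_simps)
    then show ?thesis unfolding D Y by (simp add: power_mult_distrib mult_ac)
  qed
  then show ?thesis
    unfolding ghat_def A_def B_def C_def by (simp add: YY_def algebra_simps)
qed

text \<open>A transposition of the points permutes the three resolvent products up to sign. The
  signs disappear in \<open>Q\<close> and \<open>T\<close>, which are made of squares, and in
  \<open>V\<close>, which is a multiple of the product of the three sums.\<close>

lemma ghat_sym:
  fixes x y z t :: rat and a b :: int and k e :: nat
  defines "g \<equiv> \<lambda>x y z t. ghat a b k e (DD x y z t) (YY x y z t)"
  shows "g x y z t = g y x z t" "g x y z t = g x z y t" "g x y z t = g x y t z"
proof -
  define A where "A x y z t = (x - y) * (z - t)" for x y z t :: rat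
  define V where "V x y z t = DD x y z t * ((DD x y z t) ^ 2 - 9 * (A x y z t) ^ 2)" for x y z t
  define Q where "Q x y z t = (DD x y z t) ^ 2 + 3 * (A x y z t) ^ 2" for x y z t
  define T where "T x y z t = (A x y z t * ((x - z) * (y - t)) * ((x - t) * (y - z))) ^ 2" for x y z t
  have g: "g x y z t = (4 * V x y z t) ^ e * (of_int a * (4 * Q x y z t) ^ k +
      of_int b * (1024 * T x y z t) * (4 * Q x y z t) ^ (k - 3))" for x y z t
    by (simp only: g_def ghat_DD_YY A_def V_def Q_def T_def)
  have V: "V y x z t = V x y z t" "V x z y t = V x y z t" "V x y t z = V x y z t"
    by (simp_all add: V_def A_def DD_def power2_eq_square algebra_simps)
  have Q: "Q y x z t = Q x y z t" "Q x z y t = Q x y z t" "Q x y t z = Q x y z t"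
    by (simp_all add: Q_def A_def DD_def power2_eq_square algebra_simps)
  have T: "T y x z t = T x y z t" "T x z y t = T x y z t" "T x y t z = T x y z t"
    unfolding T_def A_def by (rule square_eq_if_neg, simp add: algebra_simps)+
  show "g x y z t = g y x z t" "g x y z t = g x z y t" "g x y z t = g x y t z"
    by (simp_all only: g V Q T)
qed

text \<open>\<open>Y\<close> carries the same constant \<open>h^2 - \<epsilon> p\<close> that
  appears in the defect of a power, so the two leading terms have proportional defects and
  \<open>c\<close> makes them cancel. The remainder is divisible by \<open>delta ^ 4\<close>, which
  an operator of order 2 does not see.\<close>

lemma defect_combination:
  assumes "\<epsilon> = 0 \<or> m + 2 = d"
    and Y: "Y = [:[:4 * (h\<^sup>2 - \<epsilon> * p):]:] * delta ^ 2"
    and c: "ca * int ((m + 2) * (m + 1)) + 8 * cb * (2 * int d - 1) = 0"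
  shows "defect d (of_int ca * [:[:p, - h:], [:- h, \<epsilon>:]:] ^ (m + 2) +
    of_int cb * (Y * [:[:p, - h:], [:- h, \<epsilon>:]:] ^ m) + Y ^ 2 * R) = 0"
proof -
  define D where "D = [:[:p, - h:], [:- h, \<epsilon>:]:]"
  define \<rho> where "\<rho> = h\<^sup>2 - \<epsilon> * p"
  define q where "q = poly D X"
  have "Y * D ^ m = delta ^ 2 * ([:[:4 * \<rho>:]:] * D ^ m)" unfolding Y \<rho>_def by (simp only: mult_ac)
  then have 1: "defect d (Y * D ^ m) = of_int (8 * (4 * int d - 2)) * ([:\<rho>:] * q ^ m)"
    by (simp only: defect_delta_sq_mult poly_mult poly_power q_def[symmetric])
      (simp add: algebra_simps smult_add_left of_int_poly)
  have "Y ^ 2 * R = delta ^ 2 * (delta ^ 2 * ([:[:4 * \<rho>:]:] ^ 2 * R))"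
    unfolding Y \<rho>_def by (simp only: power2_eq_square mult_ac)
  then have 2: "defect d (Y ^ 2 * R) = 0"
    by (simp only: defect_delta_sq_mult poly_mult poly_power poly_delta_X) simp
  have 3: "defect d (D ^ (m + 2)) = of_int (int (2 * (m + 2) * (m + 1))) * ([:\<rho>:] * q ^ m)"
    using defect_bilinear_power[OF assms(1), of p h]
    by (simp add: D_def[symmetric] \<rho>_def[symmetric] q_def mult.assoc)
  have "defect d (of_int ca * D ^ (m + 2) + of_int cb * (Y * D ^ m) + Y ^ 2 * R) =
      of_int (2 * (ca * int ((m + 2) * (m + 1)) + 8 * cb * (2 * int d - 1))) * ([:\<rho>:] * q ^ m)"
    unfolding defect_add defect_of_int_mult 1 2 3
    by (simp add: algebra_simps del: mult_pCons_left mult_pCons_right smult_pCons)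
  also have "\<dots> = 0" unfolding c by simp
  finally show ?thesis by (simp only: D_def)
qed


section \<open>The fourth-order operator in weight 4\<close>

lemma ecoef_lowest:
  assumes "u \<le> 2 * k"
  shows "ecoef d k u (2 * k - u) =
    (-1) ^ u * of_nat (2 * k choose u) / (of_nat (d choose u) * of_nat (d choose (2 * k - u)))"
proof -
  have "ecoef d k u (2 * k - u) = (\<Sum>l\<in>{u}. (-1) ^ l * of_nat (2 * k choose l) *
     (of_nat (u choose l) * of_nat ((2 * k - u) choose (2 * k - l)) /
      (of_nat (d choose l) * of_nat (d choose (2 * k - l)))))"
    unfolding ecoef_def
  proof (rule sum.mono_neutral_right)
    show "\<forall>l\<in>{..2 * k} - {u}. (-1) ^ l * of_nat (2 * k choose l) *
     (of_nat (u choose l) * of_nat ((2 * k - u) choose (2 * k - l)) /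
      (of_nat (d choose l) * of_nat (d choose (2 * k - l)))) = (0 :: rat)"
    proof
      fix l assume "l \<in> {..2 * k} - {u}"
      then have "u < l \<or> 2 * k - u < 2 * k - l" using assms by auto
      then have "(u choose l) = 0 \<or> (2 * k - u choose (2 * k - l)) = 0" by auto
      then show "(-1) ^ l * of_nat (2 * k choose l) *
     (of_nat (u choose l) * of_nat ((2 * k - u) choose (2 * k - l)) /
      (of_nat (d choose l) * of_nat (d choose (2 * k - l)))) = (0 :: rat)" by auto
    qed
  qed (use assms in auto)
  then show ?thesis by simp
qed

lemma esum_2_4:
  fixes B :: "rat poly poly"
  defines "g \<equiv> \<lambda>u v. coeff (coeff B u) v"
  shows "esum d 2 4 B = (g 0 4 + g 4 0) / of_nat (d choose 4) -
    4 * (g 1 3 + g 3 1) / (of_nat d * of_nat (d choose 3)) + 6 * g 2 2 / (of_nat (d choose 2))\<^sup>2"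
proof -
  have "(4::nat) choose 2 = 6" "(4::nat) choose 3 = 4" by (simp_all add: eval_nat_numeral)
  then have e: "ecoef d 2 0 4 = 1 / of_nat (d choose 4)" "ecoef d 2 4 0 = 1 / of_nat (d choose 4)"
    "ecoef d 2 1 3 = - 4 / (of_nat d * of_nat (d choose 3))"
    "ecoef d 2 3 1 = - 4 / (of_nat d * of_nat (d choose 3))"
    "ecoef d 2 2 2 = 6 / (of_nat (d choose 2))\<^sup>2"
    using ecoef_lowest[of 0 2 d] ecoef_lowest[of 1 2 d] ecoef_lowest[of 2 2 d] ecoef_lowest[of 3 2 d]
      ecoef_lowest[of 4 2 d] by (simp_all add: power2_eq_square mult.commute)
  have "{..4} = {0, 1, 2, 3, 4::nat}" by auto
  then have "esum d 2 4 B = ecoef d 2 0 4 * g 0 4 + (ecoef d 2 1 3 * g 1 3 +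
      (ecoef d 2 2 2 * g 2 2 + (ecoef d 2 3 1 * g 3 1 + ecoef d 2 4 0 * g 4 0)))"
    by (simp add: esum_def g_def)
  then show ?thesis
    unfolding e by (simp add: add_divide_distrib algebra_simps)
qed

text \<open>This \<open>D\<close> is the slice of \<open>DD\<close> at the points \<open>1\<close>
  and \<open>- 1\<close>.\<close>

lemma coeff_bilinear_power:
  fixes n :: nat
  defines "D \<equiv> [:[:- 2:], [:0, 2:]:] :: rat poly poly"
  shows "coeff (coeff (D ^ n) i) j = (if i = j then (- 2) ^ n * (- 1) ^ i * of_nat (n choose i) else 0)"
proof (induction n arbitrary: i j)
  case 0
  show ?case by (cases i; cases j) auto
next
  case (Suc n)
  have *: "coeff (coeff (D * P) i) j = - 2 * coeff (coeff P i) j +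
      (if i = 0 \<or> j = 0 then 0 else 2 * coeff (coeff P (i - 1)) (j - 1))" for P i j
    by (cases i; cases j) (simp_all add: D_def)
  show ?case
    unfolding power_Suc[of D] * Suc.IH by (cases i; cases j) (simp_all add: algebra_simps)
qed

text \<open>\<open>harm\<close> secures the second-order equation; the left side of
  \<open>nonzero\<close> is the value of the fourth-order operator in weight 4, divided by
  \<open>(- 2) ^ d\<close>.\<close>

lemma J_piece_neq_4_quartic:
  assumes d: "d = 2 * k + 3 * e" "d \<ge> 6" "k \<ge> 3"
    and g: "\<And>D Y :: rat poly poly. ghat a b k e D Y =
      of_int ca * D ^ d + of_int cb * (Y * D ^ (d - 2)) + Y ^ 2 * (of_int cc * D ^ (d - 4) + Y * R D Y)"
    and harm: "ca * int (d * (d - 1)) + 8 * cb * (2 * int d - 1) = 0"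
    and nonzero: "6 * of_int ca / of_nat (d choose 2) +
      4 * of_int cb * of_nat (d - 2) * (8 / (of_nat d * of_nat (d choose 3)) + 12 / (of_nat (d choose 2))\<^sup>2) +
      16 * of_int cc * (2 / of_nat (d choose 4) + 32 / (of_nat d * of_nat (d choose 3)) +
        36 / (of_nat (d choose 2))\<^sup>2) \<noteq> (0 :: rat)"
  shows "J_piece d 1 4 \<noteq> J_piece d (1 + 1) 4"
proof -
  define P where "P = ghat a b k e (DD Y1 Y2 Y3 Y4) (YY Y1 Y2 Y3 Y4)"
  define D where "D z t = [:[:2 * (z * t), - (z + t):], [:- (z + t), 2:]:]" for z t :: rat
  define Y where "Y z t = [:[:4 * ((z + t)\<^sup>2 - 2 * (2 * (z * t))):]:] * delta ^ 2" for z t :: rat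
  define B where "B z t = ghat a b k e (D z t) (Y z t)" for z t
  have e: "eval4 P x y z t = ghat a b k e (DD x y z t) (YY x y z t)" for x y z t
    by (simp add: P_def eval4_ghat DD_def YY_def eval4_ring eval4_var)
  show ?thesis
  \<comment> \<open>With \<open>z + t = 0\<close> the bilinear form becomes
    \<open>2 (y1 y2 - 1)\<close>, whose powers have diagonal coefficient arrays.\<close>
  proof (rule J_piece_neq_4[where B = B and P = P and w = 4 and z = 1 and t = "- 1"])
    have "Polynomial.degree (DD Y1 Y2 Y3 Y4) \<le> 1"
      unfolding DD_def
      by (intro degree_add_le degree_mult_leI[where m = 1 and n = 0] degree_diff_le) (simp_all add: degree_var)
    moreover have "Polynomial.degree (YY Y1 Y2 Y3 Y4) \<le> 2"
      unfolding YY_def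
      by (intro degree_mult_leI[where m = 0 and n = 2] degree_power_leI[where m = 1 and n = 2]
          degree_mult_leI[where m = 1 and n = 0] degree_diff_le) (simp_all add: degree_var)
    ultimately show "Polynomial.degree P \<le> d"
      unfolding P_def d(1) by (rule degree_ghat) (rule d(3))
    show "eval4 P x y z t = eval4 P y x z t" "eval4 P x y z t = eval4 P x z y t"
      "eval4 P x y z t = eval4 P x y t z" for x y z t
      unfolding e by (rule ghat_sym)+
    show "poly (poly (B z t) [:x:]) y = eval4 P x y z t" for x y z t
    proof -
      have "poly (poly (D z t) [:x:]) y = DD x y z t" by (simp add: D_def DD_def algebra_simps)
      moreover have "poly (poly (Y z t) [:x:]) y = YY x y z t"
        by (simp add: Y_def YY_def poly_delta power2_eq_square algebra_simps)
      ultimately show ?thesis by (simp only: B_def e poly_ghat)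
    qed
    have "defect d (B z t) = 0" for z t
    proof -
      define m where "m = d - 2"
      have m: "d = m + 2" "d - 1 = m + 1" using d(2) by (simp_all add: m_def)
      have "B z t = of_int ca * D z t ^ (m + 2) + of_int cb * (Y z t * D z t ^ m) +
          Y z t ^ 2 * (of_int cc * D z t ^ (d - 4) + Y z t * R (D z t) (Y z t))"
        unfolding B_def g by (simp only: m(1)[symmetric] m_def[symmetric])
      moreover have "ca * int ((m + 2) * (m + 1)) + 8 * cb * (2 * int d - 1) = 0"
        using harm by (simp only: m(2)) (simp only: m(1))
      ultimately show ?thesis
        unfolding D_def using m(1) by (simp only:) (rule defect_combination, auto simp: Y_def)
    qed
    then have "esum d 1 w (B z t) = 0" for w z t using d(2) by (intro esum_1_eq_0) auto
    then show "(\<Sum>u\<le>w. ecoef d k u (w - u) * coeff (coeff (B z t) u) (w - u)) = 0"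
      if "1 \<le> k" "k \<le> 1" for k w z t
      using that by (simp add: esum_def)
    define D0 :: "rat poly poly" where "D0 = [:[:- 2:], [:0, 2:]:]"
    have D0: "D 1 (- 1) = D0" by (simp add: D_def D0_def)
    have Y0: "Y 1 (- 1) = of_int 16 * delta ^ 2" by (simp add: Y_def numeral_poly)
    \<comment> \<open>The part with \<open>Y ^ 3\<close> is divisible by \<open>delta ^ 6\<close>,
      so the fourth-order operator annihilates it and \<open>R\<close> never has to be
      evaluated.\<close>
    have "B 1 (- 1) = of_int ca * D0 ^ d + (of_int cb * (of_int 16 * (delta * (delta * D0 ^ (d - 2)))) +
        (of_int cc * (of_int 256 * (delta ^ 4 * D0 ^ (d - 4))) +
         delta ^ 6 * (of_int 4096 * R D0 (of_int 16 * delta ^ 2))))"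
      unfolding B_def g D0 Y0 by (simp add: algebra_simps power_numeral_reduce)
    then have "esum d 2 4 (B 1 (- 1)) = of_int ca * esum d 2 4 (D0 ^ d) +
        (of_int cb * (16 * esum d 2 4 (delta * (delta * D0 ^ (d - 2)))) +
         (of_int cc * (256 * (esum_const d 2 * coeff (coeff (D0 ^ (d - 4)) 0) 0)) + 0))"
      by (simp only: esum_add esum_of_int_mult esum_delta_power_less[of 2 6] esum_delta_power_eq[of 4 2])
    also have "esum d 2 4 (D0 ^ d) = (- 2) ^ d * (6 / of_nat (d choose 2))"
      using d by (simp add: esum_2_4 coeff_bilinear_power D0_def power2_eq_square)
    also have "esum d 2 4 (delta * (delta * D0 ^ (d - 2))) =
        (- 2) ^ (d - 2) * of_nat (d - 2) * (8 / (of_nat d * of_nat (d choose 3)) + 12 / (of_nat (d choose 2))\<^sup>2)"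
      by (simp add: esum_2_4 coeff_delta_mult coeff_bilinear_power D0_def algebra_simps)
    also have "coeff (coeff (D0 ^ (d - 4)) 0) 0 = (- 2) ^ (d - 4)"
      by (simp add: coeff_bilinear_power D0_def)
    also have "esum_const d 2 = 2 / of_nat (d choose 4) + 32 / (of_nat d * of_nat (d choose 3)) +
        36 / (of_nat (d choose 2))\<^sup>2"
    proof -
      have "{..2 * 2} = {0, 1, 2, 3, 4::nat}" by auto
      moreover have "(4::nat) choose 2 = 6" "(4::nat) choose 3 = 4" by (simp_all add: eval_nat_numeral)
      ultimately show ?thesis by (simp add: esum_const_def power2_eq_square mult.commute)
    qed
    also have "(- 2 :: rat) ^ (d - 2) = (- 2) ^ d / 4"
    proof -
      have "d - 2 + 2 = d" using d(2) by simp
      then show ?thesis using power_add[of "- 2 :: rat" "d - 2" 2] by simp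
    qed
    also have "(- 2 :: rat) ^ (d - 4) = (- 2) ^ d / 16"
    proof -
      have "d - 4 + 4 = d" using d(2) by simp
      then show ?thesis using power_add[of "- 2 :: rat" "d - 4" 4] by simp
    qed
    also have "of_int ca * ((- 2 :: rat) ^ d * (6 / of_nat (d choose 2))) + (of_int cb * (16 *
        ((- 2) ^ d / 4 * of_nat (d - 2) * (8 / (of_nat d * of_nat (d choose 3)) + 12 / (of_nat (d choose 2))\<^sup>2))) +
        (of_int cc * (256 * ((2 / of_nat (d choose 4) + 32 / (of_nat d * of_nat (d choose 3)) +
        36 / (of_nat (d choose 2))\<^sup>2) * ((- 2) ^ d / 16))) + 0)) =
      (- 2) ^ d * (6 * of_int ca / of_nat (d choose 2) +
      4 * of_int cb * of_nat (d - 2) * (8 / (of_nat d * of_nat (d choose 3)) + 12 / (of_nat (d choose 2))\<^sup>2) +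
      16 * of_int cc * (2 / of_nat (d choose 4) + 32 / (of_nat d * of_nat (d choose 3)) +
        36 / (of_nat (d choose 2))\<^sup>2))"
      by (simp add: algebra_simps)
    also have "\<dots> \<noteq> 0" using nonzero by simp
    finally show "(\<Sum>u\<le>4. ecoef d (1 + 1) u (4 - u) * coeff (coeff (B 1 (- 1)) u) (4 - u)) \<noteq> 0"
      unfolding esum_def one_add_one .
  qed (use d in auto)
qed


lemma choose_values:
  "(6::nat) choose 2 = 15" "(6::nat) choose 3 = 20" "(6::nat) choose 4 = 15"
  "(7::nat) choose 2 = 21" "(7::nat) choose 3 = 35" "(7::nat) choose 4 = 35"
  "(8::nat) choose 2 = 28" "(8::nat) choose 3 = 56" "(8::nat) choose 4 = 70"
  "(9::nat) choose 2 = 36" "(9::nat) choose 3 = 84" "(9::nat) choose 4 = 126"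
  "(10::nat) choose 2 = 45" "(10::nat) choose 3 = 120" "(10::nat) choose 4 = 210"
  "(11::nat) choose 2 = 55" "(11::nat) choose 3 = 165" "(11::nat) choose 4 = 330"
  by (simp_all add: eval_nat_numeral)

text \<open>The value 7 is missing because \<open>7 = 2 * k + 3 * e\<close> has no solution with
  \<open>k \<ge> 3\<close>.\<close>

lemma J_piece_neq_4_small:
  assumes "d \<in> {6, 8, 9, 10, 11}"
  shows "J_piece d 1 4 \<noteq> J_piece d (1 + 1) 4"
proof -
  from assms consider "d = 6" | "d = 8" | "d = 9" | "d = 10" | "d = 11" by blast
  then show ?thesis
  proof cases
    case 1
    show ?thesis unfolding 1
      by (rule J_piece_neq_4_quartic[where k = 3 and e = 0 and a = 11 and b = "- 114"
            and ca = 704 and cb = "- 240" and cc = "2100" and R = "\<lambda>D Y. 183"])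
        (simp_all add: ghat_instances(1) choose_values)
  next
    case 2
    show ?thesis unfolding 2
      by (rule J_piece_neq_4_quartic[where k = 4 and e = 0 and a = 15 and b = "- 208"
            and ca = 3840 and cb = "- 1792" and cc = "9632" and R = "\<lambda>D Y. 10640 * D ^ 2 + 591 * Y"])
        (simp_all add: ghat_instances(3) choose_values)
  next
    case 3
    show ?thesis unfolding 3
      by (rule J_piece_neq_4_quartic[where k = 3 and e = 1 and a = 17 and b = "- 36"
            and ca = 4352 and cb = "- 2304" and cc = "- 8352" and R = "\<lambda>D Y. - 17424 * D ^ 3 - 3807 * (Y * D)"])
        (simp_all add: ghat_instances(4)[unfolded One_nat_def] choose_values)
  next
    case 4
    show ?thesis unfolding 4
      by (rule J_piece_neq_4_quartic[where k = 5 and e = 0 and a = 19 and b = "- 330"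
            and ca = 19456 and cb = "- 11520" and cc = "24960"
            and R = "\<lambda>D Y. 92640 * D ^ 4 + 46620 * (Y * D ^ 2) + 1647 * Y ^ 2"])
        (simp_all add: ghat_instances(5) choose_values)
  next
    case 5
    show ?thesis unfolding 5
      by (rule J_piece_neq_4_quartic[where k = 4 and e = 1 and a = 21 and b = "- 118"
            and ca = 21504 and cb = "- 14080" and cc = "- 12160"
            and R = "\<lambda>D Y. - 100576 * D ^ 5 - 97500 * (Y * D ^ 3) - 12123 * (Y ^ 2 * D)"])
        (simp_all add: ghat_instances(6)[unfolded One_nat_def] choose_values)
  qed
qed

text \<open>The limit \<open>y\<^sub>4 \<rightarrow> \<infinity>\<close> of the previous construction.\<close>

lemma ghat_sym3:
  fixes x y z :: rat and a b :: int and k e :: nat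
  defines "g \<equiv> \<lambda>x y z. ghat a b k 0 (x + y - 2 * z) (4 * (x - y) ^ 2)"
  shows "g x y z = g y x z" "g x y z = g x z y"
proof -
  define Q where "Q x y z = 16 * (x\<^sup>2 + y\<^sup>2 + z\<^sup>2 - x * y - y * z - x * z)" for x y z :: rat
  define T where "T x y z = 1024 * ((x - y) * (x - z) * (y - z)) ^ 2" for x y z :: rat
  have g: "g x y z = of_int a * Q x y z ^ k + of_int b * T x y z * Q x y z ^ (k - 3)" for x y z
  proof -
    have "4 * (x + y - 2 * z) ^ 2 + 3 * (4 * (x - y) ^ 2) = Q x y z"
      by (simp add: Q_def power2_eq_square algebra_simps)
    moreover have "4 * (x - y) ^ 2 * (4 * (x - y) ^ 2 - 4 * (x + y - 2 * z) ^ 2) ^ 2 = T x y z"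
    proof -
      have "4 * (x - y) ^ 2 - 4 * (x + y - 2 * z) ^ 2 = - (16 * ((x - z) * (y - z)))"
        by (simp add: power2_eq_square algebra_simps)
      moreover have "4 * p ^ 2 * (- (16 * r)) ^ 2 = 1024 * (p * r) ^ 2" for p r :: rat
        by (simp add: power2_eq_square)
      ultimately show ?thesis by (simp only: T_def mult.assoc)
    qed
    ultimately show ?thesis by (simp add: g_def ghat_def)
  qed
  have "Q y x z = Q x y z" "Q x z y = Q x y z" by (simp_all add: Q_def algebra_simps)
  moreover have "T y x z = T x y z" "T x z y = T x y z"
    unfolding T_def by (rule arg_cong[where f = "\<lambda>a. 1024 * a"], rule square_eq_if_neg, simp add: algebra_simps)+
  ultimately show "g x y z = g y x z" "g x y z = g x z y"
    by (simp_all only: g)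
qed

text \<open>With the fourth point at infinity \<open>D\<close> is the linear form
  \<open>y1 + y2 - 2 y3\<close>. Then \<open>\<epsilon> = 0\<close>, and its exponent 6 need not
  equal \<open>d = 7\<close>.\<close>

lemma J_piece_neq_3_septic: "J_piece 7 1 3 \<noteq> J_piece 7 (1 + 1) 3"
proof -
  define P where "P = ghat 13 (- 132) 3 0 (Y1 + Y2 - 2 * Y3) (4 * (Y1 - Y2) ^ 2)"
  \<comment> \<open>Written so as to match \<open>defect_combination\<close> with
    \<open>h = - 1\<close> and \<open>\<epsilon> = 0\<close>.\<close>
  define D where "D z = [:[:- 2 * z, - (- 1):], [:- (- 1), 0:]:]" for z :: rat
  define Y :: "rat poly poly" where "Y = [:[:4:]:] * delta ^ 2"
  define B where "B z = ghat 13 (- 132) 3 0 (D z) Y" for z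
  have e: "eval4 P x y z t = ghat 13 (- 132) 3 0 (x + y - 2 * z) (4 * (x - y) ^ 2)" for x y z t
    by (simp add: P_def eval4_ghat eval4_ring eval4_var)
  show ?thesis
  \<comment> \<open>This \<open>z\<close> turns the linear form into \<open>1 + y1 + y2\<close>,
    whose powers are easy to expand.\<close>
  proof (rule J_piece_neq_3[where B = "\<lambda>z t. B z" and P = P and w = 4 and z = "- 1 / 2"])
    have "Polynomial.degree (Y1 + Y2 - 2 * Y3) \<le> 1"
      by (intro degree_add_le degree_mult_leI[where m = 0 and n = 0] degree_diff_le) (simp_all add: degree_var)
    moreover have "Polynomial.degree (4 * (Y1 - Y2) ^ 2) \<le> 2"
      by (intro degree_mult_leI[where m = 0 and n = 2] degree_power_leI[where m = 1 and n = 2]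
          degree_diff_le) (simp_all add: degree_var)
    ultimately have "Polynomial.degree P \<le> 2 * 3 + 3 * 0"
      unfolding P_def by (rule degree_ghat) simp
    then show "Polynomial.degree P \<le> 7" by simp
    show "eval4 P x y z t = eval4 P y x z t" "eval4 P x y z t = eval4 P x z y t" for x y z t
      unfolding e by (rule ghat_sym3)+
    show "poly (poly (B z) [:x:]) y = eval4 P x y z t" for x y z t
      by (simp add: B_def e poly_ghat D_def Y_def poly_delta algebra_simps)
    have "defect 7 (B z) = 0" for z
    proof -
      have "B z = of_int 832 * D z ^ (4 + 2) + of_int (- 240) * (Y * D z ^ 4) +
          Y ^ 2 * (of_int 2460 * D z ^ 2 + Y * 219)"
        unfolding B_def ghat_instances(2) by simp
      then show ?thesis
        unfolding D_def by (simp only:) (rule defect_combination, auto simp: Y_def)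
    qed
    then have "esum 7 1 w (B z) = 0" for w z by (intro esum_1_eq_0) auto
    then show "(\<Sum>u\<le>w. ecoef 7 k u (w - u) * coeff (coeff (B z) u) (w - u)) = 0"
      if "1 \<le> k" "k \<le> 1" for k w z
      using that by (simp add: esum_def)
    have D0: "D (- 1 / 2) = [:[:1, 1:], [:1:]:]" by (simp add: D_def)
    have Y0: "Y = of_int 4 * delta ^ 2" by (simp add: Y_def numeral_poly)
    let ?D = "[:[:1, 1:], [:1:]:] :: rat poly poly"
    have "B (- 1 / 2) = of_int 832 * ?D ^ 6 + (of_int (- 960) * (delta * (delta * ?D ^ 4)) +
        (of_int 39360 * (delta * (delta * (delta * (delta * ?D ^ 2)))) + delta ^ 6 * 14016))"
    proof -
      have "of_int 832 * E ^ 6 + of_int (- 240) * (of_int 4 * c ^ 2 * E ^ 4) +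
          (of_int 4 * c ^ 2) ^ 2 * (of_int 2460 * E ^ 2 + of_int 4 * c ^ 2 * 219) =
        of_int 832 * E ^ 6 + (of_int (- 960) * (c * (c * E ^ 4)) +
          (of_int 39360 * (c * (c * (c * (c * E ^ 2)))) + c ^ 6 * 14016))" for c E :: "rat poly poly"
        by (simp add: algebra_simps power_numeral_reduce)
      then show ?thesis unfolding B_def ghat_instances(2) D0 Y0 .
    qed
    then have "esum 7 2 4 (B (- 1 / 2)) = 832 * esum 7 2 4 (?D ^ 6) +
        (- 960 * esum 7 2 4 (delta * (delta * ?D ^ 4)) +
        (39360 * esum 7 2 4 (delta * (delta * (delta * (delta * ?D ^ 2)))) + 0))"
      by (simp only: esum_add esum_of_int_mult esum_delta_power_less[of 2 6])
    also have "\<dots> \<noteq> 0"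
      unfolding esum_2_4 choose_values
      by (simp add: delta_def power_numeral_reduce) (simp add: eval_nat_numeral)
    finally show "(\<Sum>u\<le>4. ecoef 7 (1 + 1) u (4 - u) * coeff (coeff (B (- 1 / 2)) u) (4 - u)) \<noteq> 0"
      unfolding esum_def one_add_one .
  qed auto
qed

theorem theorem1p3:
  fixes q b N d :: nat
  assumes "(q, b, N) \<in> {(1, 3, 6), (1, 4, 8), (2, 3, 12), (3, 3, 16)}"
    and "d \<ge> N"
  shows "alpha d q > b"
proof -
  \<comment> \<open>The case \<open>d = 6\<close> is included for the triple
    \<open>(1, 3, 6)\<close>, which then lacks only \<open>d = 7\<close>.\<close>
  have four: "alpha d 1 > 4" if "d = 6 \<or> d \<ge> 8"
  proof (rule alpha_gt)
    show "J_piece d 1 4 \<noteq> J_piece d (1 + 1) 4"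
    proof (cases "d \<ge> 12")
      case True
      then show ?thesis by (intro J_piece_neq_4_vandermonde) auto
    next
      case False
      then show ?thesis using that by (intro J_piece_neq_4_small) auto
    qed
  qed (use that in auto)
  have seven: "alpha 7 1 > 3" by (rule alpha_gt[OF _ _ J_piece_neq_3_septic]) auto
  have three: "alpha d q > 3" if "q \<ge> 1" "d \<ge> 4 * (q + 1)"
    using that by (intro alpha_gt J_piece_neq_3_vandermonde) auto
  from assms consider "q = 1" "b = 3" "d \<ge> 6" | "q = 1" "b = 4" "d \<ge> 8"
    | "q = 2" "b = 3" "d \<ge> 12" | "q = 3" "b = 3" "d \<ge> 16" by auto
  then show ?thesis
  proof cases
    case 1
    then consider "d = 7" | "d = 6 \<or> d \<ge> 8" by linarith
    then show ?thesis using 1 seven four by cases auto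
  qed (use four three in auto)
qed

end
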